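(* Let $u$ be the solution of $\Delta u=0$ in $D\setminus\overline T$, $u=c$ on $\partial T$, with the Robin boundary condition $z\,\nu\cdot\nabla u+u=\phi$ on $\partial D$, where $\phi$ is a smooth function. Let $\{\mathbf X_j\}_{j\in\mathbb N_0}$ be the Markov chain with transition kernel $P$ (defined in the context) and initial distribution $\mathbf X_0\sim\delta_{x_0}$, $x_0\in\overline D\setminus T$. Then the partially reflecting random walk on spheres estimator $$\check u(x_0,\omega)=\sum_{j=0}^{\infty}F(\mathbf X_j(\omega))$$ is convergent and unbiased (that is, $\mathbb E_{x_0}[\check u(x_0,\cdot)]=u(x_0)$). Moreover, there exists a constant $C>0$, independent of $x_0$, such that $$\mathrm{Var}[\check u(x_0,\cdot)]\le C\,\|F\|_{L^\infty(\overline D\setminus T)}^2 .$$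
   Context: Domain and boundary value problem. $D\subset\mathbb R^2$ is a bounded convex domain with piecewise smooth boundary $\partial D$ and connected complement, with outer unit normal $\nu$. $T$ is a simply connected (open) region inside $D$, $\overline T\subset D$, with smooth boundary $\partial T$. $z>0$ is a constant (contact impedance), $c\in\mathbb R$ is a constant assumed known, and $\phi:\partial D\to\mathbb R$. Layers. For $\varepsilon>0$ put $D_\varepsilon=\{x\in\overline D: d(x,\partial D)\le\varepsilon\}$ and $T_\varepsilon=\{x\in\overline D\setminus T: d(x,\partial T)\le\varepsilon\}$ ($d$ = Euclidean distance). $\varepsilon$ is small enough that $D_\varepsilon\cap T_\varepsilon=\emptyset$. $\pi_{\partial D}(x)$ and $\pi_{\partial T}(x)$ denote the normal projections onto $\partial D$ and $\partial T$. Stencil and stepsize. For $x\in D_\varepsilon$ let $e_1=e_1(x)$ be the inward unit normal $-\nu(\pi_{\partial D}(x))$ and $e_2=e_2(x)$ a unit vector orthogonal to $e_1$. A stepsize $h>0$ is given, small enough that the stencil points $x+he_1,\ x+2he_1,\ x+h(e_1+e_2),\ x+h(e_1-e_2)$, $x\in D_\varepsilon$, do not lie in $T$. If, at a given $x\in D_\varepsilon$, one of these points lies outside of $\overline D$, then $h$ is reduced at that $x$ until all of them lie in $\overline D$. In everything below, $h$ at a point $x\in D_\varepsilon$ denotes this (possibly locally reduced) stepsize, so it may depend on $x$. Put $$R_hu(x)=\tfrac12\big(u(x+h(e_1+e_2))+u(x+h(e_1-e_2))\big),\qquad p_a(x)=\frac{h}{h+z}.$$ Kernel. For $x\in\overline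 D\setminus T$ define the measure on $\overline D\setminus T$ $$k(x,\mathrm dy)=\begin{cases}(1-p_a(x))\,P_{h(e_1\pm e_2)}(x,\mathrm dy), & x\in D_\varepsilon,\\ 0,& x\in T_\varepsilon,\\ P_{\overline D\setminus T}(x,\mathrm dy),&\text{else,}\end{cases}$$ where $P_{h(e_1\pm e_2)}(x,\cdot)$ puts mass $\tfrac12$ on each of the points $x+h(e_1+e_2)$ and $x+h(e_1-e_2)$, and $P_{\overline D\setminus T}(x,\cdot)$ is the uniform distribution on the circle centered at $x$ with radius $d(x,\partial D\cup\partial T)$ (one step of the random walk on spheres in $\overline D\setminus T$). Inhomogeneity. The score function is $s(x)=\chi_{D_\varepsilon}(x)\,\dfrac{h\,\phi(\pi_{\partial D}(x))}{h+z}$, with $\chi_{D_\varepsilon}$ the indicator function of $D_\varepsilon$. Define $$F(x)=\begin{cases}s(x)+h\,r_1(x),& x\in D_\varepsilon,\\ u(\pi_{\partial T}(x))+r_0(x),& x\in T_\varepsilon,\\ 0,&\text{else,}\end{cases}$$ where $r_1,r_0$ are the local errors (of order $r_1=\mathcal O(h^2+\varepsilon/h)$ and $r_0=\mathcal O(\varepsilon)$), namely $h\,r_1(x)=u(x)-\frac{z}{h+z}R_hu(x)-\frac{h\,\phi(\pi_{\partial D}(x))}{h+z}$ for $x\in D_\varepsilon$ and $r_0(x)=u(x)-u(\pi_{\partial T}(x))$ for $x\in T_\varepsilon$ (note $u(\pi_{\partial T}(x))=c$). Thus $u(x)=\int_{\overline D\setminus T}u(y)\,k(x,\mathrm dy)+F(x)$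 for $x\in\overline D\setminus T$. Markov chain. $\{\mathbf X_j\}_{j\in\mathbb N_0}$ is the time-homogeneous Markov chain on $(\overline D\setminus T)\cup\{\partial\}$, where $\partial$ is an isolated absorbing cemetery point, with transition kernel $P(x,B)=\int_Bk(x,\mathrm dy)$ for Borel $B\subset\overline D\setminus T$, $x\in\overline D\setminus T$, the missing mass $1-k(x,\overline D\setminus T)$ being the probability to jump to $\partial$. Its lifetime is $\zeta$, i.e. $\mathbf X_j=\partial$ for all $j\ge\zeta$. $\mathbb P_{x_0}$, $\mathbb E_{x_0}$ denote probability and expectation for the chain started in $x_0$. The convention $F(\partial)=0$ is used, so that $\check u(x_0,\omega)=\sum_{j<\zeta(\omega)}F(\mathbf X_j(\omega))$. *)

theory Defs
  imports "HOL-Analysis.Analysis" "HOL-Probability.Probability"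
begin

text \<open>
  The plane is the type \<^typ>\<open>complex\<close>, whose norm, inner product and Lebesgue measure are those of
  the Euclidean plane; it is the type for which the library develops planar topology.
\<close>

text \<open>\<open>Ck_on k f S\<close> is meant for open sets \<open>S\<close>.\<close>

primrec Ck_on :: "nat \<Rightarrow> ('a::euclidean_space \<Rightarrow> 'b::real_normed_vector) \<Rightarrow> 'a set \<Rightarrow> bool" where
  "Ck_on 0 f S \<longleftrightarrow> continuous_on S f"
| "Ck_on (Suc k) f S \<longleftrightarrow>
     f differentiable_on S \<and> (\<forall>b\<in>Basis. Ck_on k (\<lambda>x. frechet_derivative f (at x) b) S)"

definition smooth_on :: "('a::euclidean_space \<Rightarrow> 'b::real_normed_vector) \<Rightarrow> 'a set \<Rightarrow> bool" where
  "smooth_on f S \<longleftrightarrow> (\<forall>k. Ck_on k f S)"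

definition laplacian :: "('a::euclidean_space \<Rightarrow> real) \<Rightarrow> 'a \<Rightarrow> real" where
  "laplacian f x =
     (\<Sum>b\<in>Basis. frechet_derivative (\<lambda>y. frechet_derivative f (at y) b) (at x) b)"

definition smooth_closed_curve :: "complex set \<Rightarrow> bool" where
  "smooth_closed_curve J \<longleftrightarrow>
     (\<exists>\<gamma> :: real \<Rightarrow> complex. smooth_on \<gamma> UNIV \<and> (\<forall>t. \<gamma> (t + 1) = \<gamma> t) \<and>
        (\<forall>t. vector_derivative \<gamma> (at t) \<noteq> 0) \<and> inj_on \<gamma> {0..<1} \<and> J = range \<gamma>)"

text \<open>
  A closed Jordan curve composed of finitely many regular smooth arcs, smooth up to their end points.
\<close>

definition piecewise_smooth_closed_curve :: "complex set \<Rightarrow> bool" where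
  "piecewise_smooth_closed_curve J \<longleftrightarrow>
     (\<exists>(\<gamma> :: real \<Rightarrow> complex) (p :: nat \<Rightarrow> real) n.
        simple_path \<gamma> \<and> pathfinish \<gamma> = pathstart \<gamma> \<and> path_image \<gamma> = J \<and>
        p 0 = 0 \<and> p n = 1 \<and>
        (\<forall>i<n. p i < p (Suc i) \<and>
           (\<exists>\<sigma> :: real \<Rightarrow> complex. smooth_on \<sigma> UNIV \<and>
              (\<forall>t\<in>{p i..p (Suc i)}. \<sigma> t = \<gamma> t \<and> vector_derivative \<sigma> (at t) \<noteq> 0))))"

text \<open>
  Outer unit normals of a convex set \<open>D\<close> at a boundary point \<open>y\<close>. At a point where the boundary has
  a tangent there is exactly one; at a corner there are several.
\<close>

definition outer_unit_normal :: "complex set \<Rightarrow> complex \<Rightarrow> complex \<Rightarrow> bool" where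
  "outer_unit_normal D y n \<longleftrightarrow> norm n = 1 \<and> (\<forall>w\<in>D. (w - y) \<bullet> n \<le> 0)"

definition smooth_boundary_function :: "complex set \<Rightarrow> (complex \<Rightarrow> real) \<Rightarrow> bool" where
  "smooth_boundary_function D \<phi> \<longleftrightarrow>
     (\<exists>\<Phi> :: complex \<Rightarrow> real. smooth_on \<Phi> UNIV \<and> (\<forall>y\<in>frontier D. \<Phi> y = \<phi> y))"

text \<open>
  Classical solution, continuously differentiable up to the boundary: \<open>G\<close> is the gradient of \<open>u\<close>
  extended continuously to the boundary. The Robin condition is required where the normal
  is defined, that is, away from the corners.
\<close>

definition robin_solution ::
  "complex set \<Rightarrow> complex set \<Rightarrow> real \<Rightarrow> real \<Rightarrow> (complex \<Rightarrow> complex) \<Rightarrow> (complex \<Rightarrow> real) \<Rightarrow>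
   (complex \<Rightarrow> real) \<Rightarrow> bool" where
  "robin_solution D T z c \<nu> \<phi> u \<longleftrightarrow>
     Ck_on 2 u (D - closure T) \<and> (\<forall>x\<in>D - closure T. laplacian u x = 0) \<and>
     continuous_on (closure D - T) u \<and> (\<forall>y\<in>frontier T. u y = c) \<and>
     (\<exists>G :: complex \<Rightarrow> complex. continuous_on (closure D - T) G \<and>
        (\<forall>x\<in>D - closure T. (u has_derivative (\<lambda>v. G x \<bullet> v)) (at x)) \<and>
        (\<forall>y\<in>frontier D. (\<exists>!n. outer_unit_normal D y n) \<longrightarrow> z * (\<nu> y \<bullet> G y) + u y = \<phi> y))"


text \<open>The state space \<open>E\<close> with the cemetery \<^const>\<open>None\<close> adjoined as an isolated point.\<close>

definition cemetery_space :: "'a::topological_space set \<Rightarrow> 'a option measure" where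
  "cemetery_space E =
     sigma (insert None (Some ` E)) {B. B \<subseteq> insert None (Some ` E) \<and> Some -` B \<in> sets borel}"

definition transition :: "'a set \<Rightarrow> ('a \<Rightarrow> 'a measure) \<Rightarrow> 'a option \<Rightarrow> 'a option set \<Rightarrow> ennreal" where
  "transition E k s B =
     (case s of
        None \<Rightarrow> indicator B None
      | Some x \<Rightarrow> emeasure (k x) (Some -` B) + (1 - emeasure (k x) E) * indicator B None)"

definition markov_chain ::
  "'w measure \<Rightarrow> (nat \<Rightarrow> 'w \<Rightarrow> 'a::topological_space option) \<Rightarrow> 'a set \<Rightarrow> ('a \<Rightarrow> 'a measure) \<Rightarrow> 'a \<Rightarrow> bool"
  where
  "markov_chain M X E k x0 \<longleftrightarrow>
     prob_space M \<and> (\<forall>j. X j \<in> measurable M (cemetery_space E)) \<and>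
     (AE \<omega> in M. X 0 \<omega> = Some x0) \<and>
     (\<forall>n. \<forall>A\<in>sets (PiM {..n} (\<lambda>_. cemetery_space E)). \<forall>B\<in>sets (cemetery_space E).
        emeasure M {\<omega>\<in>space M. (\<lambda>j\<in>{..n}. X j \<omega>) \<in> A \<and> X (Suc n) \<omega> \<in> B} =
        (\<integral>\<^sup>+\<omega>. indicator A (\<lambda>j\<in>{..n}. X j \<omega>) * transition E k (X n \<omega>) B \<partial>M))"


definition outer_layer :: "complex set \<Rightarrow> real \<Rightarrow> complex set" where
  "outer_layer D \<epsilon> = {x \<in> closure D. infdist x (frontier D) \<le> \<epsilon>}"

definition inner_layer :: "complex set \<Rightarrow> complex set \<Rightarrow> real \<Rightarrow> complex set" where
  "inner_layer D T \<epsilon> = {x \<in> closure D - T. infdist x (frontier T) \<le> \<epsilon>}"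

definition stencil :: "complex \<Rightarrow> complex \<Rightarrow> real \<Rightarrow> complex \<Rightarrow> complex set" where
  "stencil e1 e2 t x =
     {x + t *\<^sub>R e1, x + (2 * t) *\<^sub>R e1, x + t *\<^sub>R (e1 + e2), x + t *\<^sub>R (e1 - e2)}"

text \<open>
  \<open>\<pi>D\<close> and \<open>\<pi>T\<close> are the projections onto the boundaries of \<open>D\<close> and \<open>T\<close>; where the nearest boundary
  point is not unique (in a convex domain with corners this happens arbitrarily close to the
  boundary) and where the normal is not unique (at corners), any choice is allowed as long as the
  direction \<open>\<nu> \<circ> \<pi>D\<close> is a Borel function.

  \<open>h0\<close> is the given stepsize and \<open>h x\<close> the stepsize used at \<open>x\<close>. Reducing \<open>h0\<close> at \<open>x\<close> until
  the stencil lies in the closure of \<open>D\<close> yields the largest admissible stepsize, if the reduction is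
  continuous, or the largest one up to a fixed factor, if the stepsize is e.g. repeatedly halved.
  Assumption \<open>reduced\<close> covers both; it does not bound \<open>h\<close> away from zero near corners. It
  excludes needless reductions: with those, the walk could survive forever inside the layer.
\<close>

locale reflecting_walk =
  fixes D T :: "complex set" and \<epsilon> z :: real
    and \<nu> \<pi>D \<pi>T :: "complex \<Rightarrow> complex"
    and h0 :: real and h :: "complex \<Rightarrow> real" and e2 :: "complex \<Rightarrow> complex"
  assumes D: "open D" "convex D" "bounded D" "D \<noteq> {}" "connected (- D)"
      "piecewise_smooth_closed_curve (frontier D)"
    and T: "open T" "T \<noteq> {}" "simply_connected T" "closure T \<subseteq> D" "smooth_closed_curve (frontier T)"
    and z: "z > 0"
    and \<epsilon>: "\<epsilon> > 0" "outer_layer D \<epsilon> \<inter> inner_layer D T \<epsilon> = {}"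
    and normal: "\<And>y. y \<in> frontier D \<Longrightarrow> outer_unit_normal D y (\<nu> y)"
    and proj_D: "\<And>x. x \<in> outer_layer D \<epsilon> \<Longrightarrow>
      \<pi>D x \<in> frontier D \<and> dist x (\<pi>D x) = infdist x (frontier D)"
    and proj_T: "\<And>x. x \<in> inner_layer D T \<epsilon> \<Longrightarrow>
      \<pi>T x \<in> frontier T \<and> dist x (\<pi>T x) = infdist x (frontier T)"
    and tangent: "\<And>x. x \<in> outer_layer D \<epsilon> \<Longrightarrow> norm (e2 x) = 1 \<and> e2 x \<bullet> \<nu> (\<pi>D x) = 0"
    and h0: "h0 > 0"
    and step: "\<And>x. x \<in> outer_layer D \<epsilon> \<Longrightarrow>
      0 < h x \<and> h x \<le> h0 \<and> stencil (- \<nu> (\<pi>D x)) (e2 x) (h x) x \<subseteq> closure D - T"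
    and unreduced: "\<And>x. x \<in> outer_layer D \<epsilon> \<Longrightarrow>
      stencil (- \<nu> (\<pi>D x)) (e2 x) h0 x \<subseteq> closure D \<Longrightarrow> h x = h0"
    and reduced: "\<exists>\<kappa>>0. \<forall>x\<in>outer_layer D \<epsilon>. \<forall>t\<in>{0<..h0}.
      stencil (- \<nu> (\<pi>D x)) (e2 x) t x \<subseteq> closure D \<longrightarrow> \<kappa> * t \<le> h x"
    and measurable_direction:
      "(\<lambda>x. \<nu> (\<pi>D x)) \<in> borel_measurable (restrict_space borel (outer_layer D \<epsilon>))"
    and measurable_step: "h \<in> borel_measurable (restrict_space borel (outer_layer D \<epsilon>))"
begin

definition e1 :: "complex \<Rightarrow> complex" where
  "e1 x = - \<nu> (\<pi>D x)"

definition R :: "(complex \<Rightarrow> real) \<Rightarrow> complex \<Rightarrow> real" where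
  "R u x = 1 / 2 * (u (x + h x *\<^sub>R (e1 x + e2 x)) + u (x + h x *\<^sub>R (e1 x - e2 x)))"

definition p_a :: "complex \<Rightarrow> real" where
  "p_a x = h x / (h x + z)"

definition stencil_step :: "complex \<Rightarrow> complex measure" where
  "stencil_step x =
     distr (measure_pmf (bernoulli_pmf (1 / 2))) borel
       (\<lambda>b. if b then x + h x *\<^sub>R (e1 x + e2 x) else x + h x *\<^sub>R (e1 x - e2 x))"

definition sphere_step :: "complex \<Rightarrow> complex measure" where
  "sphere_step x =
     distr (uniform_measure lborel {0..2 * pi}) borel
       (\<lambda>\<theta>. x + infdist x (frontier D \<union> frontier T) *\<^sub>R cis \<theta>)"

definition k :: "complex \<Rightarrow> complex measure" where
  "k x =
     (if x \<in> outer_layer D \<epsilon> then scale_measure (ennreal (1 - p_a x)) (stencil_step x)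
      else if x \<in> inner_layer D T \<epsilon> then null_measure borel
      else sphere_step x)"

definition score :: "(complex \<Rightarrow> real) \<Rightarrow> complex \<Rightarrow> real" where
  "score \<phi> x = indicator (outer_layer D \<epsilon>) x * (h x * \<phi> (\<pi>D x) / (h x + z))"

definition r1 :: "(complex \<Rightarrow> real) \<Rightarrow> (complex \<Rightarrow> real) \<Rightarrow> complex \<Rightarrow> real" where
  "r1 \<phi> u x = (u x - z / (h x + z) * R u x - h x * \<phi> (\<pi>D x) / (h x + z)) / h x"

definition r0 :: "(complex \<Rightarrow> real) \<Rightarrow> complex \<Rightarrow> real" where
  "r0 u x = u x - u (\<pi>T x)"

definition F :: "(complex \<Rightarrow> real) \<Rightarrow> (complex \<Rightarrow> real) \<Rightarrow> complex \<Rightarrow> real" where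
  "F \<phi> u x =
     (if x \<in> outer_layer D \<epsilon> then score \<phi> x + h x * r1 \<phi> u x
      else if x \<in> inner_layer D T \<epsilon> then u (\<pi>T x) + r0 u x
      else 0)"

definition F_ext :: "(complex \<Rightarrow> real) \<Rightarrow> (complex \<Rightarrow> real) \<Rightarrow> complex option \<Rightarrow> real" where
  "F_ext \<phi> u s = (case s of None \<Rightarrow> 0 | Some x \<Rightarrow> F \<phi> u x)"

definition estimator ::
  "(complex \<Rightarrow> real) \<Rightarrow> (complex \<Rightarrow> real) \<Rightarrow> (nat \<Rightarrow> 'w \<Rightarrow> complex option) \<Rightarrow> 'w \<Rightarrow> real" where
  "estimator \<phi> u X \<omega> = (\<Sum>j. F_ext \<phi> u (X j \<omega>))"

end

end

theory Submission
  imports Defs "HOL-Complex_Analysis.Complex_Analysis"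
begin

text \<open>
  Let \<open>p\<close> be the killing probability of the walk: \<open>h / (h + z)\<close> in the outer layer, \<open>1\<close> in the inner
  layer, \<open>0\<close> elsewhere. Since \<open>p = 1 - K 1\<close> for the transition operator \<open>K\<close>, the potential
  \<open>\<Sum>\<^sub>n K\<^sup>n p\<close> telescopes to at most \<open>1\<close>. As \<open>u\<close> is bounded and Lipschitz near the outer boundary,
  \<open>\<bar>F\<bar> \<le> C p\<close>, whence \<open>\<Sum>\<^sub>j \<bar>F (X\<^sub>j)\<bar>\<close> has expectation at most \<open>C\<close> and second moment at most
  \<open>2 C\<^sup>2\<close>, although the expected lifetime need not be bounded (\<open>h\<close> degenerates at corners).

  The mean value property gives \<open>u = K u + F\<close>, and the estimator is unbiased because the walk is
  absorbed almost surely. Let \<open>w\<close> be the survival probability and \<open>m\<close> its supremum. Away from the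
  layers the walk reaches the inner layer in \<open>N\<close> steps with a probability bounded below by some
  \<open>\<delta> > 0\<close>, so \<open>w \<le> (1 - \<delta>) m\<close> there. If \<open>w x > (1 - \<delta>) m\<close> at a point of the outer layer, following the more
  viable of the two stencil points yields a path that never leaves the outer layer and along which
  \<open>\<Sum> h < \<infinity>\<close>; convexity of \<open>D\<close> excludes such paths. Hence \<open>m \<le> (1 - \<delta>) m\<close>, that is, \<open>m = 0\<close>.

  The constant may depend on \<open>u\<close>: if the essential supremum of \<open>F\<close> is positive, it absorbs the
  quotient of the two bounds; if it vanishes, then \<open>u = 0\<close> in the inner layer, hence everywhere by
  unique continuation, and \<open>F = 0\<close>.
\<close>

section \<open>Planar harmonic functions\<close>

text \<open>The bound on the second moment comes from conditioning on the earlier of two times: the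
  rest of the sum is again a potential, with the same bound from every starting point. Absorption
  rests on a 45 degree geometry. The steps \<open>e1 + e2\<close> and \<open>e1 - e2\<close> point
  along \<open>e1\<close> turned by 45 degrees to either side. If a trapped path converges to a
  boundary point \<open>x\<close>, both stencil points of \<open>x\<close> lie in
  \<open>closure D\<close>, which confines the inward normals near \<open>x\<close> to within 45
  degrees of \<open>e1 x\<close>; neither step can then lower the height over the supporting line at
  \<open>x\<close>. A nonnegative height that increases to 0 vanishes, so the path ends up in this
  line. There each of its points is an extreme of the path, and the steps would have to jump back
  and forth between two fixed ends. The norm of \<open>F\<close> ignores null sets, while the chain
  starts from a point mass and may charge null sets later. The degenerate case therefore needs
  \<open>F = 0\<close> at every point.\<close>

lemma has_real_derivative_along_line:
  fixes f :: "'a::real_normed_vector \<Rightarrow> real"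
  assumes "(f has_derivative f') (at (x + t *\<^sub>R a))"
  shows "((\<lambda>t. f (x + t *\<^sub>R a)) has_real_derivative f' a) (at t)"
proof -
  have "((\<lambda>t. f (x + t *\<^sub>R a)) has_derivative (\<lambda>s. f' (s *\<^sub>R a))) (at t)"
    by (rule has_derivative_compose[where f = "\<lambda>t. x + t *\<^sub>R a" and g = f, OF _ assms]) (auto intro!: derivative_eq_intros)
  moreover have "f' (s *\<^sub>R a) = f' a * s" for s
    using linear_simps(5)[OF has_derivative_bounded_linear[OF assms]] by simp
  ultimately show ?thesis
    by (simp add: has_field_derivative_def mult_commute_abs)
qed

text \<open>The mean value theorem is used along \<open>a\<close> for the increment of
  \<open>f\<close> in direction \<open>b\<close>, and then along \<open>b\<close> for the derivative
  in direction \<open>a\<close>; only the latter is assumed to be differentiable, which fixes the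
  order.\<close>

lemma double_difference:
  fixes f :: "'a::real_normed_vector \<Rightarrow> real"
  assumes s: "s > 0"
    and f: "\<And>p q. p \<in> {0..s} \<Longrightarrow> q \<in> {0..s} \<Longrightarrow> (f has_derivative f' (x + p *\<^sub>R a + q *\<^sub>R b)) (at (x + p *\<^sub>R a + q *\<^sub>R b))"
    and f': "\<And>p q. p \<in> {0..s} \<Longrightarrow> q \<in> {0..s} \<Longrightarrow>
      ((\<lambda>y. f' y a) has_derivative P (x + p *\<^sub>R a + q *\<^sub>R b)) (at (x + p *\<^sub>R a + q *\<^sub>R b))"
  shows "\<exists>p\<in>{0..s}. \<exists>q\<in>{0..s}.
    f (x + s *\<^sub>R a + s *\<^sub>R b) - f (x + s *\<^sub>R a) - f (x + s *\<^sub>R b) + f x = s * s * P (x + p *\<^sub>R a + q *\<^sub>R b) b"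
proof -
  define g where "g t = f (x + t *\<^sub>R a + s *\<^sub>R b) - f (x + t *\<^sub>R a)" for t
  have "(g has_real_derivative f' (x + t *\<^sub>R a + s *\<^sub>R b) a - f' (x + t *\<^sub>R a) a) (at t)"
    if "0 \<le> t" "t \<le> s" for t
  proof -
    have "((\<lambda>t. f (x + s *\<^sub>R b + t *\<^sub>R a)) has_real_derivative f' (x + t *\<^sub>R a + s *\<^sub>R b) a) (at t)"
      by (rule has_real_derivative_along_line) (use f[of t s] that s in \<open>simp add: add_ac\<close>)
    moreover have "((\<lambda>t. f (x + t *\<^sub>R a)) has_real_derivative f' (x + t *\<^sub>R a) a) (at t)"
      by (rule has_real_derivative_along_line) (use f[of t 0] that s in simp)
    ultimately show ?thesis
      unfolding g_def by (intro DERIV_diff) (simp_all add: add_ac)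
  qed
  then obtain p where p: "0 < p" "p < s" "g s - g 0 = (s - 0) * (f' (x + p *\<^sub>R a + s *\<^sub>R b) a - f' (x + p *\<^sub>R a) a)"
    using MVT2[OF s, of g "\<lambda>t. f' (x + t *\<^sub>R a + s *\<^sub>R b) a - f' (x + t *\<^sub>R a) a"] by blast
  have "((\<lambda>t. f' (x + p *\<^sub>R a + t *\<^sub>R b) a) has_real_derivative P (x + p *\<^sub>R a + t *\<^sub>R b) b) (at t)"
    if "0 \<le> t" "t \<le> s" for t
    by (rule has_real_derivative_along_line[of "\<lambda>y. f' y a"]) (use f'[of p t] that p in simp)
  then obtain q where q: "0 < q" "q < s"
      "f' (x + p *\<^sub>R a + s *\<^sub>R b) a - f' (x + p *\<^sub>R a + 0 *\<^sub>R b) a = (s - 0) * P (x + p *\<^sub>R a + q *\<^sub>R b) b"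
    using MVT2[OF s, of "\<lambda>t. f' (x + p *\<^sub>R a + t *\<^sub>R b) a" "\<lambda>t. P (x + p *\<^sub>R a + t *\<^sub>R b) b"] by blast
  have "f (x + s *\<^sub>R a + s *\<^sub>R b) - f (x + s *\<^sub>R a) - f (x + s *\<^sub>R b) + f x = g s - g 0"
    by (simp add: g_def)
  also have "\<dots> = s * s * P (x + p *\<^sub>R a + q *\<^sub>R b) b"
    using p q by simp
  finally show ?thesis
    using p q by (intro bexI[of _ p] bexI[of _ q]) auto
qed

text \<open>The second difference over a small parallelogram is symmetric in \<open>a\<close> and
  \<open>b\<close>, and \<open>double_difference\<close> evaluates it in both orders; continuity at
  \<open>x\<close> removes the intermediate points.\<close>

lemma symmetric_mixed_derivatives:
  fixes f :: "'a::real_normed_vector \<Rightarrow> real"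
  assumes S: "open S" "x \<in> S"
    and f: "\<And>y. y \<in> S \<Longrightarrow> (f has_derivative f' y) (at y)"
    and P: "\<And>y. y \<in> S \<Longrightarrow> ((\<lambda>y. f' y a) has_derivative P y) (at y)"
    and Q: "\<And>y. y \<in> S \<Longrightarrow> ((\<lambda>y. f' y b) has_derivative Q y) (at y)"
    and P_cont: "continuous_on S (\<lambda>y. P y b)" and Q_cont: "continuous_on S (\<lambda>y. Q y a)"
  shows "P x b = Q x a"
proof -
  have "\<bar>P x b - Q x a\<bar> < 2 * e" if e: "e > 0" for e
  proof -
    have "isCont (\<lambda>y. P y b) x" "isCont (\<lambda>y. Q y a) x"
      using P_cont Q_cont S by (simp_all add: continuous_on_eq_continuous_at)
    then obtain d1 d2 where d: "d1 > 0" "d2 > 0"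
        "\<And>y. dist y x < d1 \<Longrightarrow> dist (P y b) (P x b) < e" "\<And>y. dist y x < d2 \<Longrightarrow> dist (Q y a) (Q x a) < e"
      using e unfolding continuous_at_eps_delta by (metis dist_commute)
    obtain d3 where d3: "d3 > 0" "ball x d3 \<subseteq> S" using S by (auto simp: open_contains_ball)
    define d where "d = min d1 (min d2 d3)"
    have "d > 0" using d d3 by (simp add: d_def)
    define s where "s = d / (2 * (norm a + norm b + 1))"
    have pos: "norm a + norm b + 1 > 0" by (simp add: add_nonneg_pos)
    have s: "s > 0" using \<open>d > 0\<close> pos by (simp add: s_def)
    have near: "dist (x + p *\<^sub>R v + q *\<^sub>R w) x < d"
      if "p \<in> {0..s}" "q \<in> {0..s}" "norm v + norm w = norm a + norm b" for p q v w
    proof -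
      have "dist (x + p *\<^sub>R v + q *\<^sub>R w) x \<le> p * norm v + q * norm w"
        using that norm_triangle_ineq[of "p *\<^sub>R v" "q *\<^sub>R w"] by (simp add: dist_norm add.assoc)
      also have "\<dots> \<le> s * norm v + s * norm w"
        using that by (intro add_mono mult_right_mono) auto
      also have "\<dots> = s * (norm a + norm b)" using that by (simp add: distrib_left[symmetric])
      also have "\<dots> < d"
        using \<open>d > 0\<close> pos by (simp add: s_def field_simps add_nonneg_pos)
      finally show ?thesis .
    qed
    have in_S: "x + p *\<^sub>R v + q *\<^sub>R w \<in> S"
      if "p \<in> {0..s}" "q \<in> {0..s}" "norm v + norm w = norm a + norm b" for p q v w
      using near[OF that] d3(2) by (auto simp: d_def dist_commute)
    let ?\<Delta> = "f (x + s *\<^sub>R a + s *\<^sub>R b) - f (x + s *\<^sub>R a) - f (x + s *\<^sub>R b) + f x"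
    obtain p q where 1: "p \<in> {0..s}" "q \<in> {0..s}" "?\<Delta> = s * s * P (x + p *\<^sub>R a + q *\<^sub>R b) b"
      using double_difference[OF s, of f f' x a b P] f P in_S by blast
    have "\<exists>p\<in>{0..s}. \<exists>q\<in>{0..s}. f (x + s *\<^sub>R b + s *\<^sub>R a) - f (x + s *\<^sub>R b) - f (x + s *\<^sub>R a) + f x =
        s * s * Q (x + p *\<^sub>R b + q *\<^sub>R a) a"
      using f Q in_S by (intro double_difference[OF s, of f f']) (simp_all add: add.commute)
    moreover have "f (x + s *\<^sub>R b + s *\<^sub>R a) - f (x + s *\<^sub>R b) - f (x + s *\<^sub>R a) + f x = ?\<Delta>"
      by (simp add: add.commute add.left_commute)
    ultimately obtain p' q' where 2: "p' \<in> {0..s}" "q' \<in> {0..s}" "?\<Delta> = s * s * Q (x + p' *\<^sub>R b + q' *\<^sub>R a) a"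
      by (simp only:) blast
    have "s * s * P (x + p *\<^sub>R a + q *\<^sub>R b) b = s * s * Q (x + p' *\<^sub>R b + q' *\<^sub>R a) a"
      by (rule trans[OF 1(3)[symmetric] 2(3)])
    then have "P (x + p *\<^sub>R a + q *\<^sub>R b) b = Q (x + p' *\<^sub>R b + q' *\<^sub>R a) a"
      using s by simp
    moreover have "dist (P (x + p *\<^sub>R a + q *\<^sub>R b) b) (P x b) < e"
      using near[OF 1(1,2) refl] by (intro d(3)) (simp add: d_def)
    moreover have "dist (Q (x + p' *\<^sub>R b + q' *\<^sub>R a) a) (Q x a) < e"
      using near[OF 2(1,2), of b a] by (intro d(4)) (simp add: d_def)
    ultimately show ?thesis by (simp add: dist_real_def)
  qed
  from this[of "\<bar>P x b - Q x a\<bar> / 2"] show ?thesis by (cases "P x b = Q x a") simp_all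
qed

lemma linear_complex_real:
  fixes f :: "complex \<Rightarrow> real"
  assumes "linear f"
  shows "f v = Re v * f 1 + Im v * f \<i>"
proof -
  have "f v = f (Re v *\<^sub>R 1 + Im v *\<^sub>R \<i>)"
    by (rule arg_cong[of _ _ f]) (simp add: complex_eq_iff)
  also have "\<dots> = Re v * f 1 + Im v * f \<i>"
    by (simp only: linear_add[OF assms] linear_cmul[OF assms] real_scaleR_def)
  finally show ?thesis .
qed

text \<open>The last two assumptions are the Cauchy-Riemann equations for \<open>p - \<i> q\<close>.
  They make this real-linear map complex-linear, that is, multiplication by its value at 1.\<close>

lemma Cauchy_Riemann_mult:
  fixes p q :: "complex \<Rightarrow> real"
  assumes "linear p" "linear q" "p \<i> = q 1" "p 1 + q \<i> = 0"
  shows "Complex (p v) (- q v) = Complex (p 1) (- q 1) * v"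
proof -
  have "q \<i> = - p 1" using assms(4) by simp
  then have "p v = Re v * p 1 + Im v * q 1" "q v = Re v * q 1 - Im v * p 1"
    using linear_complex_real[OF assms(1), of v] linear_complex_real[OF assms(2), of v] assms(3) by simp_all
  then show ?thesis by (simp add: complex_eq_iff algebra_simps)
qed

section \<open>Harmonic functions through their holomorphic gradient\<close>

locale harmonic_on =
  fixes u :: "complex \<Rightarrow> real" and S :: "complex set"
  assumes S: "open S" and C2: "Ck_on 2 u S" and harm: "\<And>x. x \<in> S \<Longrightarrow> laplacian u x = 0"
begin

abbreviation (input) "du \<equiv> \<lambda>y. frechet_derivative u (at y)"

text \<open>The complex conjugate of the usual gradient, or twice the Wirtinger derivative of
  \<open>u\<close>. The conjugation makes it holomorphic, and locally \<open>u\<close> is the real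
  part of a primitive of it up to a constant.\<close>

definition grad :: "complex \<Rightarrow> complex" where
  "grad y = Complex (du y 1) (- du y \<i>)"

lemma C2_unfolded:
  shows "u differentiable_on S"
    and "b \<in> Basis \<Longrightarrow> (\<lambda>y. du y b) differentiable_on S"
    and "b \<in> Basis \<Longrightarrow> b' \<in> Basis \<Longrightarrow> continuous_on S (\<lambda>x. frechet_derivative (\<lambda>y. du y b) (at x) b')"
proof -
  have *: "u differentiable_on S \<and> (\<forall>b\<in>Basis. (\<lambda>y. du y b) differentiable_on S \<and>
      (\<forall>b'\<in>Basis. continuous_on S (\<lambda>x. frechet_derivative (\<lambda>y. du y b) (at x) b')))"
    by (rule C2[unfolded numeral_2_eq_2 Ck_on.simps])
  show "u differentiable_on S"
    using * by (rule conjunct1)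
  show "(\<lambda>y. du y b) differentiable_on S" if "b \<in> Basis"
    using bspec[OF conjunct2[OF *] that] by (rule conjunct1)
  show "continuous_on S (\<lambda>x. frechet_derivative (\<lambda>y. du y b) (at x) b')" if "b \<in> Basis" "b' \<in> Basis"
    using conjunct2[OF bspec[OF conjunct2[OF *] that(1)]] that(2) by (rule bspec)
qed

lemma has_frechet_derivative:
  assumes "f differentiable_on S" "x \<in> S"
  shows "(f has_derivative frechet_derivative f (at x)) (at x)"
proof -
  have "f differentiable at x"
    using assms differentiable_on_eq_differentiable_at[OF S, of f] by blast
  then show ?thesis by (rule frechet_derivative_works[THEN iffD1])
qed

lemma has_derivative_u: "x \<in> S \<Longrightarrow> (u has_derivative du x) (at x)"
  by (rule has_frechet_derivative[OF C2_unfolded(1)])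

lemma continuous_on_u: "continuous_on S u"
  using C2_unfolded(1) by (rule differentiable_imp_continuous_on)

lemma frechet_derivative_u: "x \<in> S \<Longrightarrow> du x v = Re (grad x * v)"
proof -
  assume x: "x \<in> S"
  have lin: "linear (du x)" using has_derivative_u[OF x] has_derivative_linear by blast
  show ?thesis
    by (subst linear_complex_real[OF lin]) (simp add: grad_def)
qed

text \<open>Symmetry of the mixed second derivatives and the vanishing Laplacian are exactly the
  Cauchy-Riemann equations for \<open>grad\<close>.\<close>

lemma holomorphic_grad: "grad holomorphic_on S"
  unfolding holomorphic_on_def
proof (rule ballI, rule field_differentiable_at_within)
  fix x assume x: "x \<in> S"
  have basis: "(1::complex) \<in> Basis" "\<i> \<in> Basis" by (simp_all add: Basis_complex_def)
  let ?P = "\<lambda>x. frechet_derivative (\<lambda>y. du y 1) (at x)"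
  let ?Q = "\<lambda>x. frechet_derivative (\<lambda>y. du y \<i>) (at x)"
  have P: "((\<lambda>y. du y 1) has_derivative ?P y) (at y)" and Q: "((\<lambda>y. du y \<i>) has_derivative ?Q y) (at y)"
    if "y \<in> S" for y
    by (rule has_frechet_derivative[OF C2_unfolded(2)[OF basis(1)] that],
        rule has_frechet_derivative[OF C2_unfolded(2)[OF basis(2)] that])
  have cont: "continuous_on S (\<lambda>y. ?P y \<i>)" "continuous_on S (\<lambda>y. ?Q y 1)"
    by (rule C2_unfolded(3)[OF basis], rule C2_unfolded(3)[OF basis(2,1)])
  have sym: "?P x \<i> = ?Q x 1"
    by (rule symmetric_mixed_derivatives[where f' = du and P = ?P and Q = ?Q, OF S x has_derivative_u P Q cont])
  have lap: "?P x 1 + ?Q x \<i> = 0"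
    using harm[OF x] by (simp add: laplacian_def Basis_complex_def)
  have lin: "linear (?P x)" "linear (?Q x)"
    using P[OF x] Q[OF x] has_derivative_linear by blast+
  have "(grad has_derivative (\<lambda>v. Complex (?P x v) (- ?Q x v))) (at x)"
    using P[OF x] Q[OF x] unfolding grad_def Complex_eq
    by (auto intro!: derivative_eq_intros simp: fun_eq_iff)
  moreover have "(\<lambda>v. Complex (?P x v) (- ?Q x v)) = (\<lambda>v. Complex (?P x 1) (- ?Q x 1) * v)"
    using Cauchy_Riemann_mult[OF lin sym lap] by (rule ext)
  ultimately have "(grad has_derivative (\<lambda>v. Complex (?P x 1) (- ?Q x 1) * v)) (at x)"
    by (simp only:)
  then have "(grad has_field_derivative Complex (?P x 1) (- ?Q x 1)) (at x)"
    by (simp only: has_field_derivative_def)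
  then show "grad field_differentiable at x"
    unfolding field_differentiable_def by (rule exI)
qed

text \<open>The identity theorem is applied to \<open>grad\<close>, which vanishes on
  \<open>V\<close>; connectedness then makes \<open>u\<close> constant.\<close>

lemma unique_continuation:
  assumes "connected S" "open V" "V \<noteq> {}" "V \<subseteq> S" and zero: "\<And>x. x \<in> V \<Longrightarrow> u x = 0" and x: "x \<in> S"
  shows "u x = 0"
proof -
  have grad0: "grad y = 0" if "y \<in> V" for y
  proof -
    have "((\<lambda>_. 0::real) has_derivative du y) (at y)"
      by (rule has_derivative_transform_within_open[OF has_derivative_u assms(2)])
        (use that assms(4) zero in auto)
    then have "du y = (\<lambda>v. 0)" by (rule has_derivative_unique) simp
    then show ?thesis by (simp add: grad_def complex_eq_iff)
  qed
  have gradS: "grad y = 0" if "y \<in> S" for y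
    by (rule analytic_continuation_open[of V S grad "\<lambda>_. 0"])
      (use assms S holomorphic_grad grad0 that in auto)
  obtain v where v: "v \<in> V" using assms(3) by auto
  have "u x = u v"
  proof (rule has_derivative_zero_unique_connected[OF S assms(1)])
    fix y assume y: "y \<in> S"
    have "du y = (\<lambda>v. 0)" using frechet_derivative_u[OF y] gradS[OF y] by auto
    with has_derivative_u[OF y] show "(u has_derivative (\<lambda>x. 0)) (at y)" by simp
  qed (use x v assms(4) in auto)
  with zero[OF v] show ?thesis by simp
qed

text \<open>On a slightly larger disc \<open>grad\<close> has a primitive \<open>f\<close> with
  \<open>Re f - u\<close> constant, so the mean value property is the real part of Cauchy's integral
  formula for \<open>f\<close>. The margin up to \<open>r'\<close> puts the closed disc inside the
  domain of \<open>f\<close>.\<close>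

lemma mean_value_inside:
  assumes r: "r > 0" and r': "r < r'" "ball x r' \<subseteq> S"
  shows "((\<lambda>t. u (x + r *\<^sub>R cis (2 * pi * t))) has_integral u x) {0..1}"
proof -
  have "grad holomorphic_on ball x r'"
    using holomorphic_grad r'(2) by (rule holomorphic_on_subset)
  then obtain f where "\<And>y. y \<in> ball x r' \<Longrightarrow> (f has_field_derivative grad y) (at y within ball x r')"
    using holomorphic_convex_primitive'[OF convex_ball open_ball] by blast
  then have f: "(f has_field_derivative grad y) (at y)" if "y \<in> ball x r'" for y
    using that by (metis at_within_open open_ball)
  have "((\<lambda>y. Re (f y) - u y) has_derivative (\<lambda>v. 0)) (at y)" if y: "y \<in> ball x r'" for y
  proof -
    have "y \<in> S" using y r'(2) by auto
    have "((\<lambda>y. Re (f y) - u y) has_derivative (\<lambda>v. Re (grad y * v) - du y v)) (at y)"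
      using f[OF y, unfolded has_field_derivative_def]
      by (rule has_derivative_diff[OF bounded_linear.has_derivative[OF bounded_linear_Re] has_derivative_u[OF \<open>y \<in> S\<close>]])
    then show ?thesis by (simp add: frechet_derivative_u[OF \<open>y \<in> S\<close>])
  qed
  then have const: "Re (f y) - u y = Re (f x) - u x" if "y \<in> ball x r'" for y
    using that r r' by (intro has_derivative_zero_unique_connected[OF open_ball connected_ball]) auto
  have hol: "f holomorphic_on ball x r'"
    unfolding holomorphic_on_def
  proof
    fix y assume "y \<in> ball x r'"
    from f[OF this] have "f field_differentiable at y"
      unfolding field_differentiable_def by (rule exI)
    then show "f field_differentiable (at y within ball x r')"
      by (rule field_differentiable_at_within)
  qed
  have sub: "cball x r \<subseteq> ball x r'" using r' by auto
  have "((\<lambda>y. f y / (y - x)) has_contour_integral (2 * of_real pi * \<i> * f x)) (circlepath x r)"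
    using r hol sub
    by (intro Cauchy_integral_circlepath continuous_on_subset[OF holomorphic_on_imp_continuous_on[OF hol] sub]
        holomorphic_on_subset[OF hol]) auto
  then have "((\<lambda>t. f (circlepath x r t) / (circlepath x r t - x) * vector_derivative (circlepath x r) (at t))
      has_integral (2 * of_real pi * \<i> * f x)) {0..1}"
    by (simp add: has_contour_integral)
  \<comment> \<open>The velocity of the circle is \<open>2 * pi * \<i>\<close> times
    \<open>circlepath x r t - x\<close>, so this normalisation leaves the plain average of
    \<open>f\<close>.\<close>
  then have "((\<lambda>t. 1 / (2 * of_real pi * \<i>) * (f (circlepath x r t) / (circlepath x r t - x) * vector_derivative (circlepath x r) (at t)))
      has_integral 1 / (2 * of_real pi * \<i>) * (2 * of_real pi * \<i> * f x)) {0..1}"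
    by (rule has_integral_mult_right)
  moreover have "1 / (2 * of_real pi * \<i>) * (f (circlepath x r t) / (circlepath x r t - x) * vector_derivative (circlepath x r) (at t)) =
      f (x + r *\<^sub>R cis (2 * pi * t))" for t
  proof -
    have 1: "circlepath x r t = x + r *\<^sub>R cis (2 * pi * t)"
      by (simp add: circlepath cis_conv_exp scaleR_conv_of_real mult_ac)
    have 2: "vector_derivative (circlepath x r) (at t) = 2 * of_real pi * \<i> * (circlepath x r t - x)"
      unfolding vector_derivative_circlepath by (simp add: circlepath)
    have "circlepath x r t - x \<noteq> 0"
      using r by (simp add: 1)
    then have "1 / (2 * of_real pi * \<i>) * (f (circlepath x r t) / (circlepath x r t - x) *
        (2 * of_real pi * \<i> * (circlepath x r t - x))) = f (circlepath x r t)"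
      by (simp add: field_simps)
    then show ?thesis by (simp only: 2) (simp only: 1)
  qed
  ultimately have "((\<lambda>t. f (x + r *\<^sub>R cis (2 * pi * t))) has_integral f x) {0..1}"
    by simp
  from has_integral_linear[OF this bounded_linear_Re]
  have "((\<lambda>t. Re (f (x + r *\<^sub>R cis (2 * pi * t)))) has_integral Re (f x)) {0..1}" by (simp add: o_def)
  from has_integral_diff[OF this has_integral_const_real[of "Re (f x) - u x" 0 1]]
  have "((\<lambda>t. Re (f (x + r *\<^sub>R cis (2 * pi * t))) - (Re (f x) - u x)) has_integral u x) {0..1}" by simp
  moreover have "Re (f (x + r *\<^sub>R cis (2 * pi * t))) - (Re (f x) - u x) = u (x + r *\<^sub>R cis (2 * pi * t))" for t
    using const[of "x + r *\<^sub>R cis (2 * pi * t)"] r r' by (simp add: dist_norm)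
  ultimately show ?thesis by simp
qed

text \<open>The circle of a sphere step touches the boundary, where \<open>u\<close> is merely
  continuous. The circle means are constant for smaller radii and depend continuously on the radius
  up to \<open>r\<close>.\<close>

lemma mean_value:
  assumes r: "r > 0" "ball x r \<subseteq> S" and cont: "continuous_on (cball x r) u"
  shows "((\<lambda>t. u (x + r *\<^sub>R cis (2 * pi * t))) has_integral u x) {0..1}"
proof -
  define I where "I \<rho> = integral (cbox 0 1) (\<lambda>t. u (x + \<rho> *\<^sub>R cis (2 * pi * t)))" for \<rho>
  have cont2: "continuous_on ({0..r} \<times> cbox 0 1) (\<lambda>(\<rho>, t). u (x + \<rho> *\<^sub>R cis (2 * pi * t)))"
    unfolding split_beta
    by (rule continuous_on_compose2[OF cont]) (auto intro!: continuous_intros simp: dist_norm)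
  then have "continuous_on {0..r} I"
    unfolding I_def by (rule integral_continuous_on_param)
  then have "continuous_on (closure {0<..<r}) I" using r by simp
  moreover have "I \<rho> = u x" if "\<rho> \<in> {0<..<r}" for \<rho>
    using mean_value_inside[of \<rho> r x] that r(2) by (simp add: I_def integral_unique)
  ultimately have "I r = u x"
    using r by (intro continuous_constant_on_closure[of "{0<..<r}" I "u x" r]) auto
  moreover have "continuous_on (cbox 0 1) (\<lambda>t. u (x + r *\<^sub>R cis (2 * pi * t)))"
    by (rule continuous_on_compose2[OF cont]) (use r in \<open>auto intro!: continuous_intros simp: dist_norm\<close>)
  then have "(\<lambda>t. u (x + r *\<^sub>R cis (2 * pi * t))) integrable_on cbox 0 1"
    by (rule integrable_continuous)
  ultimately show ?thesis by (simp add: I_def has_integral_iff)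
qed

end

section \<open>Killed random walks\<close>

lemma sets_cemetery_space:
  assumes E: "E \<in> sets borel"
  shows "sets (cemetery_space E) = {B. B \<subseteq> insert None (Some ` E) \<and> Some -` B \<in> sets borel}"
proof -
  let ?S = "{B. B \<subseteq> insert None (Some ` E) \<and> Some -` B \<in> sets borel}"
  have "sigma_algebra (insert None (Some ` E)) ?S"
    unfolding sigma_algebra_iff2
  proof (intro conjI ballI allI impI)
    fix B assume B: "B \<in> ?S"
    have "Some -` (insert None (Some ` E) - B) = E - Some -` B" by auto
    with B E show "insert None (Some ` E) - B \<in> ?S" by auto
  next
    fix A :: "nat \<Rightarrow> 'a option set" assume A: "range A \<subseteq> ?S"
    then have "Some -` (\<Union>i. A i) = (\<Union>i. Some -` A i)" "\<And>i. Some -` A i \<in> sets borel" by auto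
    with A show "(\<Union>i. A i) \<in> ?S" by auto
  qed auto
  then show ?thesis
    unfolding cemetery_space_def by (subst sigma_algebra.sets_measure_of_eq) auto
qed

lemma space_cemetery_space: "space (cemetery_space E) = insert None (Some ` E)"
  unfolding cemetery_space_def by (subst space_measure_of) auto

definition cemetery_ext :: "('a \<Rightarrow> 'b::zero) \<Rightarrow> 'a option \<Rightarrow> 'b" where
  "cemetery_ext g s = (case s of None \<Rightarrow> 0 | Some x \<Rightarrow> g x)"

lemma cemetery_ext_simps [simp]: "cemetery_ext g None = 0" "cemetery_ext g (Some x) = g x"
  by (auto simp: cemetery_ext_def)

lemma measurable_cemetery_ext:
  fixes g :: "'a::topological_space \<Rightarrow> 'b::{zero,topological_space}"
  assumes E: "E \<in> sets borel" and g: "g \<in> borel_measurable borel"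
  shows "cemetery_ext g \<in> borel_measurable (cemetery_space E)"
proof (rule measurableI)
  fix A :: "'b set" assume A: "A \<in> sets borel"
  have "Some -` (cemetery_ext g -` A \<inter> space (cemetery_space E)) = g -` A \<inter> E"
    by (auto simp: space_cemetery_space)
  moreover have "g -` A \<inter> E \<in> sets borel"
    using measurable_sets[OF g A] E by auto
  ultimately show "cemetery_ext g -` A \<inter> space (cemetery_space E) \<in> sets (cemetery_space E)"
    using E by (simp add: sets_cemetery_space) (auto simp: space_cemetery_space)
qed auto

text \<open>\<open>Q\<close> is a kernel on the whole type, null off \<open>E\<close>. All functions
  can then be Borel on the type, without restricted sigma-algebras, and inequalities between them
  are needed on \<open>E\<close> only.\<close>

locale killed_walk =
  fixes E :: "'a::topological_space set" and Q :: "'a \<Rightarrow> 'a measure"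
  assumes E [measurable]: "E \<in> sets borel"
    and Q [measurable]: "Q \<in> borel \<rightarrow>\<^sub>M subprob_algebra borel"
    and Q_E: "\<And>x. x \<in> E \<Longrightarrow> emeasure (Q x) (- E) = 0"
    and Q_off: "\<And>x. x \<notin> E \<Longrightarrow> Q x = null_measure borel"
begin

lemma sets_Q [measurable_cong, simp]: "sets (Q x) = sets borel"
  using measurable_space[OF Q, of x] by (simp add: space_subprob_algebra)

lemma space_Q [simp]: "space (Q x) = UNIV"
  using sets_eq_imp_space_eq[OF sets_Q] by simp

lemma emeasure_Q_le: "emeasure (Q x) A \<le> 1"
proof -
  have "subprob_space (Q x)"
    using measurable_space[OF Q, of x] by (simp add: space_subprob_algebra)
  then show ?thesis by (rule subprob_space.subprob_emeasure_le_1)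
qed

text \<open>With values in \<open>ennreal\<close> no integrability has to be tracked.
  \<open>(op ^^ n) g x\<close> is the expectation of \<open>g\<close> at time \<open>n\<close>, on
  survival, for the walk started in \<open>x\<close>.\<close>

definition op :: "('a \<Rightarrow> ennreal) \<Rightarrow> 'a \<Rightarrow> ennreal" where
  "op g x = (\<integral>\<^sup>+y. g y \<partial>Q x)"

lemma measurable_op [measurable]:
  "g \<in> borel_measurable borel \<Longrightarrow> op g \<in> borel_measurable borel"
  unfolding op_def by (rule measurable_compose[OF Q nn_integral_measurable_subprob_algebra])

lemma measurable_op_pow [measurable]:
  "g \<in> borel_measurable borel \<Longrightarrow> (op ^^ n) g \<in> borel_measurable borel"
  by (induction n) auto

lemma op_off: "x \<notin> E \<Longrightarrow> op g x = 0"
  by (simp add: op_def Q_off)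

lemma AE_Q_E: "AE y in Q x. y \<in> E"
proof (cases "x \<in> E")
  case True
  then show ?thesis
    by (intro AE_I[where N = "- E"]) (auto simp: Q_E)
qed (auto simp: Q_off intro!: AE_I[where N = UNIV])

lemma op_mono:
  assumes "\<And>x. x \<in> E \<Longrightarrow> f x \<le> g x"
  shows "op f x \<le> op g x"
  unfolding op_def by (intro nn_integral_mono_AE eventually_mono[OF AE_Q_E] assms)

lemma op_pow_mono:
  assumes "\<And>x. x \<in> E \<Longrightarrow> f x \<le> g x" "x \<in> E"
  shows "(op ^^ n) f x \<le> (op ^^ n) g x"
  using assms(2)
proof (induction n arbitrary: x)
  case (Suc n)
  then show ?case by (auto intro: op_mono)
qed (use assms in auto)

lemma op_add:
  assumes [measurable]: "f \<in> borel_measurable borel" "g \<in> borel_measurable borel"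
  shows "op (\<lambda>x. f x + g x) = (\<lambda>x. op f x + op g x)"
  unfolding op_def by (intro ext nn_integral_add) measurable

lemma op_cmult:
  assumes [measurable]: "g \<in> borel_measurable borel"
  shows "op (\<lambda>x. c * g x) = (\<lambda>x. c * op g x)"
  unfolding op_def by (intro ext nn_integral_cmult) measurable

lemma op_pow_add:
  assumes [measurable]: "f \<in> borel_measurable borel" "g \<in> borel_measurable borel"
  shows "(op ^^ n) (\<lambda>x. f x + g x) = (\<lambda>x. (op ^^ n) f x + (op ^^ n) g x)"
  by (induction n) (simp_all add: op_add)

lemma op_pow_cmult:
  assumes [measurable]: "g \<in> borel_measurable borel"
  shows "(op ^^ n) (\<lambda>x. c * g x) = (\<lambda>x. c * (op ^^ n) g x)"
  by (induction n) (simp_all add: op_cmult)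

definition killing :: "'a \<Rightarrow> ennreal" where
  "killing x = indicator E x * (1 - emeasure (Q x) UNIV)"

lemma measurable_killing [measurable]: "killing \<in> borel_measurable borel"
  unfolding killing_def by measurable

lemma op_indicator_E: "op (indicator E) x = indicator E x * emeasure (Q x) UNIV"
proof (cases "x \<in> E")
  case True
  have "op (indicator E) x = emeasure (Q x) E" by (simp add: op_def)
  also have "\<dots> = emeasure (Q x) UNIV"
    using AE_Q_E by (intro emeasure_eq_AE) (auto elim!: eventually_mono)
  finally show ?thesis using True by simp
qed (simp add: op_off)

lemma killing_add_op: "(\<lambda>x. killing x + op (indicator E) x) = indicator E"
  by (auto simp: killing_def op_indicator_E emeasure_Q_le diff_add_cancel_ennreal split: split_indicator)

text \<open>Decomposition by the time of death: dead by time \<open>n\<close>, or still alive. The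
  induction applies the \<open>n\<close>-th power of \<open>op\<close> to
  \<open>killing_add_op\<close>. The survival term stays in the identity, so that nothing is
  subtracted in \<open>ennreal\<close>.\<close>

lemma sum_killing: "(\<Sum>m<n. (op ^^ m) killing x) + (op ^^ n) (indicator E) x = indicator E x"
proof (induction n)
  case (Suc n)
  have *: "(op ^^ n) (indicator E) = (\<lambda>x. (op ^^ n) killing x + (op ^^ Suc n) (indicator E) x)"
    using op_pow_add[of killing "op (indicator E)" n]
    by (simp only: killing_add_op funpow_Suc_right o_def) simp
  show ?case
    using Suc unfolding fun_cong[OF *, of x] by (simp only: sum.lessThan_Suc add.assoc)
qed auto

lemma potential_le:
  assumes f [measurable]: "f \<in> borel_measurable borel"
    and le: "\<And>x. x \<in> E \<Longrightarrow> f x \<le> C * killing x" and x: "x \<in> E"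
  shows "(\<Sum>m. (op ^^ m) f x) \<le> C"
proof (rule suminf_le_const[OF summableI])
  fix n
  have "(\<Sum>m<n. (op ^^ m) f x) \<le> (\<Sum>m<n. C * (op ^^ m) killing x)"
    using op_pow_mono[of f "\<lambda>x. C * killing x" x] le x
    by (intro sum_mono) (simp add: op_pow_cmult)
  also have "\<dots> = C * (\<Sum>m<n. (op ^^ m) killing x)"
    by (simp add: sum_distrib_left)
  also have "\<dots> \<le> C * 1"
    using sum_killing[of x n] x by (intro mult_left_mono) (auto simp: le_iff_add)
  finally show "(\<Sum>m<n. (op ^^ m) f x) \<le> C" by simp
qed

end

text \<open>Each pair \<open>i < j\<close> occurs twice in the square; counting the diagonal twice
  as well only increases the bound. This is the origin of the factor 2 in the second moment.\<close>

lemma square_sum_le: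
  fixes a :: "nat \<Rightarrow> ennreal"
  shows "(\<Sum>j<n. a j)\<^sup>2 \<le> 2 * (\<Sum>j<n. \<Sum>i\<le>j. a i * a j)"
proof (induction n)
  case (Suc n)
  let ?S = "\<Sum>j<n. a j"
  have "(\<Sum>j<Suc n. a j)\<^sup>2 = ?S\<^sup>2 + (2 * (?S * a n) + a n * a n)"
    by (simp add: power2_eq_square algebra_simps mult_2)
  also have "\<dots> \<le> 2 * (\<Sum>j<n. \<Sum>i\<le>j. a i * a j) + (2 * (?S * a n) + 2 * (a n * a n))"
    using Suc by (intro add_mono order_refl) (simp_all add: mult_2)
  also have "\<dots> = 2 * (\<Sum>j<Suc n. \<Sum>i\<le>j. a i * a j)"
    by (simp add: distrib_left sum_distrib_right lessThan_Suc_atMost[symmetric])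
  finally show ?case .
qed simp

section \<open>Markov property and moments of additive functionals\<close>

locale killed_chain = killed_walk E Q + prob_space M
  for E :: "'a::topological_space set" and Q :: "'a \<Rightarrow> 'a measure"
    and M :: "'w measure" +
  fixes X :: "nat \<Rightarrow> 'w \<Rightarrow> 'a option" and x0 :: 'a
  assumes chain: "markov_chain M X E Q x0" and x0: "x0 \<in> E"
begin

lemma measurable_X [measurable]: "X j \<in> M \<rightarrow>\<^sub>M cemetery_space E"
  using chain by (simp add: markov_chain_def)

lemma measurable_ext_X [measurable (raw)]:
  "g \<in> borel_measurable borel \<Longrightarrow> (\<lambda>\<omega>. cemetery_ext g (X j \<omega>)) \<in> borel_measurable M"
  for g :: "'a \<Rightarrow> 'c::{zero,topological_space}"
  by (rule measurable_compose[OF measurable_X measurable_cemetery_ext[OF E]])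

lemma X_cases:
  assumes "\<omega> \<in> space M"
  obtains "X j \<omega> = None" | x where "x \<in> E" "X j \<omega> = Some x"
  using measurable_space[OF measurable_X assms, of j] by (auto simp: space_cemetery_space)

text \<open>The Markov property for histories that depend on coordinate \<open>i\<close> only and
  for targets that avoid the cemetery. A past time \<open>i\<close>, and not just the present one,
  is kept for the sake of the mixed moments of the estimator.\<close>

lemma step_indicator:
  assumes i: "i \<le> n" and A: "A \<in> sets (cemetery_space E)" and B: "B \<in> sets borel"
  shows "(\<integral>\<^sup>+\<omega>. indicator A (X i \<omega>) * cemetery_ext (indicator B) (X (Suc n) \<omega>) \<partial>M) =
         (\<integral>\<^sup>+\<omega>. indicator A (X i \<omega>) * cemetery_ext (op (indicator B)) (X n \<omega>) \<partial>M)"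
proof -
  let ?P = "PiM {..n} (\<lambda>_. cemetery_space E)"
  define A' where "A' = (\<lambda>f. f i) -` A \<inter> space ?P"
  define B' where "B' = Some ` (B \<inter> E)"
  have A': "A' \<in> sets ?P"
    unfolding A'_def using i A by (intro measurable_sets[OF measurable_component_singleton]) auto
  have vB': "Some -` B' = B \<inter> E" by (auto simp: B'_def)
  have B': "B' \<in> sets (cemetery_space E)"
    using B by (auto simp: sets_cemetery_space B'_def inj_vimage_image_eq)
  have inA: "(\<lambda>j\<in>{..n}. X j \<omega>) \<in> A' \<longleftrightarrow> X i \<omega> \<in> A" if "\<omega> \<in> space M" for \<omega>
    using i measurable_space[OF measurable_X that] by (auto simp: A'_def space_PiM)
  have "(\<integral>\<^sup>+\<omega>. indicator A (X i \<omega>) * cemetery_ext (indicator B) (X (Suc n) \<omega>) \<partial>M) =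
      (\<integral>\<^sup>+\<omega>. indicator {\<omega>\<in>space M. (\<lambda>j\<in>{..n}. X j \<omega>) \<in> A' \<and> X (Suc n) \<omega> \<in> B'} \<omega> \<partial>M)"
  proof (rule nn_integral_cong)
    fix \<omega> assume \<omega>: "\<omega> \<in> space M"
    show "indicator A (X i \<omega>) * cemetery_ext (indicator B) (X (Suc n) \<omega>) =
        (indicator {\<omega>\<in>space M. (\<lambda>j\<in>{..n}. X j \<omega>) \<in> A' \<and> X (Suc n) \<omega> \<in> B'} \<omega> :: ennreal)"
    proof -
      have "cemetery_ext (indicator B) (X (Suc n) \<omega>) = (indicator B' (X (Suc n) \<omega>) :: ennreal)"
        by (rule X_cases[OF \<omega>, of "Suc n"]) (auto simp: B'_def indicator_def)
      then show ?thesis using \<omega> inA[OF \<omega>] by (simp add: indicator_def)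
    qed
  qed
  also have "\<dots> = emeasure M {\<omega>\<in>space M. (\<lambda>j\<in>{..n}. X j \<omega>) \<in> A' \<and> X (Suc n) \<omega> \<in> B'}"
  proof (rule nn_integral_indicator)
    have "(\<lambda>\<omega>. \<lambda>j\<in>{..n}. X j \<omega>) \<in> M \<rightarrow>\<^sub>M ?P"
      by (intro measurable_restrict measurable_X)
    then have "((\<lambda>\<omega>. \<lambda>j\<in>{..n}. X j \<omega>) -` A' \<inter> space M) \<inter> (X (Suc n) -` B' \<inter> space M) \<in> sets M"
      using A' B' by (intro sets.Int measurable_sets[OF _ A'] measurable_sets[OF measurable_X B'])
    also have "((\<lambda>\<omega>. \<lambda>j\<in>{..n}. X j \<omega>) -` A' \<inter> space M) \<inter> (X (Suc n) -` B' \<inter> space M) =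
        {\<omega>\<in>space M. (\<lambda>j\<in>{..n}. X j \<omega>) \<in> A' \<and> X (Suc n) \<omega> \<in> B'}" by auto
    finally show "{\<omega>\<in>space M. (\<lambda>j\<in>{..n}. X j \<omega>) \<in> A' \<and> X (Suc n) \<omega> \<in> B'} \<in> sets M" .
  qed
  also have "\<dots> = (\<integral>\<^sup>+\<omega>. indicator A' (\<lambda>j\<in>{..n}. X j \<omega>) * transition E Q (X n \<omega>) B' \<partial>M)"
    using chain A' B' unfolding markov_chain_def by blast
  also have "\<dots> = (\<integral>\<^sup>+\<omega>. indicator A (X i \<omega>) * cemetery_ext (op (indicator B)) (X n \<omega>) \<partial>M)"
  proof (rule nn_integral_cong)
    fix \<omega> assume \<omega>: "\<omega> \<in> space M"
    have QB: "emeasure (Q x) (B \<inter> E) = emeasure (Q x) B" for x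
      using B by (intro emeasure_eq_AE eventually_mono[OF AE_Q_E]) auto
    have "transition E Q (X n \<omega>) B' = cemetery_ext (op (indicator B)) (X n \<omega>)"
    proof (cases rule: X_cases[OF \<omega>, of n])
      case 1
      then show ?thesis by (simp add: transition_def B'_def)
    next
      case (2 x)
      have "None \<notin> B'" by (auto simp: B'_def)
      with 2 QB B show ?thesis by (simp add: transition_def vB' op_def)
    qed
    then show "indicator A' (\<lambda>j\<in>{..n}. X j \<omega>) * transition E Q (X n \<omega>) B' =
        indicator A (X i \<omega>) * cemetery_ext (op (indicator B)) (X n \<omega>)"
      using inA[OF \<omega>] by (auto split: split_indicator)
  qed
  finally show ?thesis .
qed

lemma cemetery_ext_linear:
  fixes f g :: "'a \<Rightarrow> ennreal"
  shows "cemetery_ext (\<lambda>x. c * g x) s = c * cemetery_ext g s"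
    "cemetery_ext (\<lambda>x. f x + g x) s = cemetery_ext f s + cemetery_ext g s"
  by (cases s; simp)+

lemma cemetery_ext_SUP:
  fixes U :: "nat \<Rightarrow> 'a \<Rightarrow> ennreal"
  shows "cemetery_ext (SUP i. U i) s = (SUP i. cemetery_ext (U i) s)"
  by (cases s; simp add: image_comp)

lemma op_SUP:
  assumes [measurable]: "\<And>i. U i \<in> borel_measurable borel" and "incseq U"
  shows "op (SUP i. U i) = (SUP i. op (U i))"
proof
  fix x
  have "(\<integral>\<^sup>+y. (SUP i. U i y) \<partial>Q x) = (SUP i. \<integral>\<^sup>+y. U i y \<partial>Q x)"
    using assms(2) by (intro nn_integral_monotone_convergence_SUP) measurable
  then show "op (SUP i. U i) x = (SUP i. op (U i)) x"
    by (simp add: op_def image_comp)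
qed

lemma incseq_op: "incseq U \<Longrightarrow> incseq (\<lambda>i. op (U i))"
  by (intro monoI le_funI op_mono) (meson le_funD monoD)

lemma incseq_cemetery_ext: "incseq U \<Longrightarrow> incseq (\<lambda>i \<omega>. a \<omega> * cemetery_ext (U i) (Y \<omega>))"
  for U :: "nat \<Rightarrow> 'a \<Rightarrow> ennreal" and Y :: "'b \<Rightarrow> 'a option"
proof (intro monoI le_funI mult_left_mono)
  fix i j :: nat and \<omega> assume "incseq U" "i \<le> j"
  then have "U i \<le> U j" by (rule monoD)
  then show "cemetery_ext (U i) (Y \<omega>) \<le> cemetery_ext (U j) (Y \<omega>)"
    by (cases "Y \<omega>") (auto simp: le_fun_def)
qed auto

text \<open>Monotone class extension in \<open>g\<close> with the set \<open>A\<close> fixed;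
  \<open>step\<close> repeats it in the other factor.\<close>

lemma step_indicator_left:
  assumes i: "i \<le> n" and A [measurable]: "A \<in> sets (cemetery_space E)" and g: "g \<in> borel_measurable borel"
  shows "(\<integral>\<^sup>+\<omega>. indicator A (X i \<omega>) * cemetery_ext g (X (Suc n) \<omega>) \<partial>M) =
         (\<integral>\<^sup>+\<omega>. indicator A (X i \<omega>) * cemetery_ext (op g) (X n \<omega>) \<partial>M)"
  using g
proof (induction g rule: borel_measurable_induct)
  case (cong f g)
  then have "f = g" by auto
  with cong show ?case by simp
next
  case (set B)
  then show ?case using step_indicator[OF i A] by simp
next
  case (mult f c)
  then have [measurable]: "f \<in> borel_measurable borel" by simp
  show ?case
    using mult.IH by (simp add: op_cmult cemetery_ext_linear mult.left_commute[of _ c] nn_integral_cmult)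
next
  case (add f g)
  then have [measurable]: "f \<in> borel_measurable borel" "g \<in> borel_measurable borel" by simp_all
  show ?case
    using add.IH by (simp add: op_add cemetery_ext_linear distrib_left nn_integral_add)
next
  case (seq U)
  have [measurable]: "\<And>i. U i \<in> borel_measurable borel" by fact
  have lim: "(\<integral>\<^sup>+\<omega>. indicator A (X i \<omega>) * cemetery_ext (SUP i. V i) (X j \<omega>) \<partial>M) =
      (SUP m. \<integral>\<^sup>+\<omega>. indicator A (X i \<omega>) * cemetery_ext (V m) (X j \<omega>) \<partial>M)"
    if "incseq V" and [measurable]: "\<And>i. V i \<in> borel_measurable borel" for V :: "nat \<Rightarrow> 'a \<Rightarrow> ennreal" and j
  proof -
    have "(\<integral>\<^sup>+\<omega>. indicator A (X i \<omega>) * cemetery_ext (SUP i. V i) (X j \<omega>) \<partial>M) =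
        (\<integral>\<^sup>+\<omega>. (SUP m. indicator A (X i \<omega>) * cemetery_ext (V m) (X j \<omega>)) \<partial>M)"
      by (simp add: cemetery_ext_SUP SUP_mult_left_ennreal)
    also have "\<dots> = (SUP m. \<integral>\<^sup>+\<omega>. indicator A (X i \<omega>) * cemetery_ext (V m) (X j \<omega>) \<partial>M)"
      using that(1) by (intro nn_integral_monotone_convergence_SUP incseq_cemetery_ext) measurable
    finally show ?thesis .
  qed
  have op_g: "op (SUP i. U i) = (SUP i. op (U i))" and inc: "incseq (\<lambda>i. op (U i))"
    using seq.hyps(3) by (simp_all add: op_SUP incseq_op)
  have U: "(SUP i. U i) = g" using seq.hyps by simp
  show ?case
    using seq.IH lim[OF seq.hyps(3), of "Suc n"] lim[OF inc, of n] by (simp add: U flip: op_g)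
qed

lemma step:
  assumes i: "i \<le> n" and f: "f \<in> borel_measurable (cemetery_space E)"
    and g [measurable]: "g \<in> borel_measurable borel"
  shows "(\<integral>\<^sup>+\<omega>. f (X i \<omega>) * cemetery_ext g (X (Suc n) \<omega>) \<partial>M) =
         (\<integral>\<^sup>+\<omega>. f (X i \<omega>) * cemetery_ext (op g) (X n \<omega>) \<partial>M)"
  using f
proof (induction f rule: borel_measurable_induct)
  case (cong f g)
  have "f (X i \<omega>) = g (X i \<omega>)" if "\<omega> \<in> space M" for \<omega>
    using cong measurable_space[OF measurable_X that] by auto
  then show ?case
    using cong.IH nn_integral_cong[of M "\<lambda>\<omega>. f (X i \<omega>) * a \<omega>" "\<lambda>\<omega>. g (X i \<omega>) * a \<omega>" for a] by simp
next
  case (set B)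
  then show ?case using step_indicator_left[OF i _ g] by simp
next
  case (mult f c)
  then have [measurable]: "f \<in> borel_measurable (cemetery_space E)" by simp
  show ?case
    using mult.IH by (simp add: mult.assoc nn_integral_cmult)
next
  case (add f g)
  then have [measurable]: "f \<in> borel_measurable (cemetery_space E)" "g \<in> borel_measurable (cemetery_space E)" by simp_all
  show ?case
    using add.IH by (simp add: distrib_right nn_integral_add)
next
  case (seq U)
  have [measurable]: "\<And>i. U i \<in> borel_measurable (cemetery_space E)" by fact
  have "incseq (\<lambda>i' \<omega>. U i' (X i \<omega>) * a \<omega>)" for a :: "_ \<Rightarrow> ennreal"
    using seq.hyps(3) by (intro monoI le_funI mult_right_mono) (auto simp: le_fun_def mono_def)
  then have lim: "(\<integral>\<^sup>+\<omega>. (SUP m. U m) (X i \<omega>) * cemetery_ext g (X j \<omega>) \<partial>M) =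
      (SUP m. \<integral>\<^sup>+\<omega>. U m (X i \<omega>) * cemetery_ext g (X j \<omega>) \<partial>M)"
    if [measurable]: "g \<in> borel_measurable borel" for g j
    by (subst nn_integral_monotone_convergence_SUP[symmetric])
      (measurable, simp add: image_comp SUP_mult_right_ennreal)
  show ?case
    unfolding lim[OF g] lim[OF measurable_op[OF g]] using seq.IH by simp
qed

text \<open>Each use of \<open>step\<close> moves the later time back by one and replaces
  \<open>g\<close> by \<open>op g\<close>, while the factor at time \<open>i\<close> is untouched;
  hence the induction over all \<open>g\<close>.\<close>

lemma steps:
  assumes f [measurable]: "f \<in> borel_measurable (cemetery_space E)"
    and g [measurable]: "g \<in> borel_measurable borel"
  shows "(\<integral>\<^sup>+\<omega>. f (X i \<omega>) * cemetery_ext g (X (i + m) \<omega>) \<partial>M) =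
         (\<integral>\<^sup>+\<omega>. f (X i \<omega>) * cemetery_ext ((op ^^ m) g) (X i \<omega>) \<partial>M)"
  using g
proof (induction m arbitrary: g)
  case (Suc m)
  note [measurable] = Suc.prems
  show ?case
    using step[OF _ f, of i "i + m" g] Suc.IH[of "op g"] by (simp add: funpow_swap1)
qed simp

lemma expectation_X:
  assumes g [measurable]: "g \<in> borel_measurable borel"
  shows "(\<integral>\<^sup>+\<omega>. cemetery_ext g (X n \<omega>) \<partial>M) = (op ^^ n) g x0"
proof -
  have "(\<integral>\<^sup>+\<omega>. cemetery_ext g (X n \<omega>) \<partial>M) = (\<integral>\<^sup>+\<omega>. cemetery_ext ((op ^^ n) g) (X 0 \<omega>) \<partial>M)"
    using steps[of "\<lambda>_. 1" g 0 n] by simp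
  also have "\<dots> = (\<integral>\<^sup>+\<omega>. (op ^^ n) g x0 \<partial>M)"
    using chain by (intro nn_integral_cong_AE) (auto simp: markov_chain_def)
  finally show ?thesis by (simp add: emeasure_space_1)
qed

lemma expectation_sum:
  assumes g [measurable]: "g \<in> borel_measurable borel"
  shows "(\<integral>\<^sup>+\<omega>. (\<Sum>j. cemetery_ext g (X j \<omega>)) \<partial>M) = (\<Sum>j. (op ^^ j) g x0)"
  by (subst nn_integral_suminf) (simp_all add: expectation_X[OF g])

text \<open>For \<open>i \<le> j\<close> the mixed moment is turned into one at time
  \<open>i\<close> alone. Summed over \<open>j\<close>, its second factor is a partial potential of
  \<open>f\<close>, at most \<open>C\<close> from every state; summing the remaining factor over
  \<open>i\<close> gives \<open>C\<close> once more.\<close>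

lemma expectation_sum_square:
  assumes f [measurable]: "f \<in> borel_measurable borel"
    and le: "\<And>x. x \<in> E \<Longrightarrow> f x \<le> C * killing x"
  shows "(\<integral>\<^sup>+\<omega>. (\<Sum>j. cemetery_ext f (X j \<omega>))\<^sup>2 \<partial>M) \<le> 2 * C\<^sup>2"
proof -
  let ?a = "\<lambda>j \<omega>. cemetery_ext f (X j \<omega>)"
  have partial: "(\<integral>\<^sup>+\<omega>. (\<Sum>j<n. ?a j \<omega>)\<^sup>2 \<partial>M) \<le> 2 * C\<^sup>2" for n
  proof -
    have "(\<integral>\<^sup>+\<omega>. (\<Sum>j<n. ?a j \<omega>)\<^sup>2 \<partial>M) \<le> (\<integral>\<^sup>+\<omega>. 2 * (\<Sum>j<n. \<Sum>i\<le>j. ?a i \<omega> * ?a j \<omega>) \<partial>M)"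
      by (intro nn_integral_mono square_sum_le)
    also have "\<dots> = 2 * (\<Sum>j<n. \<Sum>i\<le>j. \<integral>\<^sup>+\<omega>. ?a i \<omega> * ?a j \<omega> \<partial>M)"
      by (simp add: nn_integral_cmult nn_integral_sum)
    also have "(\<Sum>j<n. \<Sum>i\<le>j. \<integral>\<^sup>+\<omega>. ?a i \<omega> * ?a j \<omega> \<partial>M) =
        (\<Sum>j<n. \<Sum>i\<le>j. \<integral>\<^sup>+\<omega>. ?a i \<omega> * cemetery_ext ((op ^^ (j - i)) f) (X i \<omega>) \<partial>M)"
    proof (intro sum.cong refl)
      fix i j :: nat assume "i \<in> {..j}"
      then show "(\<integral>\<^sup>+\<omega>. ?a i \<omega> * ?a j \<omega> \<partial>M) =
          (\<integral>\<^sup>+\<omega>. ?a i \<omega> * cemetery_ext ((op ^^ (j - i)) f) (X i \<omega>) \<partial>M)"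
        using steps[OF measurable_cemetery_ext[OF E f] f, of i "j - i"] by simp
    qed
    \<comment> \<open>The earlier time is moved to the outer sum, so that the inner sum is a
      potential seen from \<open>X i\<close>.\<close>
    also have "\<dots> = (\<Sum>i<n. \<Sum>j=i..<n. \<integral>\<^sup>+\<omega>. ?a i \<omega> * cemetery_ext ((op ^^ (j - i)) f) (X i \<omega>) \<partial>M)"
      by (subst sum.Sigma, simp, simp, subst sum.Sigma, simp, simp)
        (rule sum.reindex_bij_witness[where i = "\<lambda>(a, b). (b, a)" and j = "\<lambda>(a, b). (b, a)"]; force)
    also have "\<dots> \<le> (\<Sum>i<n. \<integral>\<^sup>+\<omega>. C * ?a i \<omega> \<partial>M)"
    proof (intro sum_mono)
      fix i
      have "(\<Sum>j=i..<n. \<integral>\<^sup>+\<omega>. ?a i \<omega> * cemetery_ext ((op ^^ (j - i)) f) (X i \<omega>) \<partial>M) =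
          (\<integral>\<^sup>+\<omega>. ?a i \<omega> * (\<Sum>j=i..<n. cemetery_ext ((op ^^ (j - i)) f) (X i \<omega>)) \<partial>M)"
        by (simp add: sum_distrib_left nn_integral_sum)
      also have "\<dots> \<le> (\<integral>\<^sup>+\<omega>. C * ?a i \<omega> \<partial>M)"
      proof (rule nn_integral_mono)
        fix \<omega> assume \<omega>: "\<omega> \<in> space M"
        have "(\<Sum>j=i..<n. (op ^^ (j - i)) f x) \<le> C" if "x \<in> E" for x
        proof -
          have "(\<Sum>j=i..<n. (op ^^ (j - i)) f x) = (\<Sum>j<n - i. (op ^^ j) f x)"
            by (rule sum.reindex_bij_witness[where i = "\<lambda>j. j + i" and j = "\<lambda>j. j - i"]) auto
          also have "\<dots> \<le> (\<Sum>m. (op ^^ m) f x)"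
            by (intro sum_le_suminf) auto
          also have "\<dots> \<le> C"
            using le that by (intro potential_le) auto
          finally show ?thesis .
        qed
        then show "?a i \<omega> * (\<Sum>j=i..<n. cemetery_ext ((op ^^ (j - i)) f) (X i \<omega>)) \<le> C * ?a i \<omega>"
          by (cases rule: X_cases[OF \<omega>, of i]) (auto simp: mult.commute[of C] intro!: mult_left_mono)
      qed
      finally show "(\<Sum>j=i..<n. \<integral>\<^sup>+\<omega>. ?a i \<omega> * cemetery_ext ((op ^^ (j - i)) f) (X i \<omega>) \<partial>M)
        \<le> (\<integral>\<^sup>+\<omega>. C * ?a i \<omega> \<partial>M)" .
    qed
    also have "\<dots> = C * (\<Sum>i<n. (op ^^ i) f x0)"
      by (simp add: nn_integral_cmult expectation_X sum_distrib_left)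
    also have "\<dots> \<le> C * (\<Sum>i. (op ^^ i) f x0)"
      by (intro mult_left_mono sum_le_suminf) auto
    also have "\<dots> \<le> C * C"
      using le x0 by (intro mult_left_mono potential_le) auto
    finally show ?thesis
      by (simp add: power2_eq_square mult_left_mono)
  qed
  \<comment> \<open>The squares of the partial sums increase, so the bound passes to the infinite
    sum by monotone convergence.\<close>
  have mono: "incseq (\<lambda>n. (\<Sum>j<n. ?a j \<omega>)\<^sup>2)" for \<omega>
    by (intro monoI power_mono sum_mono2) auto
  have "(\<lambda>n. (\<Sum>j<n. ?a j \<omega>)\<^sup>2) \<longlonglongrightarrow> (\<Sum>j. ?a j \<omega>)\<^sup>2" for \<omega>
    unfolding power2_eq_square
    by (intro tendsto_mult_ennreal summable_LIMSEQ) auto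
  then have "(\<Sum>j. ?a j \<omega>)\<^sup>2 = (SUP n. (\<Sum>j<n. ?a j \<omega>)\<^sup>2)" for \<omega>
    using LIMSEQ_unique LIMSEQ_SUP[OF mono] by blast
  then have "(\<integral>\<^sup>+\<omega>. (\<Sum>j. ?a j \<omega>)\<^sup>2 \<partial>M) = (\<integral>\<^sup>+\<omega>. (SUP n. (\<Sum>j<n. ?a j \<omega>)\<^sup>2) \<partial>M)"
    by simp
  also have "\<dots> = (SUP n. \<integral>\<^sup>+\<omega>. (\<Sum>j<n. ?a j \<omega>)\<^sup>2 \<partial>M)"
    by (intro nn_integral_monotone_convergence_SUP)
      (use mono in \<open>auto simp: mono_def le_fun_def\<close>)
  also have "\<dots> \<le> 2 * C\<^sup>2"
    using partial by (intro SUP_least)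
  finally show ?thesis .
qed

end

section \<open>Iterating the equation for u, and the expectation of the estimator\<close>

context killed_walk begin

lemma op_pow_cong:
  assumes "\<And>x. x \<in> E \<Longrightarrow> f x = g x" "x \<in> E"
  shows "(op ^^ n) f x = (op ^^ n) g x"
proof (rule antisym)
  show "(op ^^ n) f x \<le> (op ^^ n) g x" by (rule op_pow_mono) (simp_all add: assms)
  show "(op ^^ n) g x \<le> (op ^^ n) f x" by (rule op_pow_mono) (simp_all add: assms)
qed

lemma op_pow_le:
  assumes "\<And>x. x \<in> E \<Longrightarrow> f x \<le> B" "x \<in> E"
  shows "(op ^^ n) f x \<le> B * (op ^^ n) (indicator E) x"
proof -
  have "(op ^^ n) f x \<le> (op ^^ n) (\<lambda>x. B * indicator E x) x"
    using assms by (intro op_pow_mono) auto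
  then show ?thesis by (simp add: op_pow_cmult)
qed

lemma op_pow_indicator_le:
  assumes "x \<in> E"
  shows "(op ^^ n) (indicator E) x \<le> 1"
proof -
  have "(op ^^ n) (indicator E) x \<le> (\<Sum>m<n. (op ^^ m) killing x) + (op ^^ n) (indicator E) x"
    by (intro add_increasing) auto
  also have "\<dots> = 1"
    using sum_killing[where x = x and n = n] assms by simp
  finally show ?thesis .
qed

lemma op_pow_le_const:
  assumes "\<And>x. x \<in> E \<Longrightarrow> f x \<le> B" "x \<in> E"
  shows "(op ^^ n) f x \<le> B"
proof -
  have "(op ^^ n) f x \<le> B * (op ^^ n) (indicator E) x"
    using assms by (rule op_pow_le)
  also have "\<dots> \<le> B * 1"
    using assms(2) by (intro mult_left_mono op_pow_indicator_le) auto
  finally show ?thesis by simp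
qed

text \<open>With \<open>K\<close> for \<open>op\<close>, this is \<open>u = K^n u\<close> plus the
  sum of \<open>K^m F\<close> over \<open>m < n\<close>, for \<open>u = up - um\<close> and
  \<open>F = Fp - Fm\<close>. Every negative part is moved to the other side, because subtraction in
  \<open>ennreal\<close> truncates; \<open>eq\<close> is the case of one step.\<close>

lemma telescope:
  assumes [measurable]: "up \<in> borel_measurable borel" "um \<in> borel_measurable borel"
      "Fp \<in> borel_measurable borel" "Fm \<in> borel_measurable borel"
    and bound: "\<And>x. x \<in> E \<Longrightarrow> up x \<le> B" "\<And>x. x \<in> E \<Longrightarrow> um x \<le> B" "B < \<infinity>"
    and eq: "\<And>x. x \<in> E \<Longrightarrow> up x + op um x + Fm x = um x + op up x + Fp x"
    and x: "x \<in> E"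
  shows "up x + (op ^^ n) um x + (\<Sum>m<n. (op ^^ m) Fm x) = um x + (op ^^ n) up x + (\<Sum>m<n. (op ^^ m) Fp x)"
proof (induction n)
  case (Suc n)
  \<comment> \<open>After adding the equation at level \<open>n\<close>, these terms stand on both
    sides; the bound \<open>B\<close> makes them finite and so cancellable.\<close>
  let ?c = "(op ^^ n) um x + (op ^^ n) up x"
  have c: "?c \<noteq> \<top>"
    using op_pow_le_const[where f = up and n = n, OF bound(1) x] op_pow_le_const[where f = um and n = n, OF bound(2) x] bound(3)
    by (auto simp: top_unique)
  have "(op ^^ n) (\<lambda>x. up x + op um x + Fm x) x = (op ^^ n) (\<lambda>x. um x + op up x + Fp x) x"
    using eq x by (rule op_pow_cong)
  then have "(op ^^ n) up x + (op ^^ Suc n) um x + (op ^^ n) Fm x =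
      (op ^^ n) um x + (op ^^ Suc n) up x + (op ^^ n) Fp x"
    by (simp add: op_pow_add funpow_swap1)
  with Suc have "(up x + (op ^^ n) um x + (\<Sum>m<n. (op ^^ m) Fm x)) + ((op ^^ n) up x + (op ^^ Suc n) um x + (op ^^ n) Fm x) =
     (um x + (op ^^ n) up x + (\<Sum>m<n. (op ^^ m) Fp x)) + ((op ^^ n) um x + (op ^^ Suc n) up x + (op ^^ n) Fp x)"
    by (simp only:)
  then have "?c + (up x + (op ^^ Suc n) um x + (\<Sum>m<Suc n. (op ^^ m) Fm x)) =
      ?c + (um x + (op ^^ Suc n) up x + (\<Sum>m<Suc n. (op ^^ m) Fp x))"
    by (simp only: sum.lessThan_Suc ac_simps)
  then show ?case using c by (simp only: ennreal_add_left_cancel infinity_ennreal_def) blast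
next
  case 0
  show ?case by (simp only: funpow_0 lessThan_0 sum.empty add_0_right add.commute)
qed

end

context killed_chain begin

context
  fixes F u :: "'a \<Rightarrow> real" and B C :: real
  assumes F [measurable]: "F \<in> borel_measurable borel" and u [measurable]: "u \<in> borel_measurable borel"
    and F_le: "\<And>x. x \<in> E \<Longrightarrow> ennreal \<bar>F x\<bar> \<le> ennreal C * killing x" and C: "0 \<le> C"
    and u_le: "\<And>x. x \<in> E \<Longrightarrow> \<bar>u x\<bar> \<le> B"
    and u_eq: "\<And>x. x \<in> E \<Longrightarrow> u x = (\<integral>y. u y \<partial>Q x) + F x"
    and death: "(\<lambda>n. (op ^^ n) (indicator E) x0) \<longlonglongrightarrow> 0"
begin

text \<open>\<open>ennreal\<close> sends negative reals to 0, so \<open>ennreal (u x)\<close> and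
  \<open>ennreal (- u x)\<close> are the positive and negative parts of \<open>u x\<close>. This is
  \<open>u_eq\<close> in the form that \<open>telescope\<close> expects.\<close>

lemma pos_neg_eq:
  assumes x: "x \<in> E"
  shows "ennreal (u x) + op (\<lambda>y. ennreal (- u y)) x + ennreal (- F x) =
    ennreal (- u x) + op (\<lambda>y. ennreal (u y)) x + ennreal (F x)"
proof -
  have "op (\<lambda>y. ennreal (u y)) x \<le> ennreal B" "op (\<lambda>y. ennreal (- u y)) x \<le> ennreal B"
    using op_pow_le_const[where n = 1, OF _ x, of "\<lambda>y. ennreal (u y)" "ennreal B"]
      op_pow_le_const[where n = 1, OF _ x, of "\<lambda>y. ennreal (- u y)" "ennreal B"] u_le
    by (simp_all add: abs_le_iff ennreal_leI)
  then have fin: "op (\<lambda>y. ennreal (u y)) x < \<top>" "op (\<lambda>y. ennreal (- u y)) x < \<top>"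
    by (simp_all add: le_less_trans[OF _ ennreal_less_top])
  define a b where "a = enn2real (op (\<lambda>y. ennreal (u y)) x)" and "b = enn2real (op (\<lambda>y. ennreal (- u y)) x)"
  have a: "op (\<lambda>y. ennreal (u y)) x = ennreal a"
    unfolding a_def using fin by simp
  have b: "op (\<lambda>y. ennreal (- u y)) x = ennreal b"
    unfolding b_def using fin by simp
  have "integrable (Q x) u"
  proof (rule integrableI_bounded)
    have "(\<integral>\<^sup>+y. ennreal (norm (u y)) \<partial>Q x) \<le> (\<integral>\<^sup>+y. ennreal B \<partial>Q x)"
      by (intro nn_integral_mono_AE eventually_mono[OF AE_Q_E] ennreal_leI) (simp add: u_le)
    also have "\<dots> \<le> ennreal B * 1"
      using mult_left_mono[OF emeasure_Q_le[of x UNIV], of "ennreal B"] by simp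
    finally show "(\<integral>\<^sup>+y. ennreal (norm (u y)) \<partial>Q x) < \<infinity>"
      by (auto intro: le_less_trans)
  qed measurable
  then have "(\<integral>y. u y \<partial>Q x) = a - b"
    by (simp add: real_lebesgue_integral_def a_def b_def op_def)
  with u_eq[OF x] have eq: "max 0 (u x) + b + max 0 (- F x) = max 0 (- u x) + a + max 0 (F x)"
    by (simp add: max_def)
  have "a \<ge> 0" "b \<ge> 0" by (auto simp: a_def b_def)
  have "ennreal (u x) + ennreal b + ennreal (- F x) = ennreal (max 0 (u x) + b + max 0 (- F x))"
    using \<open>b \<ge> 0\<close> by (simp add: ennreal_plus ennreal_max_0)
  also have "\<dots> = ennreal (- u x) + ennreal a + ennreal (F x)"
    unfolding eq using \<open>a \<ge> 0\<close> by (simp add: ennreal_plus ennreal_max_0)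
  finally show ?thesis by (simp only: a b)
qed

lemma op_pow_death:
  assumes "\<And>x. x \<in> E \<Longrightarrow> g x \<le> ennreal b"
  shows "(\<lambda>n. (op ^^ n) g x0) \<longlonglongrightarrow> 0"
proof (rule tendsto_sandwich[where f = "\<lambda>_. 0" and h = "\<lambda>n. ennreal b * (op ^^ n) (indicator E) x0"])
  show "\<forall>\<^sub>F n in sequentially. (op ^^ n) g x0 \<le> ennreal b * (op ^^ n) (indicator E) x0"
    using op_pow_le[OF assms x0] by simp
  show "(\<lambda>n. ennreal b * (op ^^ n) (indicator E) x0) \<longlonglongrightarrow> 0"
    using ennreal_tendsto_cmult[OF _ death, of "ennreal b"] by simp
qed auto

text \<open>\<open>potential_le\<close> bounds the expected sum of absolute values, which yields
  almost sure convergence and termwise integration. The partial expectations differ from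
  \<open>u x0\<close> only by the expectation of \<open>u\<close> over walks still alive at time
  \<open>n\<close>, which tends to 0 by \<open>death\<close>.\<close>

lemma unbiased_estimator:
  defines "S \<equiv> \<lambda>\<omega>. \<Sum>j. cemetery_ext F (X j \<omega>)"
  shows "AE \<omega> in M. summable (\<lambda>j. cemetery_ext F (X j \<omega>))" (is ?AE)
    and "integrable M S" (is ?int) and "expectation S = u x0" (is ?eq)
    and "integrable M (\<lambda>\<omega>. (S \<omega>)\<^sup>2)" (is ?int2) and "expectation (\<lambda>\<omega>. (S \<omega>)\<^sup>2) \<le> 2 * C\<^sup>2" (is ?sq)
proof -
  define f where "f x = ennreal \<bar>F x\<bar>" for x
  have f [measurable]: "f \<in> borel_measurable borel" unfolding f_def by measurable
  have f_le: "f x \<le> ennreal C * killing x" if "x \<in> E" for x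
    using F_le[OF that] by (simp add: f_def)
  have abs: "ennreal \<bar>cemetery_ext F s\<bar> = cemetery_ext f s" for s
    by (cases s) (auto simp: f_def)
  have potential: "(\<Sum>m. (op ^^ m) f x0) \<le> ennreal C"
    using f f_le x0 by (rule potential_le)
  have nn: "(\<integral>\<^sup>+\<omega>. ennreal (norm (cemetery_ext F (X j \<omega>))) \<partial>M) = (op ^^ j) f x0" for j
    by (simp add: abs expectation_X)
  have fin: "(op ^^ j) f x0 < \<infinity>" for j
    using ennreal_suminf_lessD[of "\<lambda>m. (op ^^ m) f x0" \<top> j] potential by (simp add: le_less_trans)
  have int: "integrable M (\<lambda>\<omega>. cemetery_ext F (X j \<omega>))" for j
    using nn fin by (intro integrableI_bounded) auto
  have E_sum: "(\<integral>\<^sup>+\<omega>. (\<Sum>j. cemetery_ext f (X j \<omega>)) \<partial>M) \<le> ennreal C"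
    using potential by (simp add: expectation_sum)
  then have "AE \<omega> in M. (\<Sum>j. cemetery_ext f (X j \<omega>)) \<noteq> \<infinity>"
    by (intro nn_integral_PInf_AE) (auto simp: top_unique)
  then have summ: "AE \<omega> in M. summable (\<lambda>j. norm (cemetery_ext F (X j \<omega>)))"
  proof eventually_elim
    case (elim \<omega>)
    then show ?case
      by (intro summable_suminf_not_top) (auto simp: abs)
  qed
  then show ?AE by (auto elim!: eventually_mono intro: summable_norm_cancel)
  have real_nn: "(\<integral>\<omega>. norm (cemetery_ext F (X j \<omega>)) \<partial>M) = enn2real ((op ^^ j) f x0)" for j
    using nn by (subst integral_eq_nn_integral) auto
  have summ2: "summable (\<lambda>j. \<integral>\<omega>. norm (cemetery_ext F (X j \<omega>)) \<partial>M)"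
    unfolding real_nn
  proof (rule summable_suminf_not_top)
    show "(\<Sum>i. ennreal (enn2real ((op ^^ i) f x0))) \<noteq> \<top>"
      using potential fin by (auto simp: top_unique)
  qed auto
  show ?int unfolding S_def by (intro integrable_suminf int summ summ2)
  have sums: "(\<lambda>j. \<integral>\<omega>. cemetery_ext F (X j \<omega>) \<partial>M) sums expectation S"
    unfolding S_def by (intro sums_integral int summ summ2)
  have "(\<lambda>n. \<Sum>j<n. \<integral>\<omega>. cemetery_ext F (X j \<omega>) \<partial>M) \<longlonglongrightarrow> u x0"
  proof -
    let ?up = "\<lambda>x. ennreal (u x)" and ?um = "\<lambda>x. ennreal (- u x)"
    let ?Fp = "\<lambda>x. ennreal (F x)" and ?Fm = "\<lambda>x. ennreal (- F x)"
    have ub: "?up x \<le> ennreal B" "?um x \<le> ennreal B" if "x \<in> E" for x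
      using u_le[OF that] by (auto intro!: ennreal_leI)
    have tel: "?up x0 + (op ^^ n) ?um x0 + (\<Sum>m<n. (op ^^ m) ?Fm x0) =
        ?um x0 + (op ^^ n) ?up x0 + (\<Sum>m<n. (op ^^ m) ?Fp x0)" for n
      by (rule telescope[of _ _ _ _ "ennreal B"]) (use ub pos_neg_eq x0 in auto)
    have ext_pos: "ennreal (cemetery_ext F s) = cemetery_ext ?Fp s" "ennreal (- cemetery_ext F s) = cemetery_ext ?Fm s" for s
      by (cases s; simp)+
    have E_F: "(\<integral>\<omega>. cemetery_ext F (X j \<omega>) \<partial>M) = enn2real ((op ^^ j) ?Fp x0) - enn2real ((op ^^ j) ?Fm x0)" for j
      by (subst real_lebesgue_integral_def[OF int]) (simp add: ext_pos expectation_X)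
    have Ffin: "(op ^^ j) ?Fp x0 < \<infinity>" "(op ^^ j) ?Fm x0 < \<infinity>" for j
      by (rule le_less_trans[OF op_pow_mono[OF _ x0] fin], simp add: f_def ennreal_leI)+
    have ufin: "(op ^^ n) g x0 < \<infinity>" if "\<And>x. x \<in> E \<Longrightarrow> g x \<le> ennreal B" for n g
      using le_less_trans[OF op_pow_le_const[OF that x0] ennreal_less_top] by simp
    have partial: "(\<Sum>j<n. \<integral>\<omega>. cemetery_ext F (X j \<omega>) \<partial>M) =
        u x0 + enn2real ((op ^^ n) ?um x0) - enn2real ((op ^^ n) ?up x0)" for n
    proof -
      have sum_enn2real: "enn2real (\<Sum>m<n. (op ^^ m) g x0) = (\<Sum>m<n. enn2real ((op ^^ m) g x0))"
        if "\<And>m. (op ^^ m) g x0 < \<infinity>" for g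
        using that by (subst enn2real_sum) (auto simp: o_def)
      have "enn2real (?up x0 + (op ^^ n) ?um x0 + (\<Sum>m<n. (op ^^ m) ?Fm x0)) =
        enn2real (?up x0) + enn2real ((op ^^ n) ?um x0) + (\<Sum>m<n. enn2real ((op ^^ m) ?Fm x0))"
        using ufin[of ?um n] ub Ffin by (subst enn2real_plus; simp add: sum_enn2real)+
      moreover have "enn2real (?um x0 + (op ^^ n) ?up x0 + (\<Sum>m<n. (op ^^ m) ?Fp x0)) =
        enn2real (?um x0) + enn2real ((op ^^ n) ?up x0) + (\<Sum>m<n. enn2real ((op ^^ m) ?Fp x0))"
        using ufin[of ?up n] ub Ffin by (subst enn2real_plus; simp add: sum_enn2real)+
      moreover have "enn2real (?up x0) - enn2real (?um x0) = u x0"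
        by (cases "u x0 \<ge> 0") (auto simp: ennreal_neg)
      ultimately show ?thesis
        using arg_cong[OF tel[of n], of enn2real] by (simp add: E_F sum_subtractf)
    qed
    have "(\<lambda>n. u x0 + enn2real ((op ^^ n) ?um x0) - enn2real ((op ^^ n) ?up x0)) \<longlonglongrightarrow> u x0 + enn2real 0 - enn2real 0"
      using op_pow_death[where g = ?um, OF ub(2)] op_pow_death[where g = ?up, OF ub(1)]
      by (intro tendsto_add tendsto_diff tendsto_const tendsto_enn2real) simp_all
    then show ?thesis by (simp add: partial)
  qed
  with sums show ?eq unfolding sums_def by (rule LIMSEQ_unique)
  have S_le: "AE \<omega> in M. ennreal ((S \<omega>)\<^sup>2) \<le> (\<Sum>j. cemetery_ext f (X j \<omega>))\<^sup>2"
    using summ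
  proof eventually_elim
    case (elim \<omega>)
    have "ennreal \<bar>S \<omega>\<bar> \<le> ennreal (\<Sum>j. \<bar>cemetery_ext F (X j \<omega>)\<bar>)"
      using elim unfolding S_def by (intro ennreal_leI summable_rabs) simp
    also have "\<dots> = (\<Sum>j. cemetery_ext f (X j \<omega>))"
      using elim by (simp add: suminf_ennreal2[symmetric] abs)
    finally have "(ennreal \<bar>S \<omega>\<bar>)\<^sup>2 \<le> (\<Sum>j. cemetery_ext f (X j \<omega>))\<^sup>2"
      by (intro power_mono) auto
    then show ?case by (simp add: ennreal_power)
  qed
  have S_meas [measurable]: "S \<in> borel_measurable M" using \<open>?int\<close> by simp
  have sq: "(\<integral>\<^sup>+\<omega>. ennreal ((S \<omega>)\<^sup>2) \<partial>M) \<le> ennreal (2 * C\<^sup>2)"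
  proof -
    have "(\<integral>\<^sup>+\<omega>. ennreal ((S \<omega>)\<^sup>2) \<partial>M) \<le> (\<integral>\<^sup>+\<omega>. (\<Sum>j. cemetery_ext f (X j \<omega>))\<^sup>2 \<partial>M)"
      by (rule nn_integral_mono_AE[OF S_le])
    also have "\<dots> \<le> 2 * (ennreal C)\<^sup>2"
      using f f_le by (rule expectation_sum_square)
    also have "\<dots> = ennreal (2 * C\<^sup>2)"
      using C by (simp add: ennreal_mult ennreal_power)
    finally show ?thesis .
  qed
  show ?int2
    using sq by (intro integrableI_bounded) (auto intro: le_less_trans)
  show ?sq
    using sq by (subst integral_eq_nn_integral) (auto intro!: enn2real_leI)
qed

end

end

section \<open>The walk in the boundary layer\<close>

lemma outer_unit_normal_closure:
  assumes "outer_unit_normal D y n" "w \<in> closure D"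
  shows "(w - y) \<bullet> n \<le> 0"
proof -
  have "closure D \<subseteq> {w. (w - y) \<bullet> n \<le> 0}"
    using assms(1) unfolding outer_unit_normal_def
    by (intro closure_minimal closed_Collect_le continuous_intros) auto
  with assms(2) show ?thesis by auto
qed

text \<open>Expansion in the orthogonal basis \<open>a\<close>, \<open>\<i> * a\<close>, whose two
  vectors have the same length; the factor \<open>a \<bullet> a\<close> replaces a division and a
  condition on \<open>a\<close>.\<close>

lemma inner_complex_orthogonal_expansion:
  fixes a d n :: complex
  shows "(a \<bullet> a) * (n \<bullet> d) = (n \<bullet> a) * (d \<bullet> a) + (n \<bullet> (\<i> * a)) * (d \<bullet> (\<i> * a))"
  by (simp add: inner_complex_def algebra_simps)

lemma orthogonal_unit_complex:
  fixes e f :: complex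
  assumes "norm e = 1" "norm f = 1" "f \<bullet> e = 0"
  shows "f = \<i> * e \<or> f = - (\<i> * e)"
proof -
  have e: "e \<bullet> e = 1" and f: "f \<bullet> f = 1" using assms by (simp_all add: dot_square_norm)
  define s where "s = f \<bullet> (\<i> * e)"
  have "s * s = 1"
    using inner_complex_orthogonal_expansion[of e f f] e f assms(3) by (simp add: s_def)
  then have "s = 1 \<or> s = -1" by (simp add: square_eq_1_iff)
  moreover have "f = s *\<^sub>R (\<i> * e)"
  proof -
    have "(f - s *\<^sub>R (\<i> * e)) \<bullet> (f - s *\<^sub>R (\<i> * e)) = f \<bullet> f - 2 * s * s + s * s * ((\<i> * e) \<bullet> (\<i> * e))"
      by (simp add: inner_diff_left inner_diff_right s_def inner_commute)
    also have "(\<i> * e) \<bullet> (\<i> * e) = e \<bullet> e" by (simp add: inner_complex_def)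
    finally have "(f - s *\<^sub>R (\<i> * e)) \<bullet> (f - s *\<^sub>R (\<i> * e)) = 0"
      using e f \<open>s * s = 1\<close> by (simp add: mult.assoc)
    then show ?thesis by (simp only: inner_eq_zero_iff) simp
  qed
  ultimately show ?thesis by auto
qed

text \<open>
  Otherwise a limit of normals leaning towards \<open>a\<close> would be orthogonal to \<open>a\<close>, so \<open>D\<close> would lie
  on the \<open>b\<close>-side of the segment along \<open>a\<close>, and such a normal would cut off the end point of that segment.
\<close>

lemma normals_near_apex:
  fixes D :: "complex set" and a b x0 :: complex
  assumes a: "a \<noteq> 0" and b: "b = s *\<^sub>R (\<i> * a)" and s: "s \<noteq> 0" and t: "t > 0"
    and xa: "x0 + t *\<^sub>R a \<in> closure D" and xb: "x0 + t *\<^sub>R b \<in> closure D"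
  shows "\<exists>\<rho>>0. \<forall>y\<in>closure D. \<forall>n. dist y x0 < \<rho> \<longrightarrow> outer_unit_normal D y n \<longrightarrow> n \<bullet> a \<le> 0"
proof (rule ccontr)
  assume neg: "\<not> ?thesis"
  have "\<exists>y n. y \<in> closure D \<and> dist y x0 < 1 / real (Suc m) \<and> outer_unit_normal D y n \<and> n \<bullet> a > 0" for m
  proof -
    have "1 / real (Suc m) > 0" by simp
    with neg show ?thesis by (meson not_le)
  qed
  then obtain Y N where Y: "\<And>m. Y m \<in> closure D" "\<And>m. dist (Y m) x0 < 1 / real (Suc m)"
    and N: "\<And>m. outer_unit_normal D (Y m) (N m)" "\<And>m. N m \<bullet> a > 0"
    by metis
  have Y_lim: "Y \<longlonglongrightarrow> x0"
  proof (rule metric_LIMSEQ_I)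
    fix r :: real assume "r > 0"
    then obtain k where k: "1 / real (Suc k) < r" using nat_approx_posE by blast
    have "dist (Y m) x0 < r" if "m \<ge> k" for m
    proof -
      have "1 / real (Suc m) \<le> 1 / real (Suc k)" using that by (intro divide_left_mono) auto
      with Y(2)[of m] k show ?thesis by linarith
    qed
    then show "\<exists>k. \<forall>m\<ge>k. dist (Y m) x0 < r" by blast
  qed
  have "\<And>m. N m \<in> sphere 0 1" using N(1) by (simp add: outer_unit_normal_def)
  then obtain n r where n: "n \<in> sphere 0 1" and r: "strict_mono (r :: nat \<Rightarrow> nat)" and lim: "(N \<circ> r) \<longlonglongrightarrow> n"
    using compact_sphere[of "0::complex" 1] unfolding compact_def by blast
  have Nr: "(\<lambda>m. N (r m)) \<longlonglongrightarrow> n" using lim by (simp add: o_def)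
  have Yr: "(\<lambda>m. Y (r m)) \<longlonglongrightarrow> x0"
    using LIMSEQ_subseq_LIMSEQ[OF Y_lim r] by (simp add: o_def)
  have supp: "(w - x0) \<bullet> n \<le> 0" if w: "w \<in> closure D" for w
  proof (rule LIMSEQ_le_const2)
    show "(\<lambda>m. (w - Y (r m)) \<bullet> N (r m)) \<longlonglongrightarrow> (w - x0) \<bullet> n"
      by (intro tendsto_intros Nr Yr)
    show "\<exists>k. \<forall>m\<ge>k. (w - Y (r m)) \<bullet> N (r m) \<le> 0"
      using outer_unit_normal_closure[OF N(1) w] by blast
  qed
  have "n \<bullet> a \<ge> 0"
    by (rule LIMSEQ_le_const[OF tendsto_inner[OF Nr tendsto_const]]) (use N(2) less_imp_le in blast)
  moreover have "n \<bullet> a \<le> 0"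
    using supp[OF xa] t by (simp add: mult_le_0_iff inner_commute)
  ultimately have na: "n \<bullet> a = 0" by simp
  let ?c = "\<i> * a"
  have "n \<bullet> b \<le> 0"
    using supp[OF xb] t by (simp add: mult_le_0_iff inner_commute)
  then have snc: "s * (n \<bullet> ?c) \<le> 0" by (simp add: b)
  have "(a \<bullet> a) * (n \<bullet> n) = (n \<bullet> ?c)\<^sup>2"
    using inner_complex_orthogonal_expansion[of a n n] na by (simp add: power2_eq_square)
  then have nc: "n \<bullet> ?c \<noteq> 0"
    using a n by auto
  with snc s have snc: "s * (n \<bullet> ?c) < 0" by (simp add: less_le)
  \<comment> \<open>The limit normal \<open>n\<close> is orthogonal to \<open>a\<close>, hence a
    multiple of \<open>\<i> * a\<close> that points away from \<open>b\<close>; since it supports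
    \<open>D\<close> at \<open>x0\<close>, it puts \<open>Y m\<close> on the side of
    \<open>b\<close>.\<close>
  have beta: "s * ((Y m - x0) \<bullet> ?c) \<ge> 0" for m
  proof -
    have "(n \<bullet> ?c) * ((Y m - x0) \<bullet> ?c) = (a \<bullet> a) * (n \<bullet> (Y m - x0))"
      using inner_complex_orthogonal_expansion[of a n "Y m - x0"] na by simp
    also have "\<dots> \<le> 0"
      using supp[OF Y(1)[of m]] by (simp add: mult_nonneg_nonpos inner_commute)
    finally have "(n \<bullet> ?c) * ((Y m - x0) \<bullet> ?c) \<le> 0" .
    with snc show ?thesis
      by (auto simp: mult_le_0_iff mult_less_0_iff zero_le_mult_iff)
  qed
  have "(\<lambda>m. s * (N (r m) \<bullet> ?c)) \<longlonglongrightarrow> s * (n \<bullet> ?c)"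
    by (intro tendsto_intros Nr)
  then have ev1: "\<forall>\<^sub>F m in sequentially. s * (N (r m) \<bullet> ?c) < 0"
    using snc by (rule order_tendstoD)
  have "(\<lambda>m. (Y (r m) - x0) \<bullet> a) \<longlonglongrightarrow> (x0 - x0) \<bullet> a"
    by (intro tendsto_intros Yr)
  moreover have "(x0 - x0) \<bullet> a < t * (a \<bullet> a)" using t a by simp
  ultimately have ev2: "\<forall>\<^sub>F m in sequentially. (Y (r m) - x0) \<bullet> a < t * (a \<bullet> a)"
    by (rule order_tendstoD)
  \<comment> \<open>Late in the sequence the normal still points away from \<open>b\<close>, and its
    base point has not yet advanced along \<open>a\<close> as far as
    \<open>x0 + t *\<^sub>R a\<close>. This end point then lies strictly beyond the supporting
    line.\<close>
  obtain m where m: "s * (N (r m) \<bullet> ?c) < 0" "(Y (r m) - x0) \<bullet> a < t * (a \<bullet> a)"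
    using eventually_happens[OF eventually_conj[OF ev1 ev2]] by auto
  let ?d = "Y (r m) - x0" and ?n = "N (r m)"
  have "(x0 + t *\<^sub>R a - Y (r m)) \<bullet> ?n \<le> 0"
    using outer_unit_normal_closure[OF N(1) xa] .
  then have "t * (?n \<bullet> a) \<le> ?n \<bullet> ?d"
    by (simp add: inner_simps inner_commute)
  then have "(a \<bullet> a) * (t * (?n \<bullet> a)) \<le> (a \<bullet> a) * (?n \<bullet> ?d)"
    by (intro mult_left_mono) auto
  also have "\<dots> = (?n \<bullet> a) * (?d \<bullet> a) + (?n \<bullet> ?c) * (?d \<bullet> ?c)"
    by (rule inner_complex_orthogonal_expansion)
  also have "(?n \<bullet> ?c) * (?d \<bullet> ?c) \<le> 0"
    using m(1) beta[of "r m"] by (auto simp: mult_le_0_iff mult_less_0_iff zero_le_mult_iff)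
  finally have "(?n \<bullet> a) * (t * (a \<bullet> a)) \<le> (?n \<bullet> a) * (?d \<bullet> a)" by (simp add: ac_simps)
  with N(2)[of "r m"] m(2) show False by (simp add: mult_le_cancel_left)
qed

text \<open>The sign of \<open>c j\<close> makes \<open>\<xi> j\<close> the minimum or the maximum
  of all values, and the move goes strictly away from it. Two successive points cannot be extremes
  of the same kind, so the sequence alternates between two distinct values.\<close>

lemma no_convergent_alternating_extremes:
  fixes \<xi> c :: "nat \<Rightarrow> real"
  assumes ext: "\<And>i j. c j * (\<xi> i - \<xi> j) \<ge> 0" and move: "\<And>j. c j * (\<xi> (Suc j) - \<xi> j) > 0"
  shows "\<not> \<xi> \<longlonglongrightarrow> L"
proof
  assume lim: "\<xi> \<longlonglongrightarrow> L"
  have two: "\<xi> (Suc (Suc j)) = \<xi> j" for j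
    using ext[of j "Suc (Suc j)"] ext[of "Suc j" j] ext[of "Suc (Suc j)" j] ext[of "Suc (Suc j)" "Suc j"] ext[of "Suc j" "Suc (Suc j)"]
      move[of j] move[of "Suc j"]  move[of "Suc (Suc j)"]
    by (auto simp: zero_le_mult_iff zero_less_mult_iff)
  have "\<xi> (2 * m) = \<xi> 0" "\<xi> (Suc (2 * m)) = \<xi> 1" for m
    by (induction m) (auto simp: two)
  moreover have "(\<lambda>m. \<xi> (2 * m)) \<longlonglongrightarrow> L"
    using LIMSEQ_subseq_LIMSEQ[OF lim, of "\<lambda>m. 2 * m"] by (simp add: o_def strict_mono_def)
  moreover have "(\<lambda>m. \<xi> (Suc (2 * m))) \<longlonglongrightarrow> L"
    using LIMSEQ_subseq_LIMSEQ[OF lim, of "\<lambda>m. Suc (2 * m)"] by (simp add: o_def strict_mono_def)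
  ultimately have "\<xi> 0 = L" "\<xi> 1 = L"
    by (simp_all add: LIMSEQ_const_iff)
  with move[of 0] show False by simp
qed

context reflecting_walk begin

lemma norm_e1: "x \<in> outer_layer D \<epsilon> \<Longrightarrow> norm (e1 x) = 1"
  using normal[of "\<pi>D x"] proj_D[of x] by (simp add: e1_def outer_unit_normal_def)

lemma e2_cases: "x \<in> outer_layer D \<epsilon> \<Longrightarrow> e2 x = \<i> * e1 x \<or> e2 x = - (\<i> * e1 x)"
  using orthogonal_unit_complex[of "e1 x" "e2 x"] norm_e1[of x] tangent[of x] by (simp add: e1_def)

lemma frontier_D_nonempty: "frontier D \<noteq> {}"
  using D(3,4) frontier_not_empty[of D] not_bounded_UNIV by metis

lemma closed_outer_layer: "closed (outer_layer D \<epsilon>)"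
proof -
  have "outer_layer D \<epsilon> = closure D \<inter> {x. infdist x (frontier D) \<le> \<epsilon>}"
    by (auto simp: outer_layer_def)
  then show ?thesis
    by (auto intro!: closed_Int closed_Collect_le continuous_intros)
qed

lemma inward_normal:
  assumes "x \<in> outer_layer D \<epsilon>" "w \<in> closure D"
  shows "(w - \<pi>D x) \<bullet> e1 x \<ge> 0"
  using outer_unit_normal_closure[OF normal assms(2)] proj_D[OF assms(1)] by (simp add: e1_def)

lemma frontier_outer_layer:
  assumes "x \<in> frontier D"
  shows "x \<in> outer_layer D \<epsilon>" "\<pi>D x = x"
proof -
  have 0: "infdist x (frontier D) = 0" using assms by simp
  then show x: "x \<in> outer_layer D \<epsilon>"
    using assms \<epsilon> by (auto simp: outer_layer_def frontier_def)
  show "\<pi>D x = x" using proj_D[OF x] 0 by simp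
qed

text \<open>Summability makes the path converge. At an interior limit \<open>reduced\<close> would
  keep \<open>h\<close> away from 0. At a boundary limit the height over the supporting line is
  forced to vanish, and \<open>no_convergent_alternating_extremes\<close> excludes motion inside
  that line.\<close>

lemma no_trapped_path:
  assumes X: "\<And>j. X j \<in> outer_layer D \<epsilon>"
    and X_Suc: "\<And>j. X (Suc j) = X j + h (X j) *\<^sub>R (e1 (X j) + e2 (X j)) \<or>
      X (Suc j) = X j + h (X j) *\<^sub>R (e1 (X j) - e2 (X j))"
    and summ: "summable (\<lambda>j. h (X j))"
  shows False
proof -
  have hpos: "h (X j) > 0" for j using step[OF X] by blast
  have "norm (X (Suc j) - X j) \<le> 2 * h (X j)" for j
  proof -
    have "norm (e1 (X j) + e2 (X j)) \<le> 2" "norm (e1 (X j) - e2 (X j)) \<le> 2"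
      using norm_e1[OF X[of j]] tangent[OF X[of j]] norm_triangle_ineq[of "e1 (X j)" "e2 (X j)"]
        norm_triangle_ineq4[of "e1 (X j)" "e2 (X j)"] by simp_all
    then show ?thesis using X_Suc[of j] hpos[of j] by (auto simp: mult.commute)
  qed
  then have "summable (\<lambda>j. X (Suc j) - X j)"
    by (intro summable_comparison_test'[OF summable_mult[OF summ, of 2]])
  then have "convergent (\<lambda>n. X n - X 0)"
    using summable_iff_convergent[of "\<lambda>j. X (Suc j) - X j"] by (simp add: sum_lessThan_telescope)
  then have "convergent X" by (simp add: convergent_diff_const_right_iff)
  then obtain x where lim: "X \<longlonglongrightarrow> x" by (auto simp: convergent_def)
  have h_lim: "(\<lambda>j. h (X j)) \<longlonglongrightarrow> 0" using summ by (rule summable_LIMSEQ_zero)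
  have x: "x \<in> outer_layer D \<epsilon>"
    using closed_outer_layer lim X closed_sequentially by blast
  have X_D: "X j \<in> closure D" for j using X[of j] by (simp add: outer_layer_def)
  have "x \<notin> D"
  proof
    assume "x \<in> D"
    then obtain r where r: "r > 0" "ball x r \<subseteq> D" using D(1) by (auto simp: open_contains_ball)
    obtain \<kappa> where \<kappa>: "\<kappa> > 0" "\<And>x t. x \<in> outer_layer D \<epsilon> \<Longrightarrow> t \<in> {0<..h0} \<Longrightarrow>
        stencil (- \<nu> (\<pi>D x)) (e2 x) t x \<subseteq> closure D \<Longrightarrow> \<kappa> * t \<le> h x"
      using reduced by blast
    \<comment> \<open>A point within \<open>r / 4\<close> of \<open>x\<close>, moved by
      \<open>t\<close> times a vector of norm at most 2, stays within \<open>3 * r / 4\<close> of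
      \<open>x\<close>. So the stencil of size \<open>t\<close> fits, and \<open>reduced\<close>
      bounds \<open>h\<close> below by \<open>\<kappa> * t\<close>.\<close>
    define t where "t = min h0 (r / 4)"
    have t: "t > 0" "t \<le> h0" "t \<le> r / 4" using r h0 by (auto simp: t_def)
    have "\<forall>\<^sub>F j in sequentially. dist (X j) x < r / 4"
      using tendstoD[OF lim, of "r / 4"] r by simp
    moreover have "\<forall>\<^sub>F j in sequentially. h (X j) < \<kappa> * t"
      using order_tendstoD(2)[OF h_lim, of "\<kappa> * t"] \<kappa> t by simp
    ultimately obtain j where j: "dist (X j) x < r / 4" "h (X j) < \<kappa> * t"
      using eventually_happens[OF eventually_conj] by fastforce
    have in_D: "X j + t *\<^sub>R v \<in> closure D" if "norm v \<le> 2" for v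
    proof -
      have "dist x (X j + t *\<^sub>R v) \<le> dist x (X j) + norm (t *\<^sub>R v)"
        using norm_triangle_ineq4[of "x - X j" "t *\<^sub>R v"] by (simp add: dist_norm diff_diff_eq)
      also have "norm (t *\<^sub>R v) \<le> t * 2" using that t by simp
      finally have "dist x (X j + t *\<^sub>R v) < r" using j t by (simp add: dist_commute)
      then show ?thesis using r closure_subset by force
    qed
    have "norm (e1 (X j)) = 1" "norm (e2 (X j)) = 1"
      using norm_e1[OF X] tangent[OF X] by auto
    then have "norm (e1 (X j) + e2 (X j)) \<le> 2" "norm (e1 (X j) - e2 (X j)) \<le> 2" "norm (2 *\<^sub>R e1 (X j)) \<le> 2" "norm (e1 (X j)) \<le> 2"
      using norm_triangle_ineq[of "e1 (X j)" "e2 (X j)"] norm_triangle_ineq4[of "e1 (X j)" "e2 (X j)"] by simp_all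
    from this[THEN in_D] have "stencil (- \<nu> (\<pi>D (X j))) (e2 (X j)) t (X j) \<subseteq> closure D"
      by (simp add: stencil_def e1_def[symmetric] mult.commute)
    with \<kappa>(2)[OF X, of t j] t j show False by simp
  qed
  then have x_front: "x \<in> frontier D"
    using x D(1) by (simp add: outer_layer_def frontier_def interior_open)
  note \<pi>x = frontier_outer_layer(2)[OF x_front]
  let ?c = "e1 x"
  let ?a = "e1 x + e2 x" and ?b = "e1 x - e2 x"
  have c1: "?c \<bullet> ?c = 1" using norm_e1[OF x] by (simp add: dot_square_norm)
  have pts: "x + h x *\<^sub>R ?a \<in> closure D" "x + h x *\<^sub>R ?b \<in> closure D" and hx: "h x > 0"
    using step[OF x] by (auto simp: stencil_def e1_def)
  have "e1 x \<noteq> 0" using norm_e1[OF x] by auto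
  \<comment> \<open>Each of \<open>?a\<close> and \<open>?b\<close> is the other turned by a right
    angle, in a sense given by the sign of \<open>e2 x\<close>. Both forms are recorded because
    \<open>normals_near_apex\<close> is applied twice, with the roles exchanged.\<close>
  then have ab: "?a \<noteq> 0" "?b \<noteq> 0" "\<exists>s. s \<noteq> 0 \<and> ?b = s *\<^sub>R (\<i> * ?a) \<and> ?a = (- 1 / s) *\<^sub>R (\<i> * ?b)"
  proof -
    have nz: "(1 + \<i>) * e1 x \<noteq> 0" "(1 - \<i>) * e1 x \<noteq> 0"
      using \<open>e1 x \<noteq> 0\<close> by (auto simp: complex_eq_iff)
    consider "e2 x = \<i> * e1 x" | "e2 x = - (\<i> * e1 x)" using e2_cases[OF x] by blast
    then have "?a \<noteq> 0 \<and> ?b \<noteq> 0 \<and> (\<exists>s. s \<noteq> 0 \<and> ?b = s *\<^sub>R (\<i> * ?a) \<and> ?a = (- 1 / s) *\<^sub>R (\<i> * ?b))"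
    proof cases
      case 1
      have A: "?a = (1 + \<i>) * e1 x" "?b = (1 - \<i>) * e1 x" unfolding 1 by (simp_all add: algebra_simps)
      have B: "(1 - \<i>) * e1 x = (-1) *\<^sub>R (\<i> * ((1 + \<i>) * e1 x))"
        "(1 + \<i>) * e1 x = (- 1 / (-1)) *\<^sub>R (\<i> * ((1 - \<i>) * e1 x))"
        by (simp_all add: complex_eq_iff)
      show ?thesis unfolding A by (intro conjI exI[of _ "-1"] nz B) simp
    next
      case 2
      have A: "?a = (1 - \<i>) * e1 x" "?b = (1 + \<i>) * e1 x" unfolding 2 by (simp_all add: algebra_simps)
      have B: "(1 + \<i>) * e1 x = 1 *\<^sub>R (\<i> * ((1 - \<i>) * e1 x))"
        "(1 - \<i>) * e1 x = (- 1 / 1) *\<^sub>R (\<i> * ((1 + \<i>) * e1 x))"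
        by (simp_all add: complex_eq_iff)
      show ?thesis unfolding A by (intro conjI exI[of _ 1] nz B) simp
    qed
    then show "?a \<noteq> 0" "?b \<noteq> 0" "\<exists>s. s \<noteq> 0 \<and> ?b = s *\<^sub>R (\<i> * ?a) \<and> ?a = (- 1 / s) *\<^sub>R (\<i> * ?b)"
      by blast+
  qed
  then obtain s where s: "s \<noteq> 0" "?b = s *\<^sub>R (\<i> * ?a)" "?a = (- 1 / s) *\<^sub>R (\<i> * ?b)" by blast
  obtain \<rho>1 where \<rho>1: "\<rho>1 > 0" "\<And>y n. y \<in> closure D \<Longrightarrow> dist y x < \<rho>1 \<Longrightarrow> outer_unit_normal D y n \<Longrightarrow> n \<bullet> ?a \<le> 0"
    using normals_near_apex[OF ab(1) s(2) s(1) hx pts] by blast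
  have "- 1 / s \<noteq> 0" using s(1) by simp
  then obtain \<rho>2 where \<rho>2: "\<rho>2 > 0" "\<And>y n. y \<in> closure D \<Longrightarrow> dist y x < \<rho>2 \<Longrightarrow> outer_unit_normal D y n \<Longrightarrow> n \<bullet> ?b \<le> 0"
    using normals_near_apex[OF ab(2) s(3) _ hx pts(2,1)] by blast
  \<comment> \<open>The radius is halved because the normal used at \<open>y\<close> is the one at
    \<open>\<pi>D y\<close>, which is at most twice as far from \<open>x\<close> as \<open>y\<close>
    is.\<close>
  have lean: "(e1 y + e2 y) \<bullet> ?c \<ge> 0" "(e1 y - e2 y) \<bullet> ?c \<ge> 0"
    if y: "y \<in> outer_layer D \<epsilon>" "dist y x < min \<rho>1 \<rho>2 / 2" for y
  proof -
    have "dist (\<pi>D y) x \<le> dist y (\<pi>D y) + dist y x"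
      by (metis dist_commute dist_triangle2)
    also have "dist y (\<pi>D y) \<le> dist y x"
      using proj_D[OF y(1)] infdist_le[OF x_front] by simp
    finally have *: "dist (\<pi>D y) x < min \<rho>1 \<rho>2" using y(2) by simp
    have \<pi>y: "\<pi>D y \<in> frontier D" "\<pi>D y \<in> closure D"
      using proj_D[OF y(1)] by (auto simp: frontier_def)
    have 1: "e1 y \<bullet> ?a \<ge> 0" "e1 y \<bullet> ?b \<ge> 0"
      using \<rho>1(2)[OF \<pi>y(2) _ normal[OF \<pi>y(1)]] \<rho>2(2)[OF \<pi>y(2) _ normal[OF \<pi>y(1)]] * by (auto simp: e1_def)
    \<comment> \<open>Shifting the right-angle turn to the other factor makes the height gain of a
      step at \<open>y\<close> equal to \<open>e1 y \<bullet> ?a\<close> or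
      \<open>e1 y \<bullet> ?b\<close>.\<close>
    have "(\<i> * e1 y) \<bullet> ?c = - (e1 y \<bullet> (\<i> * ?c))" by (simp add: inner_complex_def)
    then show "(e1 y + e2 y) \<bullet> ?c \<ge> 0" "(e1 y - e2 y) \<bullet> ?c \<ge> 0"
      using 1 e2_cases[OF x] e2_cases[OF y(1)] by (auto simp: inner_simps)
  qed
  have "\<forall>\<^sub>F j in sequentially. dist (X j) x < min \<rho>1 \<rho>2 / 2"
    by (rule tendstoD[OF lim]) (use \<rho>1(1) \<rho>2(1) in simp)
  then obtain J where J: "\<And>j. j \<ge> J \<Longrightarrow> dist (X j) x < min \<rho>1 \<rho>2 / 2"
    by (auto simp: eventually_sequentially)
  define l where "l j = (X (j + J) - x) \<bullet> ?c" for j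
  have "incseq l"
  proof (rule incseq_SucI)
    fix j
    have "l (Suc j) - l j = (X (Suc (j + J)) - X (j + J)) \<bullet> ?c"
      by (simp add: l_def inner_diff_left)
    also have "\<dots> \<ge> 0"
      using X_Suc[of "j + J"] lean[OF X J, of "j + J"] hpos[of "j + J"] by (auto simp: inner_scaleR_left)
    finally show "l j \<le> l (Suc j)" by simp
  qed
  moreover have "l \<longlonglongrightarrow> (x - x) \<bullet> ?c"
    unfolding l_def by (intro tendsto_intros LIMSEQ_ignore_initial_segment[OF lim])
  ultimately have "l j \<le> 0" for j
    using incseq_le[of l 0 j] by simp
  moreover have l_nonneg: "(w - x) \<bullet> ?c \<ge> 0" if "w \<in> closure D" for w
    using inward_normal[OF x that] \<pi>x by simp
  ultimately have l0: "(X (j + J) - x) \<bullet> ?c = 0" for j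
    using X_D[of "j + J"] by (simp add: l_def antisym)
  \<comment> \<open>A path point in the open set \<open>D\<close> would have neighbours in
    \<open>D\<close> on the wrong side of the supporting line through it.\<close>
  have X_front: "X (j + J) \<in> frontier D" for j
  proof (rule ccontr)
    assume "X (j + J) \<notin> frontier D"
    then have "X (j + J) \<in> D"
      using X_D D(1) by (simp add: frontier_def interior_open)
    then obtain r where r: "r > 0" "ball (X (j + J)) r \<subseteq> D" using D(1) by (auto simp: open_contains_ball)
    have "X (j + J) - (r / 2) *\<^sub>R ?c \<in> D"
      using r norm_e1[OF x] by (intro subsetD[OF r(2)]) (simp add: dist_norm)
    then have "(X (j + J) - (r / 2) *\<^sub>R ?c - x) \<bullet> ?c \<ge> 0"
      using closure_subset by (intro l_nonneg) auto
    then show False using l0[of j] c1 r(1) by (simp add: inner_simps)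
  qed
  \<comment> \<open>Position along the supporting line, and below it the tangential part of the
    inward normal there. Support of \<open>D\<close> at each path point gives the extremality, and
    the inward component \<open>h\<close> of each step gives the strict move.\<close>
  define \<xi> where "\<xi> j = (X (j + J) - x) \<bullet> (\<i> * ?c)" for j
  define c where "c j = e1 (X (j + J)) \<bullet> (\<i> * ?c)" for j
  have line: "(X (i + J) - X (j + J)) \<bullet> e1 (X (j + J)) = c j * (\<xi> i - \<xi> j)" for i j
  proof -
    have "(X (i + J) - X (j + J)) \<bullet> ?c = (X (i + J) - x) \<bullet> ?c - (X (j + J) - x) \<bullet> ?c"
      by (simp add: inner_simps)
    then have "(X (i + J) - X (j + J)) \<bullet> ?c = 0" using l0 by simp
    moreover have "\<xi> i - \<xi> j = (X (i + J) - X (j + J)) \<bullet> (\<i> * ?c)"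
      by (simp add: \<xi>_def inner_simps)
    ultimately show ?thesis
      using inner_complex_orthogonal_expansion[of ?c "e1 (X (j + J))" "X (i + J) - X (j + J)"] c1
      by (simp add: c_def inner_commute)
  qed
  have "\<not> \<xi> \<longlonglongrightarrow> (x - x) \<bullet> (\<i> * ?c)"
  proof (rule no_convergent_alternating_extremes)
    show "c j * (\<xi> i - \<xi> j) \<ge> 0" for i j
      using inward_normal[OF X X_D, of "i + J" "j + J"] frontier_outer_layer(2)[OF X_front[of j]] by (simp flip: line)
    show "c j * (\<xi> (Suc j) - \<xi> j) > 0" for j
    proof -
      have e: "e1 (X (j + J)) \<bullet> e1 (X (j + J)) = 1" "e2 (X (j + J)) \<bullet> e1 (X (j + J)) = 0"
        using norm_e1[OF X] tangent[OF X] by (simp_all add: dot_square_norm e1_def)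
      have "(X (Suc j + J) - X (j + J)) \<bullet> e1 (X (j + J)) = h (X (j + J))"
        using X_Suc[of "j + J"] e by (auto simp: inner_simps)
      then show ?thesis using hpos[of "j + J"] line[of "Suc j" j] by simp
    qed
  qed
  moreover have "\<xi> \<longlonglongrightarrow> (x - x) \<bullet> (\<i> * ?c)"
    unfolding \<xi>_def by (intro tendsto_intros LIMSEQ_ignore_initial_segment[OF lim])
  ultimately show False by simp
qed

end

section \<open>The transition kernel\<close>

text \<open>The same displacement \<open>d\<close> is applied to both end points of a segment. By
  \<open>cball_iff\<close> this set is the part of \<open>D\<close> outside the outer layer, so
  steps between such points cannot enter that layer.\<close>

lemma convex_cball_subset:
  fixes D :: "'a::real_normed_vector set"
  assumes "convex D"
  shows "convex {x. cball x e \<subseteq> D}"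
proof (rule convexI, safe)
  fix x y v and a b :: real
  assume x: "cball x e \<subseteq> D" and y: "cball y e \<subseteq> D" and ab: "0 \<le> a" "0 \<le> b" "a + b = 1"
    and v: "v \<in> cball (a *\<^sub>R x + b *\<^sub>R y) e"
  define d where "d = v - (a *\<^sub>R x + b *\<^sub>R y)"
  have "norm d \<le> e" using v by (simp add: d_def dist_norm norm_minus_commute)
  then have "x + d \<in> D" "y + d \<in> D"
    using x y by (auto simp: subset_iff dist_norm)
  then have "a *\<^sub>R (x + d) + b *\<^sub>R (y + d) \<in> D"
    using assms ab by (simp add: convexD)
  also have "a *\<^sub>R (x + d) + b *\<^sub>R (y + d) = a *\<^sub>R x + b *\<^sub>R y + (a + b) *\<^sub>R d"
    by (simp add: algebra_simps)
  also have "\<dots> = v" using ab by (simp add: d_def)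
  finally show "v \<in> D" .
qed

text \<open>A connected ball that meets both \<open>D\<close> and its complement meets the
  frontier.\<close>

lemma cball_subset_iff_infdist_frontier:
  fixes D :: "'a::euclidean_space set"
  assumes D: "open D" "frontier D \<noteq> {}" and e: "0 \<le> e"
  shows "cball x e \<subseteq> D \<longleftrightarrow> x \<in> D \<and> infdist x (frontier D) > e"
proof safe
  assume sub: "cball x e \<subseteq> D"
  then show "x \<in> D" using e by auto
  obtain y where y: "y \<in> frontier D" "infdist x (frontier D) = dist x y"
    using infdist_attains_inf[OF frontier_closed D(2)] by blast
  have "y \<notin> D" using y(1) D(1) by (simp add: frontier_def interior_open)
  then have "y \<notin> cball x e" using sub by blast
  then show "infdist x (frontier D) > e" using y(2) by simp
next
  fix v assume x: "x \<in> D" "infdist x (frontier D) > e" and v: "v \<in> cball x e"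
  show "v \<in> D"
  proof (rule ccontr)
    assume "v \<notin> D"
    then have "x \<in> cball x e \<inter> D" "v \<in> cball x e - D"
      using x v e by auto
    then have "cball x e \<inter> frontier D \<noteq> {}"
      by (intro connected_Int_frontier connected_cball) blast+
    then obtain y where "y \<in> cball x e" "y \<in> frontier D" by blast
    then show False using infdist_le[of y "frontier D" x] x(2) by simp
  qed
qed

context reflecting_walk begin

abbreviation domain :: "complex set" where "domain \<equiv> closure D - T"

lemma closed_domain: "closed domain" and compact_domain: "compact domain"
  using T(1) D(3) by (auto intro: closed_Diff compact_diff)

lemma sets_domain [measurable]: "domain \<in> sets borel"
  using closed_domain by (rule borel_closed)

lemma sets_outer_layer [measurable]: "outer_layer D \<epsilon> \<in> sets borel"
  using closed_outer_layer by (rule borel_closed)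

lemma sets_inner_layer [measurable]: "inner_layer D T \<epsilon> \<in> sets borel"
proof -
  have "inner_layer D T \<epsilon> = domain \<inter> {x. infdist x (frontier T) \<le> \<epsilon>}"
    by (auto simp: inner_layer_def)
  then show ?thesis
    by (auto intro!: sets.Int sets_domain borel_closed closed_Collect_le continuous_intros T(1))
qed

lemma frontier_T: "y \<in> frontier T \<Longrightarrow> y \<in> D" "y \<in> frontier T \<Longrightarrow> y \<notin> T"
  using T(1,4) by (auto simp: frontier_def interior_open)

lemma frontier_T_nonempty: "frontier T \<noteq> {}"
proof
  assume "frontier T = {}"
  then have "T = UNIV" using T(2) frontier_eq_empty by blast
  then have "D = UNIV" using T(4) by auto
  then show False using D(3) not_bounded_UNIV by blast
qed

lemma frontier_T_inner: "y \<in> frontier T \<Longrightarrow> y \<in> inner_layer D T \<epsilon>"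
  using frontier_T[of y] \<epsilon>(1) closure_subset[of D] by (auto simp: inner_layer_def)

lemma cball_iff: "cball x \<epsilon> \<subseteq> D \<longleftrightarrow> x \<in> D \<and> infdist x (frontier D) > \<epsilon>"
  using \<epsilon>(1) by (intro cball_subset_iff_infdist_frontier D(1) frontier_D_nonempty) simp

lemma not_outer: "x \<in> closure D \<Longrightarrow> x \<notin> outer_layer D \<epsilon> \<Longrightarrow> cball x \<epsilon> \<subseteq> D"
proof -
  assume x: "x \<in> closure D" "x \<notin> outer_layer D \<epsilon>"
  then have "infdist x (frontier D) > \<epsilon>" by (auto simp: outer_layer_def)
  moreover have "x \<in> D"
  proof (rule ccontr)
    assume "x \<notin> D"
    then have "x \<in> frontier D" using x D(1) by (simp add: frontier_def interior_open)
    then show False using x(2) frontier_outer_layer(1) by blast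
  qed
  ultimately show ?thesis by (simp add: cball_iff)
qed

lemma cball_frontier_T: "y \<in> frontier T \<Longrightarrow> cball y \<epsilon> \<subseteq> D"
  using frontier_T_inner[of y] \<epsilon>(2) frontier_T(1)[of y] closure_subset[of D] by (intro not_outer) auto

section \<open>Geometry and integrals of the transition steps\<close>

definition middle :: "complex set" where
  "middle = domain - outer_layer D \<epsilon> - inner_layer D T \<epsilon>"

definition radius :: "complex \<Rightarrow> real" where
  "radius x = infdist x (frontier D \<union> frontier T)"

lemma radius_eq: "radius x = min (infdist x (frontier D)) (infdist x (frontier T))"
  unfolding radius_def using frontier_D_nonempty frontier_T_nonempty by (rule infdist_Un_min)

lemma radius_middle: "x \<in> middle \<Longrightarrow> radius x > \<epsilon>"
  by (auto simp: middle_def radius_eq outer_layer_def inner_layer_def)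

text \<open>The connected ball meets neither frontier, so it stays on the side of its centre; being
  open, it misses \<open>closure T\<close> as soon as it misses \<open>T\<close>.\<close>

lemma ball_radius:
  assumes x: "x \<in> middle"
  shows "ball x (radius x) \<subseteq> D - closure T"
proof -
  have r: "radius x > 0" using radius_middle[OF x] \<epsilon>(1) by simp
  have disj: "ball x (radius x) \<inter> frontier S = {}" if "S = D \<or> S = T" for S
  proof -
    have "infdist x (frontier S) \<ge> radius x" using that by (auto simp: radius_eq)
    then show ?thesis using infdist_le[of _ "frontier S" x] by fastforce
  qed
  have "cball x \<epsilon> \<subseteq> D" using x by (intro not_outer) (auto simp: middle_def)
  then have xD: "x \<in> D" using \<epsilon>(1) by auto
  have xT: "x \<notin> T" using x by (auto simp: middle_def)
  have 1: "ball x (radius x) \<subseteq> D"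
  proof (rule ccontr)
    assume "\<not> ?thesis"
    moreover have "x \<in> ball x (radius x) \<inter> D" using xD r by simp
    ultimately have "ball x (radius x) \<inter> frontier D \<noteq> {}"
      by (intro connected_Int_frontier connected_ball) blast+
    with disj[of D] show False by simp
  qed
  have 2: "ball x (radius x) \<inter> T = {}"
  proof (rule ccontr)
    assume "\<not> ?thesis"
    moreover have "x \<in> ball x (radius x) - T" using xT r by simp
    ultimately have "ball x (radius x) \<inter> frontier T \<noteq> {}"
      by (intro connected_Int_frontier connected_ball) blast+
    with disj[of T] show False by simp
  qed
  then have "ball x (radius x) \<inter> closure T = {}"
    by (simp add: open_Int_closure_eq_empty)
  with 1 show ?thesis by auto
qed

lemma cball_radius:
  assumes x: "x \<in> middle"
  shows "cball x (radius x) \<subseteq> domain"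
proof -
  have r: "radius x > 0" using radius_middle[OF x] \<epsilon>(1) by simp
  have "ball x (radius x) \<subseteq> domain"
    using ball_radius[OF x] closure_subset[of D] closure_subset[of T] by auto
  then have "closure (ball x (radius x)) \<subseteq> domain"
    using closed_domain by (rule closure_minimal)
  then show ?thesis using r by simp
qed

lemma circle_in_domain: "x \<in> middle \<Longrightarrow> x + radius x *\<^sub>R cis \<theta> \<in> domain"
  by (rule subsetD[OF cball_radius]) (auto simp: dist_norm radius_def infdist_nonneg)

lemma stencil_points:
  assumes "x \<in> outer_layer D \<epsilon>"
  shows "x + h x *\<^sub>R (e1 x + e2 x) \<in> domain" "x + h x *\<^sub>R (e1 x - e2 x) \<in> domain"
  using step[OF assms] by (auto simp: stencil_def e1_def)

lemma h_pos: "x \<in> outer_layer D \<epsilon> \<Longrightarrow> h x > 0" and h_le: "x \<in> outer_layer D \<epsilon> \<Longrightarrow> h x \<le> h0"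
  using step by auto

lemma p_a_bounds: "x \<in> outer_layer D \<epsilon> \<Longrightarrow> p_a x > 0" "x \<in> outer_layer D \<epsilon> \<Longrightarrow> p_a x < 1"
  using h_pos[of x] z by (auto simp: p_a_def)

text \<open>\<open>k\<close> cut off outside the state space, as \<open>killed_walk\<close>
  requires; by \<open>markov_chain_kernel\<close> the chain cannot tell the difference.\<close>

definition kernel :: "complex \<Rightarrow> complex measure" where
  "kernel x = (if x \<in> domain then k x else null_measure borel)"

lemma kernel_cases:
  obtains "x \<notin> domain" "kernel x = null_measure borel"
  | "x \<in> domain" "x \<in> outer_layer D \<epsilon>" "x \<notin> inner_layer D T \<epsilon>" "x \<notin> middle"
    "kernel x = scale_measure (ennreal (1 - p_a x)) (stencil_step x)"
  | "x \<in> domain" "x \<in> inner_layer D T \<epsilon>" "x \<notin> outer_layer D \<epsilon>" "x \<notin> middle" "kernel x = null_measure borel"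
  | "x \<in> domain" "x \<in> middle" "x \<notin> outer_layer D \<epsilon>" "x \<notin> inner_layer D T \<epsilon>" "kernel x = sphere_step x"
proof -
  have "x \<notin> outer_layer D \<epsilon> \<or> x \<notin> inner_layer D T \<epsilon>" using \<epsilon>(2) by auto
  then show ?thesis using that by (cases "x \<in> domain") (auto simp: kernel_def k_def middle_def)
qed

lemma sets_stencil_step [simp, measurable_cong]: "sets (stencil_step x) = sets borel"
  by (simp add: stencil_step_def)

lemma sets_sphere_step [simp, measurable_cong]: "sets (sphere_step x) = sets borel"
  by (simp add: sphere_step_def)

lemma nn_integral_stencil_step:
  assumes [measurable]: "g \<in> borel_measurable borel"
  shows "(\<integral>\<^sup>+y. g y \<partial>stencil_step x) =
    (g (x + h x *\<^sub>R (e1 x + e2 x)) + g (x + h x *\<^sub>R (e1 x - e2 x))) / 2"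
  unfolding stencil_step_def
  by (subst nn_integral_distr)
    (simp_all add: distrib_left[symmetric] divide_ennreal_def ennreal_divide_numeral[symmetric] mult.commute
      flip: distrib_right ennreal_numeral)

lemma prob_space_uniform: "prob_space (uniform_measure lborel {0..2 * pi})"
  by (rule prob_space_uniform_measure) (simp_all add: ennreal_eq_0_iff not_le)

lemma nn_integral_sphere_step:
  assumes [measurable]: "g \<in> borel_measurable borel"
  shows "(\<integral>\<^sup>+y. g y \<partial>sphere_step x) = (\<integral>\<^sup>+\<theta>. g (x + radius x *\<^sub>R cis \<theta>) \<partial>uniform_measure lborel {0..2 * pi})"
  unfolding sphere_step_def radius_def
  by (subst nn_integral_distr) (simp_all add: cis_conv_exp)

text \<open>Stepsize and normal are assumed Borel on the outer layer only; this extension by zero,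
  like the one in \<open>outer_e1\<close>, is Borel on the plane.\<close>

definition outer_h :: "complex \<Rightarrow> real" where
  "outer_h x = indicator (outer_layer D \<epsilon>) x *\<^sub>R h x"

definition outer_e1 :: "complex \<Rightarrow> complex" where
  "outer_e1 x = indicator (outer_layer D \<epsilon>) x *\<^sub>R e1 x"

lemma measurable_outer_h [measurable]: "outer_h \<in> borel_measurable borel"
  using measurable_step unfolding outer_h_def by (subst (asm) borel_measurable_restrict_space_iff) auto

lemma measurable_outer_e1 [measurable]: "outer_e1 \<in> borel_measurable borel"
proof -
  have "(\<lambda>x. indicator (outer_layer D \<epsilon>) x *\<^sub>R \<nu> (\<pi>D x)) \<in> borel_measurable borel"
    using measurable_direction by (subst (asm) borel_measurable_restrict_space_iff) auto
  then have "(\<lambda>x. - (indicator (outer_layer D \<epsilon>) x *\<^sub>R \<nu> (\<pi>D x))) \<in> borel_measurable borel"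
    by measurable
  then show ?thesis by (simp add: outer_e1_def[abs_def] e1_def)
qed

text \<open>No measurability of \<open>e2\<close> is assumed; it is determined up to a sign, in which the step is symmetric.\<close>

lemma stencil_symmetric:
  fixes g :: "complex \<Rightarrow> 'b::ab_semigroup_add"
  assumes "x \<in> outer_layer D \<epsilon>"
  shows "g (x + h x *\<^sub>R (e1 x + e2 x)) + g (x + h x *\<^sub>R (e1 x - e2 x)) =
    g (x + outer_h x *\<^sub>R (outer_e1 x + \<i> * outer_e1 x)) + g (x + outer_h x *\<^sub>R (outer_e1 x - \<i> * outer_e1 x))"
  using e2_cases[OF assms] assms by (auto simp: outer_h_def outer_e1_def add.commute)

text \<open>One formula for all states, free of \<open>e2\<close> and made of Borel ingredients;
  measurability of \<open>kernel\<close> in the state is read off from it.\<close>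

lemma nn_integral_kernel:
  assumes [measurable]: "g \<in> borel_measurable borel"
  shows "(\<integral>\<^sup>+y. g y \<partial>kernel x) =
    indicator (domain \<inter> outer_layer D \<epsilon>) x * (ennreal (1 - outer_h x / (outer_h x + z)) *
      ((g (x + outer_h x *\<^sub>R (outer_e1 x + \<i> * outer_e1 x)) + g (x + outer_h x *\<^sub>R (outer_e1 x - \<i> * outer_e1 x))) / 2)) +
    indicator middle x * (\<integral>\<^sup>+\<theta>. g (x + radius x *\<^sub>R cis \<theta>) \<partial>uniform_measure lborel {0..2 * pi})"
proof (cases rule: kernel_cases[of x])
  case 1
  then show ?thesis by (simp add: middle_def)
next
  case 2
  have "outer_h x = h x" using 2 by (simp add: outer_h_def)
  then show ?thesis
    using 2 by (simp add: nn_integral_scale_measure nn_integral_stencil_step stencil_symmetric[of x g] p_a_def)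
next
  case 3
  then show ?thesis by simp
next
  case 4
  then show ?thesis by (simp add: nn_integral_sphere_step)
qed

lemma sets_kernel [simp, measurable_cong]: "sets (kernel x) = sets borel"
  by (cases rule: kernel_cases[of x]) simp_all

lemma space_kernel [simp]: "space (kernel x) = UNIV"
  using sets_eq_imp_space_eq[OF sets_kernel] by simp

lemma emeasure_kernel_UNIV:
  "emeasure (kernel x) UNIV = indicator (domain \<inter> outer_layer D \<epsilon>) x * ennreal (1 - p_a x) + indicator middle x"
proof -
  interpret U: prob_space "uniform_measure lborel {0..2 * pi}" by (rule prob_space_uniform)
  have "emeasure (kernel x) UNIV = (\<integral>\<^sup>+y. 1 \<partial>kernel x)" by simp
  also have "\<dots> = indicator (domain \<inter> outer_layer D \<epsilon>) x * ennreal (1 - p_a x) + indicator middle x"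
    using U.emeasure_space_1 by (subst nn_integral_kernel) (simp_all add: outer_h_def p_a_def split: split_indicator)
  finally show ?thesis .
qed

lemma measurable_radius [measurable]: "radius \<in> borel_measurable borel"
  unfolding radius_def[abs_def]
  by (intro borel_measurable_continuous_onI continuous_intros)

lemma measurable_kernel [measurable]: "kernel \<in> borel \<rightarrow>\<^sub>M subprob_algebra borel"
proof (rule measurable_subprob_algebra)
  fix x
  have "p_a x \<ge> 0" if "x \<in> outer_layer D \<epsilon>" using p_a_bounds[OF that] by simp
  then have "emeasure (kernel x) UNIV \<le> 1"
    unfolding emeasure_kernel_UNIV by (auto simp: middle_def split: split_indicator)
  then show "subprob_space (kernel x)"
    by (intro subprob_spaceI) auto
next
  fix A :: "complex set" assume [measurable]: "A \<in> sets borel"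
  interpret U: prob_space "uniform_measure lborel {0..2 * pi}" by (rule prob_space_uniform)
  have [measurable]: "middle \<in> sets borel" unfolding middle_def by measurable
  have [measurable]: "cis \<in> borel_measurable borel"
    by (intro borel_measurable_continuous_onI continuous_intros)
  have "(\<lambda>x. \<integral>\<^sup>+y. indicator A y \<partial>kernel x) \<in> borel_measurable borel"
    by (subst nn_integral_kernel) measurable
  then show "(\<lambda>x. emeasure (kernel x) A) \<in> borel_measurable borel" by simp
qed auto

lemma killed_walk_kernel: "killed_walk domain kernel"
proof
  fix x assume "x \<in> domain"
  define N where "N = - domain"
  have [measurable]: "N \<in> sets borel" unfolding N_def by (rule borel_comp[OF sets_domain])
  have N: "(indicator N y :: ennreal) = 0" if "y \<in> domain" for y
    using that by (auto simp: N_def)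
  have "emeasure (kernel x) N = (\<integral>\<^sup>+y. indicator N y \<partial>kernel x)" by simp
  also have "\<dots> = 0"
  proof (cases "x \<in> outer_layer D \<epsilon>")
    case True
    then have "x \<notin> middle" by (simp add: middle_def)
    then show ?thesis
      using True N[OF stencil_points(1)[OF True]] N[OF stencil_points(2)[OF True]] stencil_symmetric[OF True, of "indicator N :: _ \<Rightarrow> ennreal"]
      by (subst nn_integral_kernel) simp_all
  next
    case False
    then show ?thesis
      using N[OF circle_in_domain] by (cases "x \<in> middle"; subst nn_integral_kernel) simp_all
  qed
  finally show "emeasure (kernel x) (- domain) = 0" by (simp only: N_def)
qed (auto simp: kernel_def)

lemma markov_chain_kernel:
  assumes "markov_chain M X domain k x0"
  shows "markov_chain M X domain kernel x0"
proof -
  have X: "X j \<in> M \<rightarrow>\<^sub>M cemetery_space domain" for j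
    using assms by (simp add: markov_chain_def)
  have "transition domain k (X n \<omega>) B = transition domain kernel (X n \<omega>) B" if "\<omega> \<in> space M" for n \<omega> B
    using measurable_space[OF X that, of n]
    by (auto simp: space_cemetery_space transition_def kernel_def)
  then have "(\<integral>\<^sup>+\<omega>. indicator A (\<lambda>j\<in>{..n}. X j \<omega>) * transition domain k (X n \<omega>) B \<partial>M) =
      (\<integral>\<^sup>+\<omega>. indicator A (\<lambda>j\<in>{..n}. X j \<omega>) * transition domain kernel (X n \<omega>) B \<partial>M)" for A n B
    by (intro nn_integral_cong) simp
  with assms show ?thesis by (simp add: markov_chain_def)
qed

sublocale kernel: killed_walk domain kernel
  by (rule killed_walk_kernel)

lemma killing_eq:
  assumes "x \<in> domain"
  shows "kernel.killing x = (if x \<in> outer_layer D \<epsilon> then ennreal (p_a x) else if x \<in> inner_layer D T \<epsilon> then 1 else 0)"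
proof -
  have "(1::ennreal) - ennreal (1 - p_a x) = ennreal (p_a x)" if "x \<in> outer_layer D \<epsilon>"
    using p_a_bounds[OF that] by (simp add: ennreal_1[symmetric] ennreal_minus del: ennreal_1)
  then show ?thesis
    using assms \<epsilon>(2) by (auto simp: kernel.killing_def emeasure_kernel_UNIV middle_def)
qed

end

section \<open>Almost sure absorption\<close>

lemma norm_cis_diff_le: "norm (cis a - cis b) \<le> \<bar>a - b\<bar>"
proof -
  have "norm (cis (a - b) - 1) \<le> \<bar>a - b\<bar>"
    using iexp_approx1[of "a - b" 0] by (simp add: cis_conv_exp mult.commute)
  moreover have "cis a - cis b = cis b * (cis (a - b) - 1)"
    by (simp add: algebra_simps cis_mult)
  ultimately show ?thesis by (simp add: norm_mult)
qed

lemma complex_polar_Arg2pi: "z = norm z *\<^sub>R cis (Arg2pi z)"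
  using Arg2pi[of z] by (simp add: is_Arg_def cis_conv_exp scaleR_conv_of_real)

context reflecting_walk begin

abbreviation "alive n \<equiv> (kernel.op ^^ n) (indicator domain)"

lemma alive_Suc_le: "x \<in> domain \<Longrightarrow> alive (Suc n) x \<le> alive n x"
proof -
  assume x: "x \<in> domain"
  have *: "kernel.op (indicator domain) y \<le> indicator domain y" for y
    by (subst kernel.op_indicator_E) (auto simp: kernel.emeasure_Q_le split: split_indicator)
  have "(kernel.op ^^ n) (kernel.op (indicator domain)) x \<le> alive n x"
    by (rule kernel.op_pow_mono[OF * x])
  then show ?thesis by (simp add: funpow_swap1)
qed

lemma alive_le: "m \<le> n \<Longrightarrow> x \<in> domain \<Longrightarrow> alive n x \<le> alive m x"
  by (rule lift_Suc_antimono_le[of "\<lambda>n. alive n x", OF alive_Suc_le])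

lemma alive_le_1: "x \<in> domain \<Longrightarrow> alive n x \<le> 1"
  using alive_le[of 0 n x] by simp

text \<open>The index is \<open>Suc n\<close> because a walk in the inner layer still counts as
  alive at time 0 and dies in its first transition.\<close>

lemma alive_inner:
  assumes "x \<in> inner_layer D T \<epsilon>"
  shows "alive (Suc n) x = 0"
proof -
  have "x \<in> domain" using assms by (auto simp: inner_layer_def)
  moreover have "alive 1 x = 0"
    using assms \<epsilon>(2) by (auto simp: kernel.op_indicator_E emeasure_kernel_UNIV middle_def split: split_indicator)
  ultimately show ?thesis using alive_le[of 1 "Suc n" x] by simp
qed

text \<open>The aim \<open>p\<close>, close to \<open>q\<close>, lies in \<open>T\<close>, so the
  segment from \<open>x\<close> to \<open>p\<close> crosses \<open>frontier T\<close> and the step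
  ends on this segment. Convexity keeps it out of the outer layer. The step is longer than
  \<open>\<epsilon>\<close>, and the deviation of \<open>p\<close> from \<open>q\<close> costs less
  than \<open>\<epsilon> / 2\<close> of that.\<close>

lemma landing:
  assumes x: "x \<in> middle" and sub: "ball q \<rho> \<subseteq> T \<inter> {y. cball y \<epsilon> \<subseteq> D}" and \<rho>: "\<rho> \<le> \<epsilon> / 2"
    and near: "dist (x + dist x q *\<^sub>R cis \<theta>) q < \<rho>"
  defines "y \<equiv> x + radius x *\<^sub>R cis \<theta>"
  shows "y \<in> domain" "y \<notin> outer_layer D \<epsilon>" "dist y q < dist x q - \<epsilon> / 2"
proof -
  let ?s = "dist x q" and ?r = "radius x"
  define p where "p = x + ?s *\<^sub>R cis \<theta>"
  have p: "p \<in> T" "cball p \<epsilon> \<subseteq> D"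
    using sub near by (auto simp: p_def dist_commute)
  have xd: "x \<in> domain" "x \<notin> outer_layer D \<epsilon>" using x by (auto simp: middle_def)
  have r: "?r > \<epsilon>" using radius_middle[OF x] .
  have dxp: "dist x p = ?s" by (simp add: p_def dist_norm)
  have "closed_segment x p \<inter> frontier T \<noteq> {}"
    using p(1) xd(1) by (intro connected_Int_frontier) auto
  then obtain f where f: "f \<in> closed_segment x p" "f \<in> frontier T" by blast
  have "?r \<le> dist x f"
    using infdist_le[OF f(2), of x] by (simp add: radius_eq)
  also have "\<dots> \<le> dist x p"
    using segment_bound(1)[OF f(1)] by (simp add: dist_norm norm_minus_commute)
  finally have rs: "?r \<le> ?s" by (simp add: dxp)
  then have s: "?s > 0" using r \<epsilon>(1) by linarith
  show yd: "y \<in> domain"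
    unfolding y_def using x by (rule circle_in_domain)
  have "y = (1 - ?r / ?s) *\<^sub>R x + (?r / ?s) *\<^sub>R p"
    using s by (simp add: y_def p_def algebra_simps)
  moreover have "cball x \<epsilon> \<subseteq> D" using xd by (intro not_outer) auto
  ultimately have "cball y \<epsilon> \<subseteq> D"
    using convexD[OF convex_cball_subset[OF D(2), of \<epsilon>], of x p "1 - ?r / ?s" "?r / ?s"] p(2) rs s r \<epsilon>(1)
    by simp
  then show "y \<notin> outer_layer D \<epsilon>"
    by (simp add: cball_iff outer_layer_def)
  have "p - y = (?s - ?r) *\<^sub>R cis \<theta>" by (simp add: p_def y_def algebra_simps)
  then have "dist y p = ?s - ?r"
    using rs by (simp add: dist_norm norm_minus_commute[of y p])
  moreover have "dist p q < \<rho>" using near by (simp add: p_def)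
  ultimately show "dist y q < dist x q - \<epsilon> / 2"
    using dist_triangle[of y q p] r \<rho> by simp
qed

text \<open>The walk is aimed at a point \<open>q\<close> of \<open>T\<close>. Directions close to
  that of \<open>q\<close> have a probability of at least \<open>\<beta> / (2 * pi)\<close>; each
  such step gains \<open>\<epsilon> / 2\<close> on \<open>q\<close> and avoids the outer layer. The
  distance to \<open>q\<close> is bounded, so a fixed number \<open>J\<close> of them cannot all end
  in \<open>middle\<close>. The result holds with \<open>Suc J\<close> steps and probability
  \<open>\<delta> ^ J\<close>.\<close>

lemma escape_middle: "\<exists>N \<delta>. 0 < \<delta> \<and> \<delta> \<le> 1 \<and> (\<forall>x\<in>middle. alive N x \<le> ennreal (1 - \<delta>))"
proof -
  let ?A = "{y. cball y \<epsilon> \<subseteq> D}"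
  have "?A = D \<inter> {y. infdist y (frontier D) > \<epsilon>}" by (auto simp: cball_iff)
  then have "open ?A"
    using D(1) by (auto intro!: open_Int open_Collect_less continuous_intros)
  obtain y0 where y0: "y0 \<in> frontier T" using frontier_T_nonempty by auto
  have "y0 \<in> ?A \<inter> closure T" using cball_frontier_T[OF y0] y0 by (auto simp: frontier_def)
  then obtain q where q: "q \<in> ?A \<inter> T"
    using open_Int_closure_eq_empty[OF \<open>open ?A\<close>, of T] by auto
  have "open (T \<inter> ?A)" using T(1) \<open>open ?A\<close> by auto
  then obtain \<rho>' where \<rho>': "\<rho>' > 0" "ball q \<rho>' \<subseteq> T \<inter> ?A"
    using q by (metis IntE IntI open_contains_ball)
  define \<rho> where "\<rho> = min \<rho>' (\<epsilon> / 2)"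
  have \<rho>: "\<rho> > 0" "\<rho> \<le> \<epsilon> / 2" "ball q \<rho> \<subseteq> T \<inter> ?A"
    using \<rho>' \<epsilon>(1) by (auto simp: \<rho>_def)
  obtain \<Delta> where \<Delta>: "\<Delta> > 0" "\<And>x. x \<in> domain \<Longrightarrow> dist x q \<le> \<Delta>"
  proof -
    have "bounded domain" using compact_domain by (rule compact_imp_bounded)
    then obtain b where "\<And>x. x \<in> domain \<Longrightarrow> dist q x \<le> b"
      using bounded_any_center[of domain q] by blast
    then show ?thesis using that[of "max b 1"] by (simp add: dist_commute le_max_iff_disj)
  qed
  \<comment> \<open>A turn by at most \<open>\<beta>\<close> shifts the aim by at most
    \<open>\<Delta> * \<beta> < \<rho>\<close>, since \<open>q\<close> is at distance at most
    \<open>\<Delta>\<close>.\<close>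
  define \<beta> where "\<beta> = min pi (\<rho> / (2 * \<Delta>))"
  have \<beta>: "\<beta> > 0" "\<beta> \<le> pi" "\<Delta> * \<beta> < \<rho>"
  proof -
    show "\<beta> > 0" "\<beta> \<le> pi" using \<rho>(1) \<Delta>(1) by (auto simp: \<beta>_def)
    have "\<Delta> * \<beta> \<le> \<Delta> * (\<rho> / (2 * \<Delta>))"
      using \<Delta>(1) by (intro mult_left_mono) (auto simp: \<beta>_def)
    also have "\<dots> < \<rho>" using \<Delta>(1) \<rho>(1) by simp
    finally show "\<Delta> * \<beta> < \<rho>" .
  qed
  define \<delta> where "\<delta> = \<beta> / (2 * pi)"
  have \<delta>: "\<delta> > 0" "\<delta> \<le> 1" using \<beta> pi_gt_zero by (auto simp: \<delta>_def field_simps)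
  let ?U = "uniform_measure lborel {0..2 * pi}"
  interpret U: prob_space ?U by (rule prob_space_uniform)
  have good_arc: "\<exists>a b. 0 \<le> a \<and> b \<le> 2 * pi \<and> b = a + \<beta> \<and>
      (\<forall>\<theta>\<in>{a..b}. dist (x + dist x q *\<^sub>R cis \<theta>) q < \<rho>)" if x: "x \<in> domain" for x
  proof -
    define \<theta>0 where "\<theta>0 = Arg2pi (q - x)"
    have \<theta>0: "0 \<le> \<theta>0" "\<theta>0 < 2 * pi" using Arg2pi[of "q - x"] by (auto simp: \<theta>0_def)
    have q_polar: "q = x + dist x q *\<^sub>R cis \<theta>0"
      using complex_polar_Arg2pi[of "q - x"] by (simp add: \<theta>0_def dist_norm norm_minus_commute algebra_simps)
    have good: "dist (x + dist x q *\<^sub>R cis \<theta>) q < \<rho>" if "\<bar>\<theta> - \<theta>0\<bar> \<le> \<beta>" for \<theta>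
    proof -
      have "dist (x + dist x q *\<^sub>R cis \<theta>) q = norm (dist x q *\<^sub>R (cis \<theta> - cis \<theta>0))"
        by (subst (2) q_polar) (simp add: dist_norm scaleR_diff_right)
      also have "\<dots> = dist x q * norm (cis \<theta> - cis \<theta>0)" by simp
      also have "\<dots> \<le> \<Delta> * \<beta>"
        using \<Delta>(2)[OF x] norm_cis_diff_le[of \<theta> \<theta>0] that \<Delta>(1) by (intro mult_mono) auto
      finally show ?thesis using \<beta>(3) by simp
    qed
    \<comment> \<open>The arc is taken on that side of \<open>\<theta>0\<close> on which it stays in
      \<open>{0..2 * pi}\<close>; \<open>\<beta> \<le> pi\<close> guarantees that there is
      one.\<close>
    show ?thesis
    proof (cases "\<theta>0 \<le> pi")
      case True
      then show ?thesis using \<theta>0 \<beta> good by (intro exI[of _ \<theta>0] exI[of _ "\<theta>0 + \<beta>"]) auto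
    next
      case False
      then show ?thesis using \<theta>0 \<beta> good by (intro exI[of _ "\<theta>0 - \<beta>"] exI[of _ \<theta>0]) auto
    qed
  qed
  \<comment> \<open>One step more than the \<open>j\<close> good ones accounts for the death in the
    inner layer; for \<open>j = 0\<close> the distance condition cannot hold.\<close>
  have main: "\<forall>x\<in>middle. dist x q < real j * (\<epsilon> / 2) \<longrightarrow> alive (Suc j) x \<le> ennreal (1 - \<delta> ^ j)" for j
  proof (induction j)
    case 0
    then show ?case using zero_le_dist not_less by (metis mult_zero_left of_nat_0)
  next
    case (Suc j)
    show ?case
    proof (intro ballI impI)
      fix x assume x: "x \<in> middle" and dx: "dist x q < real (Suc j) * (\<epsilon> / 2)"
      have xd: "x \<in> domain" using x by (auto simp: middle_def)
      obtain a b where ab: "0 \<le> a" "b \<le> 2 * pi" "b = a + \<beta>"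
          "\<And>\<theta>. \<theta> \<in> {a..b} \<Longrightarrow> dist (x + dist x q *\<^sub>R cis \<theta>) q < \<rho>"
        using good_arc[OF xd] by blast
      have \<delta>j: "0 \<le> \<delta> ^ j" "\<delta> ^ j \<le> 1" using \<delta> by (auto intro: power_le_one)
      have bound: "alive (Suc j) (x + radius x *\<^sub>R cis \<theta>) \<le> ennreal (1 - \<delta> ^ j * indicator {a..b} \<theta>)" for \<theta>
      proof (cases "\<theta> \<in> {a..b}")
        case True
        let ?y = "x + radius x *\<^sub>R cis \<theta>"
        have y: "?y \<in> domain" "?y \<notin> outer_layer D \<epsilon>" "dist ?y q < dist x q - \<epsilon> / 2"
          using landing[OF x \<rho>(3,2) ab(4)[OF True]] by auto
        have "alive (Suc j) ?y \<le> ennreal (1 - \<delta> ^ j)"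
        proof (cases "?y \<in> inner_layer D T \<epsilon>")
          case True
          then show ?thesis by (simp only: alive_inner) simp
        next
          case False
          then have "?y \<in> middle" using y by (simp add: middle_def)
          moreover have "dist ?y q < real j * (\<epsilon> / 2)"
            using y(3) dx by (simp add: algebra_simps)
          ultimately show ?thesis using Suc by blast
        qed
        then show ?thesis using True by simp
      next
        case False
        then show ?thesis using alive_le_1[OF circle_in_domain[OF x], of "Suc j"] by (simp del: funpow.simps)
      qed
      have ind: "integrable ?U (indicator {a..b} :: real \<Rightarrow> real)"
        by (rule U.integrable_const_bound[where B = 1]) (auto split: split_indicator)
      have "alive (Suc (Suc j)) x = (\<integral>\<^sup>+y. alive (Suc j) y \<partial>kernel x)"
        by (simp add: kernel.op_def)
      also have "\<dots> = (\<integral>\<^sup>+\<theta>. alive (Suc j) (x + radius x *\<^sub>R cis \<theta>) \<partial>?U)"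
        using x by (subst nn_integral_kernel) (auto simp: middle_def)
      also have "\<dots> \<le> (\<integral>\<^sup>+\<theta>. ennreal (1 - \<delta> ^ j * indicator {a..b} \<theta>) \<partial>?U)"
        by (intro nn_integral_mono bound)
      also have "\<dots> = ennreal (\<integral>\<theta>. 1 - \<delta> ^ j * indicator {a..b} \<theta> \<partial>?U)"
      proof (rule nn_integral_eq_integral)
        show "integrable ?U (\<lambda>\<theta>. 1 - \<delta> ^ j * indicator {a..b} \<theta>)"
          by (intro Bochner_Integration.integrable_diff integrable_mult_right U.integrable_const ind)
        show "AE \<theta> in ?U. 0 \<le> 1 - \<delta> ^ j * indicator {a..b} \<theta>"
          using \<delta>j by (auto split: split_indicator)
      qed
      also have "(\<integral>\<theta>. 1 - \<delta> ^ j * indicator {a..b} \<theta> \<partial>?U) = 1 - \<delta> ^ j * measure ?U {a..b}"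
        by (subst Bochner_Integration.integral_diff[OF U.integrable_const integrable_mult_right[OF ind]])
          (use U.prob_space in \<open>simp del: measure_uniform_measure\<close>)
      also have "measure ?U {a..b} = \<delta>"
      proof -
        have "{0..2 * pi} \<inter> {a..b} = {a..b}" using ab by auto
        then have "emeasure ?U {a..b} = ennreal \<beta> / ennreal (2 * pi)"
          using ab \<beta>(1) by simp
        also have "\<dots> = ennreal \<delta>"
          using \<beta>(1) by (simp add: \<delta>_def divide_ennreal)
        finally show ?thesis using \<delta> by (simp add: measure_def)
      qed
      finally show "alive (Suc (Suc j)) x \<le> ennreal (1 - \<delta> ^ Suc j)" by (simp add: mult.commute del: funpow.simps)
    qed
  qed
  obtain J where J: "\<Delta> < real J * (\<epsilon> / 2)"
    using reals_Archimedean3[of "\<epsilon> / 2"] \<epsilon>(1) by auto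
  have "alive (Suc J) x \<le> ennreal (1 - \<delta> ^ J)" if "x \<in> middle" for x
  proof -
    have "dist x q \<le> \<Delta>" using that by (intro \<Delta>(2)) (auto simp: middle_def)
    then show ?thesis using main[of J] J that by force
  qed
  moreover have "0 < \<delta> ^ J" "\<delta> ^ J \<le> 1" using \<delta> by (auto intro: power_le_one)
  ultimately show ?thesis by blast
qed


section \<open>The probability of surviving forever\<close>

definition survival :: "complex \<Rightarrow> ennreal" where
  "survival x = (INF n. alive n x)"

lemma measurable_survival [measurable]: "survival \<in> borel_measurable borel"
  unfolding survival_def[abs_def] by measurable

lemma survival_le: "survival x \<le> alive n x"
  unfolding survival_def by (rule INF_lower) simp

lemma survival_le_1: "x \<in> domain \<Longrightarrow> survival x \<le> 1"
  using survival_le[of x 0] by simp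

text \<open>Downward monotone convergence, legitimate because \<open>kernel x\<close> has finite
  mass.\<close>

lemma survival_le_op:
  assumes "x \<in> domain"
  shows "survival x \<le> kernel.op survival x"
proof -
  have "kernel.op survival x = (INF n. kernel.op (alive n) x)"
    unfolding kernel.op_def[of survival] kernel.op_def[of "alive _"] survival_def
  proof (rule nn_integral_monotone_convergence_INF_AE'[where f = "\<lambda>n. alive n"])
    show "AE y in kernel x. alive (Suc n) y \<le> alive n y" for n
      by (rule eventually_mono[OF kernel.AE_Q_E alive_Suc_le])
    have "(\<integral>\<^sup>+y. alive 0 y \<partial>kernel x) \<le> (\<integral>\<^sup>+y. 1 \<partial>kernel x)"
      by (intro nn_integral_mono) (simp split: split_indicator)
    also have "\<dots> \<le> 1" using kernel.emeasure_Q_le[of x UNIV] by simp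
    finally show "(\<integral>\<^sup>+y. alive 0 y \<partial>kernel x) < \<infinity>" by (auto intro: le_less_trans)
  qed measurable
  moreover have "survival x \<le> kernel.op (alive n) x" for n
    using survival_le[of x "Suc n"] by simp
  ultimately show ?thesis by (simp add: INF_greatest)
qed

lemma survival_le_op_pow:
  assumes "x \<in> domain"
  shows "survival x \<le> (kernel.op ^^ n) survival x"
  using assms
proof (induction n arbitrary: x)
  case (Suc n)
  have "kernel.op survival x \<le> kernel.op ((kernel.op ^^ n) survival) x"
    by (rule kernel.op_mono) (rule Suc.IH)
  then show ?case using survival_le_op[OF Suc.prems] by simp
qed simp

lemma survival_child:
  assumes x: "x \<in> domain" "x \<in> outer_layer D \<epsilon>"
  shows "\<exists>y\<in>domain. (y = x + h x *\<^sub>R (e1 x + e2 x) \<or> y = x + h x *\<^sub>R (e1 x - e2 x)) \<and>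
    survival x \<le> ennreal (1 - p_a x) * survival y"
proof -
  let ?y1 = "x + h x *\<^sub>R (e1 x + e2 x)" and ?y2 = "x + h x *\<^sub>R (e1 x - e2 x)"
  define y where "y = (if survival ?y1 \<le> survival ?y2 then ?y2 else ?y1)"
  have y: "y \<in> domain" "y = ?y1 \<or> y = ?y2" using stencil_points[OF x(2)] by (auto simp: y_def)
  have "survival x \<le> kernel.op survival x" using x(1) by (rule survival_le_op)
  also have "\<dots> = ennreal (1 - p_a x) * ((survival ?y1 + survival ?y2) / 2)"
    using x stencil_symmetric[OF x(2), of survival] unfolding kernel.op_def
    by (subst nn_integral_kernel) (auto simp: middle_def outer_h_def p_a_def)
  also have "(survival ?y1 + survival ?y2) / 2 \<le> (2 * survival y) / 2"
    by (intro divide_right_mono_ennreal) (auto simp: y_def mult_2 add_mono)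
  also have "(2 * survival y) / 2 = survival y"
    unfolding mult.commute[of 2] by (rule ennreal_mult_divide_eq) auto
  finally show ?thesis
    using y by (auto simp: mult_left_mono)
qed

lemma survival_zero: "x \<in> domain \<Longrightarrow> survival x = 0"
proof -
  obtain N \<delta> where \<delta>: "0 < \<delta>" "\<delta> \<le> 1" and N: "\<And>x. x \<in> middle \<Longrightarrow> alive N x \<le> ennreal (1 - \<delta>)"
    using escape_middle by blast
  define m where "m = (SUP x\<in>domain. survival x)"
  have m: "survival x \<le> m" if "x \<in> domain" for x
    unfolding m_def using that by (rule SUP_upper)
  have m1: "m \<le> 1" unfolding m_def using survival_le_1 by (rule SUP_least)
  define \<mu> where "\<mu> = m * ennreal (1 - \<delta>)"
  have middle: "survival x \<le> \<mu>" if x: "x \<in> middle" for x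
  proof -
    have xd: "x \<in> domain" using x by (auto simp: middle_def)
    have "survival x \<le> (kernel.op ^^ N) survival x" using xd by (rule survival_le_op_pow)
    also have "\<dots> \<le> (kernel.op ^^ N) (\<lambda>x. m * indicator domain x) x"
      by (rule kernel.op_pow_mono[OF _ xd]) (simp add: m)
    also have "\<dots> = m * alive N x"
      by (simp add: kernel.op_pow_cmult)
    also have "\<dots> \<le> \<mu>" unfolding \<mu>_def using N[OF x] by (rule mult_left_mono) simp
    finally show ?thesis .
  qed
  have inner: "survival x \<le> \<mu>" if "x \<in> inner_layer D T \<epsilon>" for x
    using survival_le[of x "Suc 0"] alive_inner[OF that, of 0] by simp
  have outer: "survival x0 \<le> \<mu>" if x0: "x0 \<in> domain" for x0
  proof (rule ccontr)
    assume neg: "\<not> survival x0 \<le> \<mu>"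
    \<comment> \<open>Survival at a good point exceeds \<open>\<mu>\<close>, so it can lie neither
      in \<open>middle\<close> nor in the inner layer. The more viable child inherits goodness,
      because the factor \<open>1 - p_a x\<close> is at most 1.\<close>
    define good where "good x \<longleftrightarrow> x \<in> domain \<and> survival x0 \<le> survival x" for x
    have good_outer: "x \<in> outer_layer D \<epsilon>" if "good x" for x
      using that neg middle[of x] inner[of x] unfolding good_def middle_def by (meson DiffI order_trans)
    have "\<exists>y. good y \<and> (y = x + h x *\<^sub>R (e1 x + e2 x) \<or> y = x + h x *\<^sub>R (e1 x - e2 x)) \<and>
        survival x \<le> ennreal (1 - p_a x) * survival y" if gx: "good x" for x
    proof -
      have xo: "x \<in> outer_layer D \<epsilon>" using gx by (rule good_outer)
      obtain y where y: "y \<in> domain" "y = x + h x *\<^sub>R (e1 x + e2 x) \<or> y = x + h x *\<^sub>R (e1 x - e2 x)"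
          "survival x \<le> ennreal (1 - p_a x) * survival y"
        using survival_child[OF _ xo] gx unfolding good_def by blast
      have "ennreal (1 - p_a x) \<le> 1" using p_a_bounds[OF xo] by simp
      then have "ennreal (1 - p_a x) * survival y \<le> 1 * survival y" by (rule mult_right_mono) simp
      then have "good y" using y gx unfolding good_def by (metis mult_1 order_trans)
      then show ?thesis using y by blast
    qed
    then obtain next_pt where next_pt: "\<And>x. good x \<Longrightarrow> good (next_pt x)"
        "\<And>x. good x \<Longrightarrow> next_pt x = x + h x *\<^sub>R (e1 x + e2 x) \<or> next_pt x = x + h x *\<^sub>R (e1 x - e2 x)"
        "\<And>x. good x \<Longrightarrow> survival x \<le> ennreal (1 - p_a x) * survival (next_pt x)"
      by metis
    define X where "X j = (next_pt ^^ j) x0" for j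
    have X_Suc: "X (Suc j) = next_pt (X j)" for j by (simp add: X_def)
    have good_X: "good (X j)" for j
      by (induction j) (use x0 next_pt(1) in \<open>auto simp: X_def good_def\<close>)
    define w where "w j = enn2real (survival (X j))" for j
    have X_domain: "X j \<in> domain" for j using good_X by (simp add: good_def)
    have w: "survival (X j) = ennreal (w j)" for j
      unfolding w_def using survival_le_1[OF X_domain, of j] by (simp add: le_less_trans)
    have w_nonneg: "w j \<ge> 0" for j by (simp add: w_def)
    have w_le: "w j \<le> 1" for j
      using survival_le_1[OF X_domain, of j] unfolding w by simp
    have w0: "w 0 > 0"
      using neg w[of 0] w_nonneg[of 0] by (cases "w 0 = 0") (auto simp: X_def less_le)
    have w_ge: "w 0 \<le> w j" for j
      using good_X[of j] w[of j] w[of 0] w_nonneg by (simp add: good_def X_def)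
    have p: "0 < p_a (X j)" "p_a (X j) < 1" for j
      using p_a_bounds[OF good_outer[OF good_X]] by auto
    have decay: "w j \<le> (1 - p_a (X j)) * w (Suc j)" for j
    proof -
      have "ennreal (w j) \<le> ennreal (1 - p_a (X j)) * ennreal (w (Suc j))"
        using next_pt(3)[OF good_X[of j]] by (simp add: w X_Suc[symmetric])
      also have "\<dots> = ennreal ((1 - p_a (X j)) * w (Suc j))"
        using p[of j] w_nonneg by (simp add: ennreal_mult)
      finally show ?thesis using p[of j] w_nonneg by (simp add: ennreal_le_iff mult_nonneg_nonneg)
    qed
    \<comment> \<open>By \<open>decay\<close>, \<open>p_a (X j) * w 0\<close> is at most
      \<open>w (Suc j) - w j\<close>, and \<open>h\<close> is at most \<open>(h0 + z) * p_a\<close>.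
      So \<open>h\<close> is dominated by \<open>c\<close> times the increments of a sequence
      bounded by 1, which telescope.\<close>
    define c where "c = (h0 + z) / w 0"
    have c: "c \<ge> 0" using h0 z w0 by (simp add: c_def)
    have h_bound: "h (X j) \<le> c * (w (Suc j) - w j)" for j
    proof -
      have o: "X j \<in> outer_layer D \<epsilon>" using good_outer[OF good_X] .
      have "p_a (X j) * w 0 \<le> p_a (X j) * w (Suc j)"
        using p[of j] w_ge[of "Suc j"] by (intro mult_left_mono) auto
      also have "\<dots> \<le> w (Suc j) - w j" using decay[of j] by (simp add: algebra_simps)
      finally have 1: "p_a (X j) * w 0 \<le> w (Suc j) - w j" .
      have "h (X j) \<le> (h0 + z) * p_a (X j)"
        using h_pos[OF o] h_le[OF o] z by (simp add: p_a_def field_simps)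
      also have "(h0 + z) * p_a (X j) = c * (p_a (X j) * w 0)" using w0 by (simp add: c_def)
      also have "\<dots> \<le> c * (w (Suc j) - w j)" using c 1 by (intro mult_left_mono)
      finally show ?thesis .
    qed
    have "summable (\<lambda>j. h (X j))"
    proof (rule bounded_imp_summable)
      show "0 \<le> h (X j)" for j using h_pos[OF good_outer[OF good_X]] by (simp add: less_imp_le)
      show "(\<Sum>j\<le>n. h (X j)) \<le> c" for n
      proof -
        have "(\<Sum>j\<le>n. h (X j)) \<le> (\<Sum>j<Suc n. c * (w (Suc j) - w j))"
          unfolding lessThan_Suc_atMost by (intro sum_mono h_bound)
        also have "\<dots> = c * (w (Suc n) - w 0)"
          by (simp only: sum_distrib_left[symmetric] sum_lessThan_telescope)
        also have "\<dots> \<le> c * 1" using c w_le[of "Suc n"] w0 by (intro mult_left_mono) auto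
        finally show ?thesis by simp
      qed
    qed
    moreover have "X (Suc j) = X j + h (X j) *\<^sub>R (e1 (X j) + e2 (X j)) \<or> X (Suc j) = X j + h (X j) *\<^sub>R (e1 (X j) - e2 (X j))" for j
      using next_pt(2)[OF good_X[of j]] by (simp add: X_Suc)
    ultimately show False
      using no_trapped_path[of X] good_outer[OF good_X] by blast
  qed
  have "m \<le> \<mu>" unfolding m_def using outer by (rule SUP_least)
  then have "m = 0"
  proof -
    obtain r where r: "m = ennreal r" "r \<ge> 0" using m1 by (cases m) (auto simp: top_unique)
    have "r \<le> r * (1 - \<delta>)"
      using \<open>m \<le> \<mu>\<close> r \<delta> by (simp add: \<mu>_def ennreal_mult[symmetric])
    then have "r * \<delta> \<le> 0" by (simp add: algebra_simps)
    then have "r = 0" using r \<delta>(1) by (simp add: mult_le_0_iff)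
    then show ?thesis using r by simp
  qed
  then show "x \<in> domain \<Longrightarrow> survival x = 0" using m[of x] by simp
qed

lemma alive_tendsto_zero:
  assumes "x \<in> domain"
  shows "(\<lambda>n. alive n x) \<longlonglongrightarrow> 0"
proof -
  have "decseq (\<lambda>n. alive n x)"
    by (rule decseq_SucI) (rule alive_Suc_le[OF assms])
  then have "(\<lambda>n. alive n x) \<longlonglongrightarrow> survival x"
    unfolding survival_def by (rule LIMSEQ_INF)
  then show ?thesis using survival_zero[OF assms] by simp
qed

end

section \<open>The score function\<close>

lemma integral_scale_measure:
  fixes f :: "'a \<Rightarrow> real"
  assumes [measurable]: "f \<in> borel_measurable M" and c: "0 \<le> c"
  shows "(\<integral>x. f x \<partial>scale_measure (ennreal c) M) = c * (\<integral>x. f x \<partial>M)"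
proof -
  have "scale_measure (ennreal c) M = density M (\<lambda>_. ennreal c)"
    by (rule measure_eqI) (simp_all add: emeasure_density_const)
  then show ?thesis using c by (simp add: integral_density)
qed

lemma integral_uniform_measure_Icc:
  fixes f :: "real \<Rightarrow> real"
  assumes ab: "a < b" and cont: "continuous_on {a..b} f" and [measurable]: "f \<in> borel_measurable borel"
    and I: "(f has_integral I) {a..b}"
  shows "(\<integral>x. f x \<partial>uniform_measure lborel {a..b}) = I / (b - a)"
proof -
  have "uniform_measure lborel {a..b} = density lborel (\<lambda>x. ennreal (indicator {a..b} x / (b - a)))"
    unfolding uniform_measure_def using ab
    by (intro density_cong) (auto simp: divide_ennreal[symmetric] split: split_indicator)
  then have "(\<integral>x. f x \<partial>uniform_measure lborel {a..b}) = (\<integral>x. (indicator {a..b} x / (b - a)) * f x \<partial>lborel)"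
    using ab by (simp add: integral_density)
  also have "\<dots> = (\<integral>x. (indicator {a..b} x *\<^sub>R f x) / (b - a) \<partial>lborel)"
    by (intro Bochner_Integration.integral_cong) auto
  also have "\<dots> = (LINT x:{a..b}|lborel. f x) / (b - a)"
    by (simp add: set_lebesgue_integral_def)
  also have "(LINT x:{a..b}|lborel. f x) = integral {a..b} f"
    using borel_integrable_atLeastAtMost'[OF cont] by (rule set_borel_integral_eq_integral(2))
  also have "\<dots> = I" using I by (rule integral_unique)
  finally show ?thesis .
qed

context reflecting_walk begin

context
  fixes c :: real and \<phi> u :: "complex \<Rightarrow> real"
  assumes sol: "robin_solution D T z c \<nu> \<phi> u"
begin

lemma u_continuous: "continuous_on domain u"
  using sol by (simp add: robin_solution_def)

lemma harmonic_on_u: "harmonic_on u (D - closure T)"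
proof
  show "open (D - closure T)" using D(1) by (simp add: open_Diff)
qed (use sol in \<open>simp_all add: robin_solution_def\<close>)

lemma u_bounded: "\<exists>B>0. \<forall>x\<in>domain. \<bar>u x\<bar> \<le> B"
proof -
  have "bounded (u ` domain)"
    using compact_continuous_image[OF u_continuous compact_domain] by (rule compact_imp_bounded)
  then show ?thesis by (force simp: bounded_pos)
qed

text \<open>Nothing is known about \<open>u\<close> off the state space; the cut-off is Borel on the
  plane and agrees with \<open>u\<close> wherever the walk can go.\<close>

definition v :: "complex \<Rightarrow> real" where
  "v x = indicator domain x *\<^sub>R u x"

lemma v_eq: "x \<in> domain \<Longrightarrow> v x = u x"
  by (simp add: v_def)

lemma measurable_v [measurable]: "v \<in> borel_measurable borel"
  unfolding v_def[abs_def] by (rule borel_measurable_continuous_on_indicator[OF sets_domain u_continuous])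

lemma one_minus_p_a: "x \<in> outer_layer D \<epsilon> \<Longrightarrow> 1 - p_a x = z / (h x + z)"
  using h_pos[of x] z by (simp add: p_a_def field_simps)

text \<open>The local error is by definition the defect of the discrete Robin condition, so
  \<open>\<phi>\<close> cancels between \<open>score\<close> and \<open>h * r1\<close>.\<close>

lemma F_outer:
  assumes "x \<in> outer_layer D \<epsilon>"
  shows "F \<phi> u x = u x - (1 - p_a x) * R u x"
  using assms h_pos[OF assms] by (simp add: F_def score_def r1_def one_minus_p_a)

lemma integral_sphere_step:
  assumes x: "x \<in> middle"
  shows "(\<integral>y. v y \<partial>sphere_step x) = u x"
proof -
  interpret harmonic_on u "D - closure T" by (rule harmonic_on_u)
  have r: "radius x > 0" using radius_middle[OF x] \<epsilon>(1) by simp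
  define f where "f \<theta> = v (x + radius x *\<^sub>R cis \<theta>)" for \<theta>
  have f: "f \<theta> = u (x + radius x *\<^sub>R cis \<theta>)" for \<theta>
    by (simp add: f_def v_eq[OF circle_in_domain[OF x]])
  have "((\<lambda>t. u (x + radius x *\<^sub>R cis (2 * pi * t))) has_integral u x) {0..1}"
    using r ball_radius[OF x] continuous_on_subset[OF u_continuous cball_radius[OF x]] by (rule mean_value)
  moreover have "(\<lambda>t. t / (2 * pi)) ` {0..2 * pi} = {0..1}"
    using image_divide_atLeastAtMost[of "2 * pi" 0 "2 * pi"] by simp
  ultimately have I: "(f has_integral (2 * pi * u x)) {0..2 * pi}"
    using has_integral_stretch_real_iff[of "2 * pi" f "u x" 0 "2 * pi"] by (simp add: f)
  have cont: "continuous_on UNIV (\<lambda>\<theta>. u (x + radius x *\<^sub>R cis \<theta>))"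
    by (rule continuous_on_compose2[OF u_continuous])
      (auto intro!: continuous_intros simp: circle_in_domain[OF x, simplified])
  then have cont: "continuous_on A f" for A
    unfolding f[abs_def] by (rule continuous_on_subset) simp
  have [measurable]: "(\<lambda>\<theta>. x + radius x *\<^sub>R cis \<theta>) \<in> borel_measurable borel"
    by (intro borel_measurable_continuous_onI continuous_intros)
  have "(\<integral>y. v y \<partial>sphere_step x) = (\<integral>\<theta>. f \<theta> \<partial>uniform_measure lborel {0..2 * pi})"
    unfolding sphere_step_def radius_def[symmetric] f_def
    by (rule integral_distr) measurable
  also have "\<dots> = 2 * pi * u x / (2 * pi - 0)"
    using I by (intro integral_uniform_measure_Icc cont borel_measurable_continuous_onI) simp_all
  finally show ?thesis by simp
qed

lemma u_eq_integral_add_F: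
  assumes x: "x \<in> domain"
  shows "u x = (\<integral>y. v y \<partial>kernel x) + F \<phi> u x"
proof (cases rule: kernel_cases[of x])
  case 2
  have "(\<integral>y. v y \<partial>stencil_step x) = (\<integral>b. v (if b then x + h x *\<^sub>R (e1 x + e2 x) else x + h x *\<^sub>R (e1 x - e2 x)) \<partial>measure_pmf (bernoulli_pmf (1 / 2)))"
    unfolding stencil_step_def by (rule integral_distr) simp_all
  also have "\<dots> = R u x"
    using stencil_points[OF 2(2)] by (simp add: R_def v_eq del: Diff_iff)
  finally have "(\<integral>y. v y \<partial>kernel x) = (1 - p_a x) * R u x"
    using 2 p_a_bounds[OF 2(2)] by (simp add: integral_scale_measure measurable_cong_sets[OF sets_stencil_step refl])
  then show ?thesis using 2 by (simp add: F_outer)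
next
  case 3
  then show ?thesis by (simp add: F_def r0_def)
next
  case 4
  then show ?thesis by (simp add: F_def integral_sphere_step)
qed (use x in simp)

text \<open>The choices \<open>\<pi>D\<close> and \<open>\<pi>T\<close> are not assumed measurable,
  so \<open>F\<close> is represented as \<open>v\<close> minus its integral against the
  kernel.\<close>

lemma measurable_F: "(\<lambda>x. indicator domain x *\<^sub>R F \<phi> u x) \<in> borel_measurable borel"
proof -
  have "(\<lambda>x. indicator domain x *\<^sub>R (v x - (\<integral>y. v y \<partial>kernel x))) \<in> borel_measurable borel"
    using measurable_compose[OF measurable_kernel integral_measurable_subprob_algebra[OF measurable_v]]
    by measurable
  also have "(\<lambda>x. indicator domain x *\<^sub>R (v x - (\<integral>y. v y \<partial>kernel x))) = (\<lambda>x. indicator domain x *\<^sub>R F \<phi> u x)"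
    using u_eq_integral_add_F by (auto simp: fun_eq_iff v_eq split: split_indicator)
  finally show ?thesis .
qed

text \<open>The hole makes \<open>domain\<close> non-convex. But within distance \<open>d\<close> of
  a point of the outer layer, \<open>D\<close> is convex and away from \<open>closure T\<close>, and
  the bounded gradient gives the estimate; at distance \<open>d\<close> or more the bound on
  \<open>u\<close> suffices.\<close>

lemma u_Lipschitz:
  "\<exists>L\<ge>0. \<forall>x\<in>outer_layer D \<epsilon> \<inter> domain. \<forall>y\<in>domain. \<bar>u x - u y\<bar> \<le> L * dist x y"
proof -
  obtain G where G: "continuous_on domain G"
      "\<And>x. x \<in> D - closure T \<Longrightarrow> (u has_derivative (\<lambda>v. G x \<bullet> v)) (at x)"
    using sol by (auto simp: robin_solution_def)
  have "bounded (G ` domain)"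
    using compact_continuous_image[OF G(1) compact_domain] by (rule compact_imp_bounded)
  then obtain K where K: "K > 0" "\<And>x. x \<in> domain \<Longrightarrow> norm (G x) \<le> K"
    by (auto simp: bounded_pos)
  obtain B where B: "B > 0" "\<And>x. x \<in> domain \<Longrightarrow> \<bar>u x\<bar> \<le> B" using u_bounded by blast
  have "compact (outer_layer D \<epsilon> \<inter> domain)"
    using compact_domain closed_outer_layer by (simp add: closed_Int_compact)
  moreover have "outer_layer D \<epsilon> \<inter> domain \<inter> closure T = {}"
    using frontier_T_inner \<epsilon>(2) T(1) by (auto simp: frontier_def interior_open)
  ultimately obtain d where d: "d > 0" "\<And>x y. x \<in> outer_layer D \<epsilon> \<inter> domain \<Longrightarrow> y \<in> closure T \<Longrightarrow> d \<le> dist x y"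
    using separate_compact_closed[of "outer_layer D \<epsilon> \<inter> domain" "closure T"] by auto
  obtain q where q: "q \<in> D" using D(4) by auto
  have "\<bar>u x - u y\<bar> \<le> max K (2 * B / d) * dist x y" if x: "x \<in> outer_layer D \<epsilon> \<inter> domain" and y: "y \<in> domain" for x y
  proof (cases "dist x y < d")
    case False
    have "\<bar>u x - u y\<bar> \<le> 2 * B" using B(2)[of x] B(2)[OF y] x by auto
    also have "\<dots> = (2 * B / d) * d" using d(1) by simp
    also have "\<dots> \<le> max K (2 * B / d) * dist x y"
      using False B(1) d(1) K(1) by (intro mult_mono) (auto simp: le_max_iff_disj)
    finally show ?thesis .
  next
    case True
    define s :: "nat \<Rightarrow> real" where "s n = inverse (real (Suc n))" for n
    have s: "0 < s n" "s n \<le> 1" for n by (auto simp: s_def field_simps)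
    have s_lim: "s \<longlonglongrightarrow> 0" unfolding s_def by (rule LIMSEQ_inverse_real_of_nat)
    \<comment> \<open>Both points may lie on \<open>frontier D\<close>, where no derivative of
      \<open>u\<close> is given; they are pulled towards the interior point \<open>q\<close>, and
      the estimate passes to the limit.\<close>
    define xs ys where "xs n = x - s n *\<^sub>R (x - q)" and "ys n = y - s n *\<^sub>R (y - q)" for n
    have "xs \<longlonglongrightarrow> x - 0 *\<^sub>R (x - q)" unfolding xs_def by (intro tendsto_intros s_lim)
    then have xs_lim: "xs \<longlonglongrightarrow> x" by simp
    have "ys \<longlonglongrightarrow> y - 0 *\<^sub>R (y - q)" unfolding ys_def by (intro tendsto_intros s_lim)
    then have ys_lim: "ys \<longlonglongrightarrow> y" by simp
    have in_D: "xs n \<in> D" "ys n \<in> D" for n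
      using mem_interior_closure_convex_shrink[OF D(2), of q x "s n"] mem_interior_closure_convex_shrink[OF D(2), of q y "s n"]
        s[of n] q x y D(1) by (auto simp: xs_def ys_def interior_open)
    have "\<forall>\<^sub>F n in sequentially. dist (xs n) x < d"
      using xs_lim d(1) by (rule tendstoD)
    moreover have "\<forall>\<^sub>F n in sequentially. dist (ys n) x < d"
    proof (rule order_tendstoD(2))
      show "(\<lambda>n. dist (ys n) x) \<longlonglongrightarrow> dist y x" by (intro tendsto_intros ys_lim)
    qed (use True in \<open>simp add: dist_commute\<close>)
    ultimately have ev: "\<forall>\<^sub>F n in sequentially. xs n \<in> ball x d \<inter> D \<and> ys n \<in> ball x d \<inter> D"
      by eventually_elim (simp add: in_D dist_commute)
    have sub: "ball x d \<inter> D \<subseteq> D - closure T" using d(2)[OF x] by fastforce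
    have est: "\<forall>\<^sub>F n in sequentially. norm (u (xs n) - u (ys n)) \<le> K * norm (xs n - ys n)"
      using ev
    proof eventually_elim
      case (elim n)
      show ?case
      proof (rule differentiable_bound[of "ball x d \<inter> D"])
        show "convex (ball x d \<inter> D)" using D(2) by (simp add: convex_Int)
        fix w assume w: "w \<in> ball x d \<inter> D"
        then have w': "w \<in> D - closure T" using sub by blast
        show "(u has_derivative (\<lambda>v. G w \<bullet> v)) (at w within ball x d \<inter> D)"
          using G(2)[OF w'] by (rule has_derivative_at_withinI)
        have "w \<in> domain" using w' closure_subset[of D] closure_subset[of T] by auto
        then have "norm (G w \<bullet> v) \<le> K * norm v" for v
          using Cauchy_Schwarz_ineq2[of "G w" v] K(2)[of w] mult_right_mono[of "norm (G w)" K "norm v"] by fastforce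
        then show "onorm (\<lambda>v. G w \<bullet> v) \<le> K" using K(1) by (intro onorm_bound) auto
      qed (use elim in auto)
    qed
    have in_domain: "\<forall>\<^sub>F n in sequentially. xs n \<in> domain" "\<forall>\<^sub>F n in sequentially. ys n \<in> domain"
      using ev sub closure_subset[of D] closure_subset[of T] by (auto elim!: eventually_mono)
    have "(\<lambda>n. u (xs n)) \<longlonglongrightarrow> u x"
      using continuous_on_tendsto_compose[OF u_continuous xs_lim _ in_domain(1)] x by simp
    moreover have "(\<lambda>n. u (ys n)) \<longlonglongrightarrow> u y"
      using continuous_on_tendsto_compose[OF u_continuous ys_lim y in_domain(2)] .
    ultimately have "norm (u x - u y) \<le> K * norm (x - y)"
      by (intro tendsto_le[OF _ _ _ est] tendsto_intros xs_lim ys_lim) simp_all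
    also have "\<dots> \<le> max K (2 * B / d) * dist x y"
      by (simp add: dist_norm mult_right_mono)
    finally show ?thesis by simp
  qed
  then show ?thesis using K(1) by (intro exI[of _ "max K (2 * B / d)"]) auto
qed

text \<open>In the outer layer \<open>F = p_a * u + (1 - p_a) * (u - R u)\<close>. Here
  \<open>u - R u\<close> is at most \<open>2 * L * h\<close> in modulus, and
  \<open>(1 - p_a) * h = z * p_a\<close>; hence the constant \<open>B + 2 * L * z\<close>. In the
  inner layer \<open>F = u\<close> and the killing probability is 1.\<close>

lemma F_le_killing: "\<exists>C>0. \<forall>x\<in>domain. ennreal \<bar>F \<phi> u x\<bar> \<le> ennreal C * kernel.killing x"
proof -
  obtain B where B: "B > 0" "\<And>x. x \<in> domain \<Longrightarrow> \<bar>u x\<bar> \<le> B" using u_bounded by blast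
  obtain L where L: "L \<ge> 0" "\<And>x y. x \<in> outer_layer D \<epsilon> \<inter> domain \<Longrightarrow> y \<in> domain \<Longrightarrow> \<bar>u x - u y\<bar> \<le> L * dist x y"
    using u_Lipschitz by blast
  have "ennreal \<bar>F \<phi> u x\<bar> \<le> ennreal (B + 2 * L * z) * kernel.killing x" if x: "x \<in> domain" for x
  proof (cases rule: kernel_cases[of x])
    case 2
    let ?y1 = "x + h x *\<^sub>R (e1 x + e2 x)" and ?y2 = "x + h x *\<^sub>R (e1 x - e2 x)"
    have xo: "x \<in> outer_layer D \<epsilon> \<inter> domain" using 2 by blast
    have hx: "h x > 0" using h_pos 2 by blast
    have "norm (e1 x + e2 x) \<le> 2" "norm (e1 x - e2 x) \<le> 2"
      using norm_e1[OF 2(2)] tangent[OF 2(2)] norm_triangle_ineq[of "e1 x" "e2 x"] norm_triangle_ineq4[of "e1 x" "e2 x"] by simp_all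
    then have "dist x ?y1 \<le> h x * 2" "dist x ?y2 \<le> h x * 2"
      using hx by (simp_all add: dist_norm mult_left_mono)
    then have "L * dist x ?y1 \<le> L * (h x * 2)" "L * dist x ?y2 \<le> L * (h x * 2)"
      using L(1) by (intro mult_left_mono; simp)+
    then have "\<bar>u x - u ?y1\<bar> \<le> L * (h x * 2)" "\<bar>u x - u ?y2\<bar> \<le> L * (h x * 2)"
      using L(2)[OF xo stencil_points(1)[OF 2(2)]] L(2)[OF xo stencil_points(2)[OF 2(2)]] by linarith+
    moreover have "R u x = (u ?y1 + u ?y2) / 2" by (simp add: R_def)
    ultimately have diff: "\<bar>u x - R u x\<bar> \<le> 2 * L * h x" by (simp add: abs_le_iff field_simps)
    have p: "0 < p_a x" "p_a x < 1" using p_a_bounds 2 by blast+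
    have "F \<phi> u x = p_a x * u x + (1 - p_a x) * (u x - R u x)"
      using F_outer[OF 2(2)] by (simp add: algebra_simps)
    then have "\<bar>F \<phi> u x\<bar> \<le> \<bar>p_a x * u x\<bar> + \<bar>(1 - p_a x) * (u x - R u x)\<bar>"
      by (simp only: abs_triangle_ineq)
    also have "\<dots> = p_a x * \<bar>u x\<bar> + (1 - p_a x) * \<bar>u x - R u x\<bar>"
      using p by (simp add: abs_mult)
    also have "\<dots> \<le> p_a x * B + (1 - p_a x) * (2 * L * h x)"
      using p B(2)[OF x] diff by (intro add_mono mult_left_mono) auto
    also have "(1 - p_a x) * (2 * L * h x) = 2 * L * z * p_a x"
      using one_minus_p_a[OF 2(2)] by (simp add: p_a_def)
    finally have "\<bar>F \<phi> u x\<bar> \<le> (B + 2 * L * z) * p_a x" by (simp add: algebra_simps)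
    then have "ennreal \<bar>F \<phi> u x\<bar> \<le> ennreal ((B + 2 * L * z) * p_a x)" by (rule ennreal_leI)
    then show ?thesis
      using 2 p B(1) L(1) z by (simp add: killing_eq ennreal_mult)
  next
    case 3
    then have "\<bar>F \<phi> u x\<bar> \<le> B + 2 * L * z"
      using B(2)[OF x] L(1) z by (simp add: F_def r0_def add_increasing2)
    then show ?thesis using 3 by (simp add: killing_eq ennreal_leI)
  next
    case 4
    then show ?thesis by (simp add: F_def)
  qed (use x in simp)
  moreover have "B + 2 * L * z > 0" using B L z by (simp add: add_pos_nonneg)
  ultimately show ?thesis by blast
qed

end

end

section \<open>Unbiasedness and variance\<close>

lemma smooth_closed_curve_simple_path:
  assumes "smooth_closed_curve J"
  obtains g where "simple_path g" "pathfinish g = pathstart g" "path_image g = J"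
proof -
  obtain g :: "real \<Rightarrow> complex" where g: "smooth_on g UNIV" "\<And>t. g (t + 1) = g t" "inj_on g {0..<1}" "J = range g"
    using assms unfolding smooth_closed_curve_def by blast
  have "continuous_on UNIV g" using g(1) unfolding smooth_on_def by (metis Ck_on.simps(1))
  then have "path g" unfolding path_def by (rule continuous_on_subset) simp
  have g1: "g 1 = g 0" using g(2)[of 0] by simp
  have "loop_free g"
    unfolding loop_free_def
  proof (intro ballI impI)
    fix x y :: real assume xy: "x \<in> {0..1}" "y \<in> {0..1}" "g x = g y"
    consider "x < 1" "y < 1" | "x = 1" "y < 1" | "x < 1" "y = 1" | "x = 1" "y = 1"
      using xy(1,2) by fastforce
    then show "x = y \<or> x = 0 \<and> y = 1 \<or> x = 1 \<and> y = 0"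
    proof cases
      case 1
      then show ?thesis using inj_onD[OF g(3) xy(3)] xy by auto
    next
      case 2
      then have "0 = y" using inj_onD[OF g(3), of 0 y] xy g1 by auto
      with 2 show ?thesis by simp
    next
      case 3
      then have "x = 0" using inj_onD[OF g(3), of x 0] xy g1 by auto
      with 3 show ?thesis by simp
    qed simp
  qed
  moreover have "path_image g = J"
  proof
    show "path_image g \<subseteq> J" unfolding path_image_def g(4) by blast
    have int: "g (t + real n) = g t" for t n
      by (induction n) (use g(2)[of "t + real _"] in \<open>auto simp: add_ac\<close>)
    have "g t = g (frac t)" for t
    proof (cases "\<lfloor>t\<rfloor> \<ge> 0")
      case True
      then show ?thesis using int[of "frac t" "nat \<lfloor>t\<rfloor>"] by (simp add: frac_def)
    next
      case False
      then show ?thesis using int[of t "nat (- \<lfloor>t\<rfloor>)"] by (simp add: frac_def)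
    qed
    moreover have "frac t \<in> {0..1}" for t :: real using frac_lt_1[of t] by simp
    ultimately show "J \<subseteq> path_image g" unfolding path_image_def g(4) by blast
  qed
  ultimately show ?thesis
    using that[of g] \<open>path g\<close> g1 by (simp add: simple_path_def pathfinish_def pathstart_def)
qed

section \<open>Topology of the region between the two boundaries, and the final estimate\<close>

context reflecting_walk begin

text \<open>A connected set that meets \<open>T\<close> but not \<open>frontier T\<close> lies in
  \<open>T\<close>. As \<open>T\<close> is bounded, this rules out the outside of the Jordan curve
  \<open>frontier T\<close> and identifies \<open>T\<close> with its inside.\<close>

lemma complement_closure_T:
  "connected (- closure T)" "frontier T \<subseteq> closure (- closure T)"
proof -
  obtain g where g: "simple_path g" "pathfinish g = pathstart g" "path_image g = frontier T"
    using smooth_closed_curve_simple_path[OF T(5)] by metis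
  let ?I = "inside (frontier T)" and ?O = "outside (frontier T)"
  note J = Jordan_inside_outside[OF g(1,2), unfolded g(3)]
  have con: "connected ?I" "connected ?O" and unb: "\<not> bounded ?O" and IO: "?I \<union> ?O = - frontier T"
    and frO: "frontier ?O = frontier T"
    using J by simp_all
  have "bounded T"
    using bounded_subset[OF D(3)] T(4) closure_subset[of T] by blast
  have sub: "S \<subseteq> T" if "connected S" "S \<subseteq> - frontier T" "S \<inter> T \<noteq> {}" for S
    using connected_Int_frontier[OF that(1,3)] that(2) by blast
  have "?O \<inter> T = {}"
    using sub[OF con(2)] IO unb bounded_subset[OF \<open>bounded T\<close>] by blast
  then have TI: "T \<subseteq> ?I" using IO frontier_T(2) by blast
  moreover have "?I \<subseteq> T" using sub[OF con(1)] IO TI T(2) by blast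
  ultimately have "T = ?I" by blast
  then have "closure T = ?I \<union> frontier T"
    using closure_Un_frontier[of T] by simp
  moreover have "?I \<inter> ?O = {}" "?O \<inter> frontier T = {}"
    using inside_Int_outside outside_no_overlap by blast+
  ultimately have O: "- closure T = ?O" using IO by blast
  show "connected (- closure T)" unfolding O by (rule con(2))
  have "frontier ?O \<subseteq> closure ?O" by (simp add: frontier_def)
  then show "frontier T \<subseteq> closure (- closure T)" unfolding O frO .
qed

text \<open>Janiszewski's theorem: the disjoint sets \<open>closure T\<close> and \<open>- D\<close>
  do not separate \<open>a\<close> from \<open>b\<close> individually, hence neither does their
  union.\<close>

lemma connected_D_minus_closure_T: "connected (D - closure T)"
  unfolding connected_iff_connected_component
proof (intro ballI)
  fix a b assume ab: "a \<in> D - closure T" "b \<in> D - closure T"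
  have "compact (closure T)"
    using bounded_subset[OF D(3) T(4)] by (simp add: compact_eq_bounded_closed)
  moreover have "closed (- D)" using D(1) by (simp add: closed_Compl)
  moreover have "connected (closure T \<inter> - D)"
  proof -
    have "closure T \<inter> - D = {}" using T(4) by blast
    then show ?thesis by simp
  qed
  moreover have "connected_component (- closure T) a b"
    using complement_closure_T(1) ab by (simp add: connected_iff_connected_component)
  moreover have "connected_component (- (- D)) a b"
    using convex_connected[OF D(2)] ab by (simp add: connected_iff_connected_component)
  ultimately have "connected_component (- (closure T \<union> - D)) a b"
    by (rule Janiszewski)
  moreover have "- (closure T \<union> - D) = D - closure T" by blast
  ultimately show "connected_component (D - closure T) a b" by simp
qed

text \<open>This carries \<open>u = 0\<close> from the open region to all states. Points of
  \<open>frontier T\<close> are limits of points outside \<open>closure T\<close>, points of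
  \<open>frontier D\<close> limits of points of \<open>D\<close>.\<close>

lemma closure_D_minus_closure_T: "closure (D - closure T) = domain"
proof
  have "D - closure T \<subseteq> domain" using closure_subset[of D] closure_subset[of T] by blast
  then show "closure (D - closure T) \<subseteq> domain" using closed_domain by (rule closure_minimal)
  show "domain \<subseteq> closure (D - closure T)"
  proof
    fix x assume x: "x \<in> domain"
    show "x \<in> closure (D - closure T)"
    proof (cases "x \<in> D")
      case True
      have "x \<in> closure (- closure T)"
      proof (cases "x \<in> closure T")
        case True
        then have "x \<in> frontier T" using x T(1) by (simp add: frontier_def interior_open)
        then show ?thesis using complement_closure_T(2) by blast
      next
        case False
        then show ?thesis using closure_subset[of "- closure T"] by blast
      qed
      then have "x \<in> D \<inter> closure (- closure T)" using True by blast
      also have "\<dots> \<subseteq> closure (D \<inter> - closure T)" using D(1) by (rule open_Int_closure_subset)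
      finally show ?thesis by (simp add: Diff_eq)
    next
      case False
      then have "x \<in> - closure T \<inter> closure D" using x T(4) by blast
      also have "\<dots> \<subseteq> closure (- closure T \<inter> D)" by (rule open_Int_closure_subset) (simp add: open_Compl)
      finally show ?thesis by (simp add: Diff_eq Int_commute)
    qed
  qed
qed

text \<open>Near \<open>frontier T\<close> the function \<open>F\<close> is \<open>u\<close>, whose
  nonzero set \<open>W\<close> there is open and null, hence empty. Unique continuation and density
  then give \<open>u = 0\<close> on the state space, and the equation for \<open>u\<close> gives
  \<open>F = 0\<close>.\<close>

lemma F_zero_of_AE:
  assumes sol: "robin_solution D T z c \<nu> \<phi> u"
    and AE: "AE x in lebesgue_on domain. F \<phi> u x = 0" and x: "x \<in> domain"
  shows "F \<phi> u x = 0"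
proof -
  note u_cont = u_continuous[OF sol]
  interpret U: harmonic_on u "D - closure T" using sol by (rule harmonic_on_u)
  have [measurable]: "domain \<in> sets lebesgue" using sets_domain by auto
  obtain y where y: "y \<in> frontier T" using frontier_T_nonempty by blast
  obtain r where r: "r > 0" "ball y r \<subseteq> D" using D(1) frontier_T(1)[OF y] by (auto simp: open_contains_ball)
  define V where "V = ball y (min r \<epsilon>) - closure T"
  have "open V" by (simp add: V_def open_Diff)
  have V_sub: "V \<subseteq> D - closure T" using r(2) by (auto simp: V_def)
  have "y \<in> ball y (min r \<epsilon>) \<inter> closure (- closure T)"
    using complement_closure_T(2) y r(1) \<epsilon>(1) by auto
  then have "V \<noteq> {}"
    using open_Int_closure_eq_empty[OF open_ball, of y "min r \<epsilon>" "- closure T"]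
    unfolding V_def Diff_eq by blast
  have FV: "F \<phi> u x = u x" if "x \<in> V" for x
  proof -
    have "infdist x (frontier T) \<le> dist x y" using y by (rule infdist_le)
    also have "\<dots> \<le> \<epsilon>" using that by (simp add: V_def dist_commute)
    finally have "x \<in> inner_layer D T \<epsilon>"
      using that V_sub closure_subset[of D] closure_subset[of T] by (auto simp: inner_layer_def)
    then show ?thesis using \<epsilon>(2) by (auto simp: F_def r0_def)
  qed
  define W where "W = V \<inter> u -` (- {0})"
  have "continuous_on V u"
    using U.continuous_on_u V_sub by (rule continuous_on_subset)
  then have "open W"
    unfolding W_def using \<open>open V\<close> by (intro continuous_open_preimage) auto
  have "AE x in lebesgue. x \<in> domain \<longrightarrow> F \<phi> u x = 0"
    using AE by (subst (asm) AE_restrict_space_iff) simp_all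
  then have "AE x in lebesgue. x \<notin> W"
  proof eventually_elim
    case (elim x)
    have "x \<in> domain" if "x \<in> W"
      using that V_sub closure_subset[of D] closure_subset[of T] by (auto simp: W_def)
    then show ?case using elim FV[of x] by (auto simp: W_def)
  qed
  moreover have "W \<in> sets lebesgue" using \<open>open W\<close> by auto
  ultimately have "negligible W" by (simp add: negligible_iff_null_sets AE_iff_null_sets)
  then have "W = {}" using \<open>open W\<close> open_not_negligible by blast
  then have "u x = 0" if "x \<in> V" for x using that by (auto simp: W_def)
  then have "u x = 0" if "x \<in> D - closure T" for x
    using U.unique_continuation[OF connected_D_minus_closure_T \<open>open V\<close> \<open>V \<noteq> {}\<close> V_sub _ that] by blast
  then have zero: "u x = 0" if "x \<in> domain" for x
    using continuous_constant_on_closure[of "D - closure T" u 0 x] u_cont that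
    unfolding closure_D_minus_closure_T by blast
  then have "v u = (\<lambda>x. 0)" by (auto simp: v_def[OF sol] split: split_indicator)
  then show ?thesis
    using u_eq_integral_add_F[OF sol x] zero[OF x] by simp
qed

lemma estimator_unbiased_variance_bound:
  assumes sol: "robin_solution D T z c \<nu> \<phi> u"
  shows "\<exists>C>0. \<forall>x0\<in>domain. \<forall>(M :: 'w measure) (X :: nat \<Rightarrow> 'w \<Rightarrow> complex option).
    markov_chain M X domain k x0 \<longrightarrow>
      (AE \<omega> in M. summable (\<lambda>j. F_ext \<phi> u (X j \<omega>))) \<and>
      integrable M (estimator \<phi> u X) \<and>
      (\<integral>\<omega>. estimator \<phi> u X \<omega> \<partial>M) = u x0 \<and>
      integrable M (\<lambda>\<omega>. (estimator \<phi> u X \<omega>)\<^sup>2) \<and>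
      ereal (\<integral>\<omega>. (estimator \<phi> u X \<omega> - (\<integral>\<omega>'. estimator \<phi> u X \<omega>' \<partial>M))\<^sup>2 \<partial>M)
        \<le> ereal C * (esssup (lebesgue_on domain) (\<lambda>x. ereal \<bar>F \<phi> u x\<bar>))\<^sup>2"
proof -
  define s where "s = esssup (lebesgue_on domain) (\<lambda>x. ereal \<bar>F \<phi> u x\<bar>)"
  obtain K where K: "K > 0" "\<And>x. x \<in> domain \<Longrightarrow> ennreal \<bar>F \<phi> u x\<bar> \<le> ennreal K * kernel.killing x"
    using F_le_killing[OF sol] by blast
  obtain B where B: "\<And>x. x \<in> domain \<Longrightarrow> \<bar>u x\<bar> \<le> B" using u_bounded[OF sol] by blast
  \<comment> \<open>For finite nonzero \<open>s\<close> the quotient of the two bounds serves; an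
    infinite \<open>s\<close> has infinite square, so any constant will do. \<open>C\<close> is
    chosen here, before the starting point and the chain.\<close>
  have "\<exists>C>0. ereal (2 * K\<^sup>2) \<le> ereal C * s\<^sup>2 \<or> s = 0"
  proof (cases s)
    case (real r)
    show ?thesis
    proof (cases "r = 0")
      case False
      then have "2 * K\<^sup>2 = (2 * K\<^sup>2 / r\<^sup>2) * r\<^sup>2" by simp
      then show ?thesis using K(1) False real by (intro exI[of _ "2 * K\<^sup>2 / r\<^sup>2"]) simp
    qed (use real in \<open>auto intro: exI[of _ 1]\<close>)
  qed (auto intro!: exI[of _ 1] simp: power2_eq_square)
  then obtain C where C: "C > 0" "ereal (2 * K\<^sup>2) \<le> ereal C * s\<^sup>2 \<or> s = 0" by blast
  have F_zero: "F \<phi> u x = 0" if "s = 0" "x \<in> domain" for x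
  proof (rule F_zero_of_AE[OF sol _ that(2)])
    have "AE x in lebesgue_on domain. ereal \<bar>F \<phi> u x\<bar> \<le> s" unfolding s_def by (rule esssup_AE)
    then show "AE x in lebesgue_on domain. F \<phi> u x = 0" using that(1) by (auto elim!: eventually_mono)
  qed
  define f where "f x = indicator domain x *\<^sub>R F \<phi> u x" for x
  show ?thesis
    unfolding s_def[symmetric]
  proof (intro exI[of _ C] conjI C(1) ballI allI impI)
    fix x0 and M :: "'w measure" and X :: "nat \<Rightarrow> 'w \<Rightarrow> complex option"
    assume x0: "x0 \<in> domain" and chain: "markov_chain M X domain k x0"
    interpret prob_space M using chain by (simp add: markov_chain_def)
    interpret X: killed_chain domain kernel M X x0
      by unfold_locales (use markov_chain_kernel[OF chain] x0 in auto)
    let ?S = "\<lambda>\<omega>. \<Sum>j. cemetery_ext f (X j \<omega>)"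
    have F_ext: "F_ext \<phi> u (X j \<omega>) = cemetery_ext f (X j \<omega>)" if "\<omega> \<in> space M" for j \<omega>
      by (rule X.X_cases[OF that, of j]) (simp_all add: F_ext_def f_def)
    then have est: "estimator \<phi> u X \<omega> = ?S \<omega>" if "\<omega> \<in> space M" for \<omega>
      using that by (simp add: estimator_def)
    have f: "f \<in> borel_measurable borel" unfolding f_def[abs_def] by (rule measurable_F[OF sol])
    have f_le: "ennreal \<bar>f x\<bar> \<le> ennreal K * kernel.killing x" if "x \<in> domain" for x
      using K(2)[OF that] that by (simp add: f_def)
    have v_le: "\<bar>v u x\<bar> \<le> B" if "x \<in> domain" for x
      using B[OF that] v_eq[OF sol that] by simp
    have v_eq': "v u x = (\<integral>y. v u y \<partial>kernel x) + f x" if "x \<in> domain" for x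
      using u_eq_integral_add_F[OF sol that] that by (simp add: f_def v_eq[OF sol])
    note S = X.unbiased_estimator[OF f measurable_v[OF sol] f_le less_imp_le[OF K(1)] v_le v_eq' alive_tendsto_zero[OF x0]]
    show "AE \<omega> in M. summable (\<lambda>j. F_ext \<phi> u (X j \<omega>))"
      using S(1) by (rule AE_mp) (auto simp: F_ext intro!: AE_I2)
    show int: "integrable M (estimator \<phi> u X)"
      using S(2) by (subst Bochner_Integration.integrable_cong[OF refl est])
    show mean: "expectation (estimator \<phi> u X) = u x0"
      using S(3) v_eq[OF sol x0] by (subst Bochner_Integration.integral_cong[OF refl est]) simp_all
    have sq: "(estimator \<phi> u X \<omega>)\<^sup>2 = (?S \<omega>)\<^sup>2" if "\<omega> \<in> space M" for \<omega>
      by (simp add: est[OF that])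
    show int2: "integrable M (\<lambda>\<omega>. (estimator \<phi> u X \<omega>)\<^sup>2)"
      using S(4) by (subst Bochner_Integration.integrable_cong[OF refl sq])
    have moment: "expectation (\<lambda>\<omega>. (estimator \<phi> u X \<omega>)\<^sup>2) \<le> 2 * K\<^sup>2"
      using S(5) by (subst Bochner_Integration.integral_cong[OF refl sq])
    show "ereal (variance (estimator \<phi> u X)) \<le> ereal C * s\<^sup>2"
    proof (cases "s = 0")
      case True
      have "estimator \<phi> u X \<omega> = 0" if "\<omega> \<in> space M" for \<omega>
      proof -
        have "cemetery_ext f (X j \<omega>) = 0" for j
          by (rule X.X_cases[OF that, of j]) (simp_all add: f_def F_zero[OF True])
        then show ?thesis by (simp add: est[OF that])
      qed
      then have "variance (estimator \<phi> u X) = expectation (\<lambda>\<omega>. 0)"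
        by (simp cong: Bochner_Integration.integral_cong)
      then show ?thesis using True by (simp add: power2_eq_square)
    next
      case False
      have "variance (estimator \<phi> u X) \<le> 2 * K\<^sup>2"
        using moment by (subst variance_eq[OF int int2]) (smt (verit) zero_le_power2)
      then have "ereal (variance (estimator \<phi> u X)) \<le> ereal (2 * K\<^sup>2)" by simp
      also have "\<dots> \<le> ereal C * s\<^sup>2" using C(2) False by simp
      finally show ?thesis .
    qed
  qed
qed

end

theorem theorem1:
  fixes D T :: "complex set" and \<epsilon> z c h0 :: real
    and \<nu> \<pi>D \<pi>T e2 :: "complex \<Rightarrow> complex" and h \<phi> u :: "complex \<Rightarrow> real"
  assumes walk: "reflecting_walk D T \<epsilon> z \<nu> \<pi>D \<pi>T h0 h e2"
    and data: "smooth_boundary_function D \<phi>"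
    and sol: "robin_solution D T z c \<nu> \<phi> u"
  defines "E \<equiv> closure D - T"
  defines "k \<equiv> reflecting_walk.k D T \<epsilon> z \<nu> \<pi>D h e2"
    and "F \<equiv> reflecting_walk.F D T \<epsilon> z \<nu> \<pi>D \<pi>T h e2 \<phi> u"
    and "F_ext \<equiv> reflecting_walk.F_ext D T \<epsilon> z \<nu> \<pi>D \<pi>T h e2 \<phi> u"
    and "estimator \<equiv> reflecting_walk.estimator D T \<epsilon> z \<nu> \<pi>D \<pi>T h e2 \<phi> u"
  shows "\<exists>C>0. \<forall>x0\<in>E. \<forall>(M :: 'w measure) (X :: nat \<Rightarrow> 'w \<Rightarrow> complex option).
           markov_chain M X E k x0 \<longrightarrow>
             (AE \<omega> in M. summable (\<lambda>j. F_ext (X j \<omega>))) \<and>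
             integrable M (estimator X) \<and>
             (\<integral>\<omega>. estimator X \<omega> \<partial>M) = u x0 \<and>
             integrable M (\<lambda>\<omega>. (estimator X \<omega>)\<^sup>2) \<and>
             ereal (\<integral>\<omega>. (estimator X \<omega> - (\<integral>\<omega>'. estimator X \<omega>' \<partial>M))\<^sup>2 \<partial>M)
               \<le> ereal C * (esssup (lebesgue_on E) (\<lambda>x. ereal \<bar>F x\<bar>))\<^sup>2"
  unfolding E_def k_def F_def F_ext_def estimator_def
  by (rule reflecting_walk.estimator_unbiased_variance_bound[OF walk sol])

end
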